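(* Let $f:A\to B$ be an arbitrary object of $\mathcal S$ (an injective $R$-homomorphism of finitely generated $R$-modules). Set $C=\mathrm{Cok}\,f$ and let $g:B\to C$ be the natural projection. Then there exist a projective $R$-module $Q$ and $R$-homomorphisms $h_1:\mathrm{Tr}\,C\to Q$ and $h_2:Q\to \mathrm{Tr}\,A$ such that: (1) $\mathrm{Tr}_{\mathcal M}(f)=\big(\mathrm{Tr}\,C\xrightarrow{[\mathrm{Tr}\,g\ \ h_1]}\mathrm{Tr}\,B\oplus Q\big)$, and the sequence $$\mathrm{Tr}\,C\xrightarrow{[\mathrm{Tr}\,g\ \ h_1]}\mathrm{Tr}\,B\oplus Q\xrightarrow{[\mathrm{Tr}\,f\ \ h_2]^t}\mathrm{Tr}\,A\to 0$$ is exact. (2) If $\mathrm{Ext}^1_R(C,R)=0$, then $\mathrm{Tr}_{\mathcal M}(f)\in\mathcal S$.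
   Context: $(R,\mathfrak m)$ is a commutative noetherian local ring of finite dimension; all modules are finitely generated. $\mathcal M$ is the category whose objects are $R$-homomorphisms $f:A\to B$ of finitely generated $R$-modules and whose morphisms are commutative squares; $\mathcal S$ is its full subcategory of monomorphisms. The projective objects of $\mathcal M$ are the direct sums of objects $P\xrightarrow{1}P$ and $0\to P$ with $P$ finitely generated projective. Write $(-)'=\mathrm{Hom}_R(-,R)$. For an $R$-module $M$ with minimal projective presentation $P_1\to P_0\to M\to 0$, $\mathrm{Tr}\,M=\mathrm{Cok}(P_0'\to P_1')$. A homomorphism $\varphi:M\to N$ induces $\mathrm{Tr}\,\varphi:\mathrm{Tr}\,N\to\mathrm{Tr}\,M$, determined up to maps factoring through projective modules; in the statement $\mathrm{Tr}\,f$, $\mathrm{Tr}\,g$ denote such (representing) induced maps. $[a\ \ b]:X\to Y\oplus Z$ denotes the map with components $a:X\to Y$, $b:X\to Z$; $[a\ \ b]^t:Y\oplus Z\to X$ denotes the map with components $a:Y\to X$, $b:Z\to X$. Transpose in $\mathcal M$. Let $\mathbf r$ be the object $R\to R\oplus R$ (split monomorphism) of $\mathcal M$, i.e. $(R\xrightarrow{1}R)\oplus(0\to R)$, corresponding to the path algebra of the quiver $\bullet_1\to\bullet_2$ over $R$. For $f:A\to B$ in $\mathcal M$ the left module $f^*=\mathrm{Hom}_{\mathcal M}(f,\mathbf r)$ over the path algebra corresponds to the $R$-homomorphism $\mathrm{Hom}_{\mathcal M}(f,(0\to R))\to\mathrm{Hom}_{\mathcal M}(f,(R\xrightarrow{1}R))$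 induced by the inclusion $(0\to R)\to(R\xrightarrow{1}R)$; this is the map $(\mathrm{Cok} f)'\to B'$ and it is regarded again as an object of the category of $R$-homomorphisms. If $f:A\to B$ is in $\mathcal S$ with minimal projective presentation $(P_1\to P_1\oplus Q_1)\to(P_0\to P_0\oplus Q_0)\to f\to 0$ in $\mathcal M$, applying $(-)^*$ gives a morphism $(Q_0'\to P_0'\oplus Q_0')\to(Q_1'\to P_1'\oplus Q_1')$, and $\mathrm{Tr}_{\mathcal M}(f)$ is defined as its cokernel (an $R$-homomorphism). Equality of objects means isomorphism. *)

theory Defs
  imports "HOL-Algebra.Module" "HOL-Algebra.Ring_Divisibility"
begin

section \<open>The base ring\<close>

definition local_ring :: "('a, 'm) ring_scheme \<Rightarrow> bool" where
  "local_ring R \<longleftrightarrow> cring R \<and> (\<exists>!I. maximalideal I R)"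

definition finite_krull_dim :: "('a, 'm) ring_scheme \<Rightarrow> bool" where
  "finite_krull_dim R \<longleftrightarrow>
    (\<exists>n. \<forall>k p. (\<forall>i\<le>k. primeideal (p i) R) \<and> (\<forall>i<k. p i \<subset> p (Suc i)) \<longrightarrow> k \<le> (n::nat))"


section \<open>Modules over \<open>R\<close>\<close>

text \<open>
  The record type of modules in HOL-Algebra extends that of rings; its multiplicative fields play
  no role in the notion of a module and are left \<^const>\<open>undefined\<close> below where there is no obvious
  choice. Homomorphisms are total functions that only matter on the carrier of the source; only
  as elements of a Hom module are they normalised by \<^const>\<open>extensional\<close>.
\<close>

definition reg_mod :: "('a, 'm) ring_scheme \<Rightarrow> ('a, 'a) module" where
  "reg_mod R = \<lparr>carrier = carrier R, monoid.mult = monoid.mult R, monoid.one = \<one>\<^bsub>R\<^esub>,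
     ring.zero = \<zero>\<^bsub>R\<^esub>, ring.add = ring.add R, smult = monoid.mult R\<rparr>"

definition zero_mod :: "('a, 'm) ring_scheme \<Rightarrow> ('a, 'a) module" where
  "zero_mod R = (reg_mod R)\<lparr>carrier := {\<zero>\<^bsub>R\<^esub>}\<rparr>"

definition free_mod :: "('a, 'm) ring_scheme \<Rightarrow> nat \<Rightarrow> ('a, nat \<Rightarrow> 'a) module" where
  "free_mod R n = \<lparr>carrier = {..<n} \<rightarrow>\<^sub>E carrier R, monoid.mult = undefined, monoid.one = undefined,
     ring.zero = (\<lambda>i\<in>{..<n}. \<zero>\<^bsub>R\<^esub>), ring.add = (\<lambda>x y. \<lambda>i\<in>{..<n}. x i \<oplus>\<^bsub>R\<^esub> y i),
     smult = (\<lambda>a x. \<lambda>i\<in>{..<n}. a \<otimes>\<^bsub>R\<^esub> x i)\<rparr>"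

definition dsum :: "('a, 'b) module \<Rightarrow> ('a, 'c) module \<Rightarrow> ('a, 'b \<times> 'c) module" where
  "dsum M N = \<lparr>carrier = carrier M \<times> carrier N, monoid.mult = undefined, monoid.one = undefined,
     ring.zero = (\<zero>\<^bsub>M\<^esub>, \<zero>\<^bsub>N\<^esub>),
     ring.add = (\<lambda>(x, y) (x', y'). (x \<oplus>\<^bsub>M\<^esub> x', y \<oplus>\<^bsub>N\<^esub> y')),
     smult = (\<lambda>a (x, y). (a \<odot>\<^bsub>M\<^esub> x, a \<odot>\<^bsub>N\<^esub> y))\<rparr>"

definition fg_module :: "('a, 'm) ring_scheme \<Rightarrow> ('a, 'b) module \<Rightarrow> bool" where
  "fg_module R M \<longleftrightarrow> module R M \<and>
    (\<exists>S. finite S \<and> S \<subseteq> carrier M \<and> (\<forall>N. submodule N R M \<and> S \<subseteq> N \<longrightarrow> N = carrier M))"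

definition mod_hom :: "('a, 'm) ring_scheme \<Rightarrow> ('a, 'b) module \<Rightarrow> ('a, 'c) module \<Rightarrow> ('b \<Rightarrow> 'c) set"
  where "mod_hom R M N = {h. h \<in> carrier M \<rightarrow> carrier N \<and>
    (\<forall>x\<in>carrier M. \<forall>y\<in>carrier M. h (x \<oplus>\<^bsub>M\<^esub> y) = h x \<oplus>\<^bsub>N\<^esub> h y) \<and>
    (\<forall>a\<in>carrier R. \<forall>x\<in>carrier M. h (a \<odot>\<^bsub>M\<^esub> x) = a \<odot>\<^bsub>N\<^esub> h x)}"

text \<open>Finitely generated projective modules: the direct summands of some \<open>R\<^sup>n\<close>.\<close>

definition fg_projective :: "('a, 'm) ring_scheme \<Rightarrow> ('a, 'b) module \<Rightarrow> bool" where
  "fg_projective R P \<longleftrightarrow> module R P \<and>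
    (\<exists>n. \<exists>i\<in>mod_hom R P (free_mod R n). \<exists>p\<in>mod_hom R (free_mod R n) P.
      \<forall>x\<in>carrier P. p (i x) = x)"

definition Hom_mod :: "('a, 'm) ring_scheme \<Rightarrow> ('a, 'b) module \<Rightarrow> ('a, 'c) module \<Rightarrow>
    ('a, 'b \<Rightarrow> 'c) module" where
  "Hom_mod R M N = \<lparr>carrier = mod_hom R M N \<inter> extensional (carrier M),
     monoid.mult = undefined, monoid.one = undefined,
     ring.zero = (\<lambda>x\<in>carrier M. \<zero>\<^bsub>N\<^esub>),
     ring.add = (\<lambda>h k. \<lambda>x\<in>carrier M. h x \<oplus>\<^bsub>N\<^esub> k x),
     smult = (\<lambda>a h. \<lambda>x\<in>carrier M. a \<odot>\<^bsub>N\<^esub> h x)\<rparr>"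

abbreviation dual :: "('a, 'm) ring_scheme \<Rightarrow> ('a, 'b) module \<Rightarrow> ('a, 'b \<Rightarrow> 'a) module" where
  "dual R M \<equiv> Hom_mod R M (reg_mod R)"

text \<open>The map \<open>Hom(N, L) \<rightarrow> Hom(M, L)\<close> induced by \<open>d : M \<rightarrow> N\<close>.\<close>

definition precomp :: "('a, 'b) module \<Rightarrow> ('b \<Rightarrow> 'c) \<Rightarrow> ('c \<Rightarrow> 'd) \<Rightarrow> ('b \<Rightarrow> 'd)" where
  "precomp M d = (\<lambda>h. compose (carrier M) h d)"

text \<open>The quotient \<open>M/H\<close>; the scalar multiple of \<open>H + x\<close> by \<open>a\<close> is \<open>H + a(H + x) = H + ax\<close>.\<close>

definition quot_mod :: "('a, 'b) module \<Rightarrow> 'b set \<Rightarrow> ('a, 'b set) module" where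
  "quot_mod M H = \<lparr>carrier = a_rcosets\<^bsub>M\<^esub> H, monoid.mult = undefined, monoid.one = undefined,
     ring.zero = H, ring.add = set_add M, smult = (\<lambda>a U. set_add M H ((\<lambda>x. a \<odot>\<^bsub>M\<^esub> x) ` U))\<rparr>"

definition Cok :: "('a, 'b) module \<Rightarrow> ('a, 'c) module \<Rightarrow> ('b \<Rightarrow> 'c) \<Rightarrow> ('a, 'c set) module" where
  "Cok M N h = quot_mod N (h ` carrier M)"

definition cok_proj :: "('a, 'b) module \<Rightarrow> ('a, 'c) module \<Rightarrow> ('b \<Rightarrow> 'c) \<Rightarrow> 'c \<Rightarrow> 'c set" where
  "cok_proj M N h = (\<lambda>y. (h ` carrier M) +>\<^bsub>N\<^esub> y)"

text \<open>The map \<open>Cok h \<rightarrow> Cok (k : M \<rightarrow> N)\<close> induced by a map \<open>v\<close> into \<open>N\<close>; it sends the coset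
  of \<open>y\<close> to the coset of \<open>v y\<close>.\<close>

definition cok_map :: "('a, 'b) module \<Rightarrow> ('a, 'c) module \<Rightarrow> ('b \<Rightarrow> 'c) \<Rightarrow> ('d \<Rightarrow> 'c) \<Rightarrow>
    'd set \<Rightarrow> 'c set" where
  "cok_map M N k v = (\<lambda>Y. set_add N (k ` carrier M) (v ` Y))"


section \<open>Minimal presentations, transpose and \<open>Ext\<close> for modules\<close>

definition superfluous :: "('a, 'm) ring_scheme \<Rightarrow> ('a, 'b) module \<Rightarrow> 'b set \<Rightarrow> bool" where
  "superfluous R M K \<longleftrightarrow>
    (\<forall>L. submodule L R M \<and> set_add M K L = carrier M \<longrightarrow> L = carrier M)"

definition proj_cover :: "('a, 'm) ring_scheme \<Rightarrow> ('a, 'p) module \<Rightarrow> ('p \<Rightarrow> 'b) \<Rightarrow>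
    ('a, 'b) module \<Rightarrow> bool" where
  "proj_cover R P e M \<longleftrightarrow> fg_projective R P \<and> e \<in> mod_hom R P M \<and>
    e ` carrier P = carrier M \<and> superfluous R P (a_kernel P M e)"

text \<open>\<open>P\<^sub>1 \<rightarrow> P\<^sub>0 \<rightarrow> M \<rightarrow> 0\<close>, with maps \<open>d\<close> and \<open>e\<close>.\<close>

definition min_pres :: "('a, 'm) ring_scheme \<Rightarrow> ('a, 'p) module \<Rightarrow> ('p \<Rightarrow> 'q) \<Rightarrow>
    ('a, 'q) module \<Rightarrow> ('q \<Rightarrow> 'b) \<Rightarrow> ('a, 'b) module \<Rightarrow> bool" where
  "min_pres R P1 d P0 e M \<longleftrightarrow> proj_cover R P0 e M \<and>
    proj_cover R P1 d (P0\<lparr>carrier := a_kernel P0 M e\<rparr>)"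

definition Tr :: "('a, 'm) ring_scheme \<Rightarrow> ('a, 'p) module \<Rightarrow> ('p \<Rightarrow> 'q) \<Rightarrow> ('a, 'q) module \<Rightarrow>
    ('a, ('p \<Rightarrow> 'a) set) module" where
  "Tr R P1 d P0 = Cok (dual R P0) (dual R P1) (precomp P1 d)"

text \<open>
  \<open>is_Tr_map R P1 d P0 e Q1 d' Q0 e' f t\<close>: the map \<open>t : Tr N \<rightarrow> Tr M\<close> is induced by
  \<open>f : M \<rightarrow> N\<close>, where \<open>P1 \<rightarrow> P0 \<rightarrow> M\<close> and \<open>Q1 \<rightarrow> Q0 \<rightarrow> N\<close> are the presentations
  defining the transposes. Different choices of the lift \<open>(f\<^sub>1, f\<^sub>0)\<close> yield maps that differ by one
  factoring through a projective module, and all such maps arise in this way.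
\<close>

definition is_Tr_map :: "('a, 'm) ring_scheme \<Rightarrow>
    ('a, 'p1) module \<Rightarrow> ('p1 \<Rightarrow> 'p0) \<Rightarrow> ('a, 'p0) module \<Rightarrow> ('p0 \<Rightarrow> 'b) \<Rightarrow>
    ('a, 'q1) module \<Rightarrow> ('q1 \<Rightarrow> 'q0) \<Rightarrow> ('a, 'q0) module \<Rightarrow> ('q0 \<Rightarrow> 'c) \<Rightarrow>
    ('b \<Rightarrow> 'c) \<Rightarrow> (('q1 \<Rightarrow> 'a) set \<Rightarrow> ('p1 \<Rightarrow> 'a) set) \<Rightarrow> bool" where
  "is_Tr_map R P1 d P0 e Q1 d' Q0 e' f t \<longleftrightarrow>
    (\<exists>f1\<in>mod_hom R P1 Q1. \<exists>f0\<in>mod_hom R P0 Q0.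
      (\<forall>x\<in>carrier P0. e' (f0 x) = f (e x)) \<and>
      (\<forall>x\<in>carrier P1. d' (f1 x) = f0 (d x)) \<and>
      (\<forall>U\<in>carrier (Tr R Q1 d' Q0).
        t U = cok_map (dual R P0) (dual R P1) (precomp P1 d) (precomp P1 f1) U))"

text \<open>\<open>\<dots> \<rightarrow> P 2 \<rightarrow> P 1 \<rightarrow> P 0 \<rightarrow> M \<rightarrow> 0\<close>, with maps \<open>d n : P (n+1) \<rightarrow> P n\<close> and \<open>e : P 0 \<rightarrow> M\<close>.\<close>

definition proj_resolution :: "('a, 'm) ring_scheme \<Rightarrow> (nat \<Rightarrow> ('a, 'p) module) \<Rightarrow>
    (nat \<Rightarrow> 'p \<Rightarrow> 'p) \<Rightarrow> ('p \<Rightarrow> 'b) \<Rightarrow> ('a, 'b) module \<Rightarrow> bool" where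
  "proj_resolution R P d e M \<longleftrightarrow>
    (\<forall>n. fg_projective R (P n) \<and> d n \<in> mod_hom R (P (Suc n)) (P n)) \<and>
    e \<in> mod_hom R (P 0) M \<and> e ` carrier (P 0) = carrier M \<and>
    d 0 ` carrier (P 1) = a_kernel (P 0) M e \<and>
    (\<forall>n. d (Suc n) ` carrier (P (Suc (Suc n))) = a_kernel (P (Suc n)) (P n) (d n))"

text \<open>\<open>Ext\<^sup>n(M, N) = H\<^sup>n(Hom(P, N))\<close>, computed from a projective resolution \<open>(P, d)\<close> of \<open>M\<close>.\<close>

definition Ext :: "('a, 'm) ring_scheme \<Rightarrow> nat \<Rightarrow> (nat \<Rightarrow> ('a, 'p) module) \<Rightarrow>
    (nat \<Rightarrow> 'p \<Rightarrow> 'p) \<Rightarrow> ('a, 'b) module \<Rightarrow> ('a, ('p \<Rightarrow> 'b) set) module" where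
  "Ext R n P d N = quot_mod
     ((Hom_mod R (P n) N)\<lparr>carrier :=
        a_kernel (Hom_mod R (P n) N) (Hom_mod R (P (Suc n)) N) (precomp (P (Suc n)) (d n))\<rparr>)
     (case n of 0 \<Rightarrow> {\<zero>\<^bsub>Hom_mod R (P 0) N\<^esub>}
      | Suc m \<Rightarrow> precomp (P (Suc m)) (d m) ` carrier (Hom_mod R (P m) N))"


section \<open>The category of homomorphisms\<close>

record ('a, 'x, 'y) mobj =
  src :: "('a, 'x) module"
  tgt :: "('a, 'y) module"
  arr :: "'x \<Rightarrow> 'y"

definition M_obj :: "('a, 'm) ring_scheme \<Rightarrow> ('a, 'x, 'y) mobj \<Rightarrow> bool" where
  "M_obj R F \<longleftrightarrow> fg_module R (src F) \<and> fg_module R (tgt F) \<and> arr F \<in> mod_hom R (src F) (tgt F)"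

definition S_obj :: "('a, 'm) ring_scheme \<Rightarrow> ('a, 'x, 'y) mobj \<Rightarrow> bool" where
  "S_obj R F \<longleftrightarrow> M_obj R F \<and> inj_on (arr F) (carrier (src F))"

definition M_hom :: "('a, 'm) ring_scheme \<Rightarrow> ('a, 'x, 'y) mobj \<Rightarrow> ('a, 'z, 'w) mobj \<Rightarrow>
    (('x \<Rightarrow> 'z) \<times> ('y \<Rightarrow> 'w)) set" where
  "M_hom R F G = {(u, v). u \<in> mod_hom R (src F) (src G) \<and> v \<in> mod_hom R (tgt F) (tgt G) \<and>
     (\<forall>x\<in>carrier (src F). v (arr F x) = arr G (u x))}"

definition M_iso :: "('a, 'm) ring_scheme \<Rightarrow> ('a, 'x, 'y) mobj \<Rightarrow> ('a, 'z, 'w) mobj \<Rightarrow> bool" where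
  "M_iso R F G \<longleftrightarrow> (\<exists>(u, v)\<in>M_hom R F G.
     bij_betw u (carrier (src F)) (carrier (src G)) \<and>
     bij_betw v (carrier (tgt F)) (carrier (tgt G)))"

definition id_obj :: "('a, 'x) module \<Rightarrow> ('a, 'x, 'x) mobj" where
  "id_obj P = \<lparr>src = P, tgt = P, arr = (\<lambda>x. x)\<rparr>"

definition zero_obj :: "('a, 'm) ring_scheme \<Rightarrow> ('a, 'x) module \<Rightarrow> ('a, 'a, 'x) mobj" where
  "zero_obj R P = \<lparr>src = zero_mod R, tgt = P, arr = (\<lambda>_. \<zero>\<^bsub>P\<^esub>)\<rparr>"

definition M_dsum :: "('a, 'x, 'y) mobj \<Rightarrow> ('a, 'z, 'w) mobj \<Rightarrow> ('a, 'x \<times> 'z, 'y \<times> 'w) mobj" where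
  "M_dsum F G = \<lparr>src = dsum (src F) (src G), tgt = dsum (tgt F) (tgt G),
     arr = map_prod (arr F) (arr G)\<rparr>"

text \<open>
  Projective objects, up to isomorphism. Up to isomorphism every finitely generated projective
  module is a direct summand of some \<open>R\<^sup>n\<close>, so the element type \<^typ>\<open>nat \<Rightarrow> 'a\<close> is no restriction.
\<close>

definition M_projective :: "('a, 'm) ring_scheme \<Rightarrow> ('a, 'x, 'y) mobj \<Rightarrow> bool" where
  "M_projective R F \<longleftrightarrow> M_obj R F \<and>
    (\<exists>(P :: ('a, nat \<Rightarrow> 'a) module) (Q :: ('a, nat \<Rightarrow> 'a) module).
      fg_projective R P \<and> fg_projective R Q \<and> M_iso R F (M_dsum (id_obj P) (zero_obj R Q)))"

definition M_ker :: "('a, 'x, 'y) mobj \<Rightarrow> ('a, 'z, 'w) mobj \<Rightarrow> ('x \<Rightarrow> 'z) \<times> ('y \<Rightarrow> 'w) \<Rightarrow>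
    ('a, 'x, 'y) mobj" where
  "M_ker F G m = \<lparr>src = (src F)\<lparr>carrier := a_kernel (src F) (src G) (fst m)\<rparr>,
     tgt = (tgt F)\<lparr>carrier := a_kernel (tgt F) (tgt G) (snd m)\<rparr>, arr = arr F\<rparr>"

definition M_cok :: "('a, 'x, 'y) mobj \<Rightarrow> ('a, 'z, 'w) mobj \<Rightarrow> ('x \<Rightarrow> 'z) \<times> ('y \<Rightarrow> 'w) \<Rightarrow>
    ('a, 'z set, 'w set) mobj" where
  "M_cok F G m = \<lparr>src = Cok (src F) (src G) (fst m), tgt = Cok (tgt F) (tgt G) (snd m),
     arr = cok_map (tgt F) (tgt G) (snd m) (arr G)\<rparr>"

definition M_superfluous :: "('a, 'm) ring_scheme \<Rightarrow> ('a, 'x, 'y) mobj \<Rightarrow> 'x set \<Rightarrow> 'y set \<Rightarrow> bool"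
  where "M_superfluous R F K K' \<longleftrightarrow>
    (\<forall>L L'. submodule L R (src F) \<and> submodule L' R (tgt F) \<and> arr F ` L \<subseteq> L' \<and>
      set_add (src F) K L = carrier (src F) \<and> set_add (tgt F) K' L' = carrier (tgt F) \<longrightarrow>
      L = carrier (src F) \<and> L' = carrier (tgt F))"

definition M_proj_cover :: "('a, 'm) ring_scheme \<Rightarrow> ('a, 'x, 'y) mobj \<Rightarrow>
    ('x \<Rightarrow> 'z) \<times> ('y \<Rightarrow> 'w) \<Rightarrow> ('a, 'z, 'w) mobj \<Rightarrow> bool" where
  "M_proj_cover R F m G \<longleftrightarrow> M_projective R F \<and> m \<in> M_hom R F G \<and>
    fst m ` carrier (src F) = carrier (src G) \<and> snd m ` carrier (tgt F) = carrier (tgt G) \<and>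
    M_superfluous R F (carrier (src (M_ker F G m))) (carrier (tgt (M_ker F G m)))"

definition M_min_pres :: "('a, 'm) ring_scheme \<Rightarrow> ('a, 'x1, 'y1) mobj \<Rightarrow>
    ('x1 \<Rightarrow> 'x0) \<times> ('y1 \<Rightarrow> 'y0) \<Rightarrow> ('a, 'x0, 'y0) mobj \<Rightarrow>
    ('x0 \<Rightarrow> 'b) \<times> ('y0 \<Rightarrow> 'c) \<Rightarrow> ('a, 'b, 'c) mobj \<Rightarrow> bool" where
  "M_min_pres R F1 \<delta> F0 \<epsilon> F \<longleftrightarrow>
    M_proj_cover R F0 \<epsilon> F \<and> M_proj_cover R F1 \<delta> (M_ker F0 F \<epsilon>)"


section \<open>The transpose in the category of homomorphisms\<close>

definition M_Hom_mod :: "('a, 'm) ring_scheme \<Rightarrow> ('a, 'x, 'y) mobj \<Rightarrow> ('a, 'z, 'w) mobj \<Rightarrow>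
    ('a, ('x \<Rightarrow> 'z) \<times> ('y \<Rightarrow> 'w)) module" where
  "M_Hom_mod R F G =
    (dsum (Hom_mod R (src F) (src G)) (Hom_mod R (tgt F) (tgt G)))
      \<lparr>carrier := M_hom R F G \<inter> (extensional (carrier (src F)) \<times> extensional (carrier (tgt F)))\<rparr>"

text \<open>
  \<open>F\<^sup>*\<close> is the homomorphism \<open>Hom(F, 0 \<rightarrow> R) \<rightarrow> Hom(F, R = R)\<close> given by composition with the
  inclusion of \<open>0 \<rightarrow> R\<close> into \<open>R = R\<close>. Both components of that inclusion are \<open>\<lambda>r. r\<close>, since the
  zero module is realised as the zero submodule of \<open>R\<close>.
\<close>

definition star :: "('a, 'm) ring_scheme \<Rightarrow> ('a, 'x, 'y) mobj \<Rightarrow>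
    ('a, ('x \<Rightarrow> 'a) \<times> ('y \<Rightarrow> 'a), ('x \<Rightarrow> 'a) \<times> ('y \<Rightarrow> 'a)) mobj" where
  "star R F = \<lparr>src = M_Hom_mod R F (zero_obj R (reg_mod R)),
     tgt = M_Hom_mod R F (id_obj (reg_mod R)),
     arr = (\<lambda>(a, b). (compose (carrier (src F)) (\<lambda>r. r) a, compose (carrier (tgt F)) (\<lambda>r. r) b))\<rparr>"

text \<open>The morphism \<open>G\<^sup>* \<rightarrow> F\<^sup>*\<close> induced by a morphism \<open>m : F \<rightarrow> G\<close>; its two components are given
  by the same formula.\<close>

definition star_map :: "('a, 'x, 'y) mobj \<Rightarrow> ('x \<Rightarrow> 'z) \<times> ('y \<Rightarrow> 'w) \<Rightarrow>
    (('z \<Rightarrow> 'a) \<times> ('w \<Rightarrow> 'a) \<Rightarrow> ('x \<Rightarrow> 'a) \<times> ('y \<Rightarrow> 'a)) \<times>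
    (('z \<Rightarrow> 'a) \<times> ('w \<Rightarrow> 'a) \<Rightarrow> ('x \<Rightarrow> 'a) \<times> ('y \<Rightarrow> 'a))" where
  "star_map F m = (let k = map_prod (precomp (src F) (fst m)) (precomp (tgt F) (snd m)) in (k, k))"

definition Tr_M :: "('a, 'm) ring_scheme \<Rightarrow> ('a, 'x1, 'y1) mobj \<Rightarrow>
    ('x1 \<Rightarrow> 'x0) \<times> ('y1 \<Rightarrow> 'y0) \<Rightarrow> ('a, 'x0, 'y0) mobj \<Rightarrow>
    ('a, (('x1 \<Rightarrow> 'a) \<times> ('y1 \<Rightarrow> 'a)) set, (('x1 \<Rightarrow> 'a) \<times> ('y1 \<Rightarrow> 'a)) set) mobj" where
  "Tr_M R F1 \<delta> F0 = M_cok (star R F0) (star R F1) (star_map F1 \<delta>)"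

end

theory Submission
  imports Defs
begin

text \<open>
  Splitting the projective objects \<open>F\<^sub>i\<close> of a minimal presentation of \<open>f\<close> as \<open>X\<^sub>i \<rightarrow> Y\<^sub>i \<rightarrow> Q\<^sub>i\<close>, the
  outer terms form minimal presentations of \<open>A\<close> and \<open>C\<close>, while \<open>Y\<^sub>1 \<rightarrow> Y\<^sub>0\<close> is a presentation of \<open>B\<close>
  that need not be minimal. Dualising, \<open>Tr\<^sub>M f\<close> is the first map in a right exact sequence
  \<open>Tr C \<rightarrow> Cok(Y\<^sub>0' \<rightarrow> Y\<^sub>1') \<rightarrow> Tr A \<rightarrow> 0\<close>. The minimal presentation of \<open>B\<close> is a retract of
  \<open>Y\<^sub>1 \<rightarrow> Y\<^sub>0\<close>, and the other composite is homotopic to the identity; hence the middle term is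
  \<open>Tr B \<oplus> Q\<close> with \<open>Q\<close> a retract of the projective module \<open>Y\<^sub>1'\<close>. For the second part, an element of
  the kernel of \<open>Tr\<^sub>M f\<close> yields a functional on \<open>A\<close>, and it vanishes once this functional extends
  to \<open>B\<close>, which \<open>Ext\<^sup>1(C, R) = 0\<close> guarantees.
\<close>

section \<open>Modules and their homomorphisms\<close>

context cring begin

text \<open>Superfluity in the category is tested against compatible pairs of submodules only, and
  this is why the targets give a presentation of \<open>B\<close> that may be too large.
  Multiplication by a nonzerodivisor of the maximal ideal on \<open>R\<close> is an example: the
  target of the cover is \<open>R \<oplus> R\<close>, although \<open>R\<close> alone covers
  \<open>B\<close>. The surplus over the minimal presentation is made of pieces
  \<open>P = P\<close>, whose dual has zero cokernel, and pieces \<open>P \<rightarrow> 0\<close>,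
  which contribute the dual of \<open>P\<close> to the cokernel. The latter are the origin of
  \<open>Q\<close>. This decomposition is never formed; a homotopy yields an idempotent of the
  cokernel instead, and \<open>Q\<close> is its image. A second obstacle is that the transposes
  consist of cosets of functions, or of pairs of functions, of many different types. Each is
  therefore accessed through one relation, \<open>transp\<close>, in which its elements are named by
  functionals on the degree 1 term. Maps between transposes are then precompositions, and equations
  between them reduce to equations between maps of projective modules.\<close>

lemma mod_add_closed [simp]:
  "\<lbrakk>module R M; x \<in> carrier M; y \<in> carrier M\<rbrakk> \<Longrightarrow> x \<oplus>\<^bsub>M\<^esub> y \<in> carrier M"
  by (meson abelian_groupE(1) module.axioms(2))

lemma mod_zero_closed [simp]: "module R M \<Longrightarrow> \<zero>\<^bsub>M\<^esub> \<in> carrier M"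
  by (meson abelian_groupE(2) module.axioms(2))

lemma mod_diff_closed [simp]:
  "\<lbrakk>module R M; x \<in> carrier M; y \<in> carrier M\<rbrakk> \<Longrightarrow> x \<ominus>\<^bsub>M\<^esub> y \<in> carrier M"
  by (meson abelian_group.minus_closed module.axioms(2))

lemma mod_smult_closed [simp]:
  "\<lbrakk>module R M; a \<in> carrier R; x \<in> carrier M\<rbrakk> \<Longrightarrow> a \<odot>\<^bsub>M\<^esub> x \<in> carrier M"
  by (rule module.smult_closed)

lemma mod_add_zero [simp]:
  assumes "module R M" "x \<in> carrier M"
  shows "x \<oplus>\<^bsub>M\<^esub> \<zero>\<^bsub>M\<^esub> = x" "\<zero>\<^bsub>M\<^esub> \<oplus>\<^bsub>M\<^esub> x = x"
proof -
  interpret module R M by fact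
  show "x \<oplus>\<^bsub>M\<^esub> \<zero>\<^bsub>M\<^esub> = x" "\<zero>\<^bsub>M\<^esub> \<oplus>\<^bsub>M\<^esub> x = x"
    using assms by simp_all
qed

lemma mod_add_assoc:
  "\<lbrakk>module R M; x \<in> carrier M; y \<in> carrier M; z \<in> carrier M\<rbrakk>
    \<Longrightarrow> (x \<oplus>\<^bsub>M\<^esub> y) \<oplus>\<^bsub>M\<^esub> z = x \<oplus>\<^bsub>M\<^esub> (y \<oplus>\<^bsub>M\<^esub> z)"
  by (meson abelian_groupE(3) module.axioms(2))

lemma mod_add_commute:
  "\<lbrakk>module R M; x \<in> carrier M; y \<in> carrier M\<rbrakk> \<Longrightarrow> x \<oplus>\<^bsub>M\<^esub> y = y \<oplus>\<^bsub>M\<^esub> x"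
  by (meson abelian_groupE(4) module.axioms(2))

lemma mod_add_left_commute:
  assumes "module R M" "x \<in> carrier M" "y \<in> carrier M" "z \<in> carrier M"
  shows "x \<oplus>\<^bsub>M\<^esub> (y \<oplus>\<^bsub>M\<^esub> z) = y \<oplus>\<^bsub>M\<^esub> (x \<oplus>\<^bsub>M\<^esub> z)"
proof -
  interpret module R M by fact
  show ?thesis using assms by (simp add: M.a_lcomm)
qed

lemma mod_diff_add [simp]:
  assumes "module R M" "x \<in> carrier M" "y \<in> carrier M"
  shows "(x \<ominus>\<^bsub>M\<^esub> y) \<oplus>\<^bsub>M\<^esub> y = x" "y \<oplus>\<^bsub>M\<^esub> (x \<ominus>\<^bsub>M\<^esub> y) = x"
    "(x \<oplus>\<^bsub>M\<^esub> y) \<ominus>\<^bsub>M\<^esub> y = x" "(y \<oplus>\<^bsub>M\<^esub> x) \<ominus>\<^bsub>M\<^esub> y = x"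
proof -
  interpret module R M by fact
  have "(\<ominus>\<^bsub>M\<^esub> y) \<oplus>\<^bsub>M\<^esub> y = \<zero>\<^bsub>M\<^esub>" "y \<oplus>\<^bsub>M\<^esub> (\<ominus>\<^bsub>M\<^esub> y) = \<zero>\<^bsub>M\<^esub>"
    using assms by (simp_all add: M.l_neg M.r_neg)
  then show "(x \<ominus>\<^bsub>M\<^esub> y) \<oplus>\<^bsub>M\<^esub> y = x" "y \<oplus>\<^bsub>M\<^esub> (x \<ominus>\<^bsub>M\<^esub> y) = x"
    "(x \<oplus>\<^bsub>M\<^esub> y) \<ominus>\<^bsub>M\<^esub> y = x" "(y \<oplus>\<^bsub>M\<^esub> x) \<ominus>\<^bsub>M\<^esub> y = x"
    using assms by (simp_all add: a_minus_def M.a_assoc M.a_lcomm M.minus_add M.a_comm)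
qed

lemma mod_diff_self [simp]: "\<lbrakk>module R M; x \<in> carrier M\<rbrakk> \<Longrightarrow> x \<ominus>\<^bsub>M\<^esub> x = \<zero>\<^bsub>M\<^esub>"
  using mod_diff_add(4)[of M "\<zero>\<^bsub>M\<^esub>" x] by simp

lemma mod_diff_zero [simp]: "\<lbrakk>module R M; x \<in> carrier M\<rbrakk> \<Longrightarrow> x \<ominus>\<^bsub>M\<^esub> \<zero>\<^bsub>M\<^esub> = x"
  using mod_diff_add(1)[of M x "\<zero>\<^bsub>M\<^esub>"] by simp

lemma mod_eq_diff_iff:
  "\<lbrakk>module R M; x \<in> carrier M; y \<in> carrier M; z \<in> carrier M\<rbrakk>
    \<Longrightarrow> x = y \<ominus>\<^bsub>M\<^esub> z \<longleftrightarrow> x \<oplus>\<^bsub>M\<^esub> z = y"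
  by (metis mod_diff_add(1,3))

lemma mod_diff_eq_zero_iff [simp]:
  "\<lbrakk>module R M; x \<in> carrier M; y \<in> carrier M\<rbrakk> \<Longrightarrow> x \<ominus>\<^bsub>M\<^esub> y = \<zero>\<^bsub>M\<^esub> \<longleftrightarrow> x = y"
  by (metis mod_add_zero(2) mod_diff_add(1) mod_diff_self)

lemma mod_add_cancel_left:
  "\<lbrakk>module R M; x \<in> carrier M; y \<in> carrier M; z \<in> carrier M\<rbrakk>
    \<Longrightarrow> x \<oplus>\<^bsub>M\<^esub> y = x \<oplus>\<^bsub>M\<^esub> z \<longleftrightarrow> y = z"
  by (metis mod_diff_add(4))

lemma mod_smult_add:
  "\<lbrakk>module R M; a \<in> carrier R; x \<in> carrier M; y \<in> carrier M\<rbrakk>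
    \<Longrightarrow> a \<odot>\<^bsub>M\<^esub> (x \<oplus>\<^bsub>M\<^esub> y) = a \<odot>\<^bsub>M\<^esub> x \<oplus>\<^bsub>M\<^esub> a \<odot>\<^bsub>M\<^esub> y"
  by (rule module.smult_r_distr)

lemma mod_smult_zero [simp]: "\<lbrakk>module R M; a \<in> carrier R\<rbrakk> \<Longrightarrow> a \<odot>\<^bsub>M\<^esub> \<zero>\<^bsub>M\<^esub> = \<zero>\<^bsub>M\<^esub>"
  by (rule module.smult_r_null)

lemma mod_smult_diff:
  "\<lbrakk>module R M; a \<in> carrier R; x \<in> carrier M; y \<in> carrier M\<rbrakk>
    \<Longrightarrow> a \<odot>\<^bsub>M\<^esub> (x \<ominus>\<^bsub>M\<^esub> y) = a \<odot>\<^bsub>M\<^esub> x \<ominus>\<^bsub>M\<^esub> a \<odot>\<^bsub>M\<^esub> y"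
  by (metis mod_diff_add(3) mod_diff_add(1) mod_diff_closed mod_smult_add mod_smult_closed)

text \<open>Additive inverses are not asked for: \<open>(\<ominus> \<one>) \<odot> x\<close> serves
  as the inverse of \<open>x\<close>, and the hypothesis on the scalar zero is there for this
  purpose.\<close>

lemma moduleI':
  assumes "\<And>x y. \<lbrakk>x \<in> carrier M; y \<in> carrier M\<rbrakk> \<Longrightarrow> x \<oplus>\<^bsub>M\<^esub> y \<in> carrier M"
    and "\<zero>\<^bsub>M\<^esub> \<in> carrier M"
    and "\<And>x y z. \<lbrakk>x \<in> carrier M; y \<in> carrier M; z \<in> carrier M\<rbrakk> \<Longrightarrow>
      (x \<oplus>\<^bsub>M\<^esub> y) \<oplus>\<^bsub>M\<^esub> z = x \<oplus>\<^bsub>M\<^esub> (y \<oplus>\<^bsub>M\<^esub> z)"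
    and "\<And>x y. \<lbrakk>x \<in> carrier M; y \<in> carrier M\<rbrakk> \<Longrightarrow> x \<oplus>\<^bsub>M\<^esub> y = y \<oplus>\<^bsub>M\<^esub> x"
    and "\<And>x. x \<in> carrier M \<Longrightarrow> \<zero>\<^bsub>M\<^esub> \<oplus>\<^bsub>M\<^esub> x = x"
    and sc: "\<And>a x. \<lbrakk>a \<in> carrier R; x \<in> carrier M\<rbrakk> \<Longrightarrow> a \<odot>\<^bsub>M\<^esub> x \<in> carrier M"
    and sl: "\<And>a b x. \<lbrakk>a \<in> carrier R; b \<in> carrier R; x \<in> carrier M\<rbrakk> \<Longrightarrow>
      (a \<oplus> b) \<odot>\<^bsub>M\<^esub> x = a \<odot>\<^bsub>M\<^esub> x \<oplus>\<^bsub>M\<^esub> b \<odot>\<^bsub>M\<^esub> x"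
    and "\<And>a x y. \<lbrakk>a \<in> carrier R; x \<in> carrier M; y \<in> carrier M\<rbrakk> \<Longrightarrow>
      a \<odot>\<^bsub>M\<^esub> (x \<oplus>\<^bsub>M\<^esub> y) = a \<odot>\<^bsub>M\<^esub> x \<oplus>\<^bsub>M\<^esub> a \<odot>\<^bsub>M\<^esub> y"
    and "\<And>a b x. \<lbrakk>a \<in> carrier R; b \<in> carrier R; x \<in> carrier M\<rbrakk> \<Longrightarrow>
      (a \<otimes> b) \<odot>\<^bsub>M\<^esub> x = a \<odot>\<^bsub>M\<^esub> (b \<odot>\<^bsub>M\<^esub> x)"
    and so: "\<And>x. x \<in> carrier M \<Longrightarrow> \<one> \<odot>\<^bsub>M\<^esub> x = x"
    and sz: "\<And>x. x \<in> carrier M \<Longrightarrow> \<zero> \<odot>\<^bsub>M\<^esub> x = \<zero>\<^bsub>M\<^esub>"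
  shows "module R M"
proof (rule moduleI[OF is_cring])
  show "abelian_group M"
  proof (rule abelian_groupI)
    fix x assume x: "x \<in> carrier M"
    have "(\<ominus> \<one>) \<odot>\<^bsub>M\<^esub> x \<oplus>\<^bsub>M\<^esub> x = ((\<ominus> \<one>) \<oplus> \<one>) \<odot>\<^bsub>M\<^esub> x"
      using x by (simp add: sl so)
    also have "\<dots> = \<zero>\<^bsub>M\<^esub>" using x by (simp add: sz l_neg)
    finally show "\<exists>y\<in>carrier M. y \<oplus>\<^bsub>M\<^esub> x = \<zero>\<^bsub>M\<^esub>" using x sc by blast
  qed (use assms in auto)
qed (use assms in auto)

section \<open>Homomorphisms of modules\<close>

lemma mod_homI:
  assumes "\<And>x. x \<in> carrier M \<Longrightarrow> h x \<in> carrier N"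
    and "\<And>x y. \<lbrakk>x \<in> carrier M; y \<in> carrier M\<rbrakk> \<Longrightarrow> h (x \<oplus>\<^bsub>M\<^esub> y) = h x \<oplus>\<^bsub>N\<^esub> h y"
    and "\<And>a x. \<lbrakk>a \<in> carrier R; x \<in> carrier M\<rbrakk> \<Longrightarrow> h (a \<odot>\<^bsub>M\<^esub> x) = a \<odot>\<^bsub>N\<^esub> h x"
  shows "h \<in> mod_hom R M N"
  using assms by (auto simp: mod_hom_def)

lemma mod_hom_closed: "\<lbrakk>h \<in> mod_hom R M N; x \<in> carrier M\<rbrakk> \<Longrightarrow> h x \<in> carrier N"
  by (auto simp: mod_hom_def)

lemma mod_hom_add: 
  "\<lbrakk>h \<in> mod_hom R M N; x \<in> carrier M; y \<in> carrier M\<rbrakk> \<Longrightarrow> h (x \<oplus>\<^bsub>M\<^esub> y) = h x \<oplus>\<^bsub>N\<^esub> h y"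
  unfolding mod_hom_def by blast

lemma mod_hom_smult:
  "\<lbrakk>h \<in> mod_hom R M N; a \<in> carrier R; x \<in> carrier M\<rbrakk> \<Longrightarrow> h (a \<odot>\<^bsub>M\<^esub> x) = a \<odot>\<^bsub>N\<^esub> h x"
  unfolding mod_hom_def by blast

lemmas mod_hom_rules = mod_hom_closed mod_hom_add mod_hom_smult

lemma mod_hom_zero:
  "\<lbrakk>h \<in> mod_hom R M N; module R M; module R N\<rbrakk> \<Longrightarrow> h \<zero>\<^bsub>M\<^esub> = \<zero>\<^bsub>N\<^esub>"
proof -
  assume h: "h \<in> mod_hom R M N" and MN: "module R M" "module R N"
  have "h (\<zero>\<^bsub>M\<^esub> \<oplus>\<^bsub>M\<^esub> \<zero>\<^bsub>M\<^esub>) = h \<zero>\<^bsub>M\<^esub> \<oplus>\<^bsub>N\<^esub> h \<zero>\<^bsub>M\<^esub>"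
    by (rule mod_hom_add[OF h]) (simp_all add: MN)
  then have "h \<zero>\<^bsub>M\<^esub> \<oplus>\<^bsub>N\<^esub> h \<zero>\<^bsub>M\<^esub> = h \<zero>\<^bsub>M\<^esub> \<oplus>\<^bsub>N\<^esub> \<zero>\<^bsub>N\<^esub>"
    using mod_hom_closed[OF h] MN by simp
  then show ?thesis using mod_hom_closed[OF h] MN by (simp add: mod_add_cancel_left del: mod_add_zero)
qed

lemma mod_hom_diff:
  "\<lbrakk>h \<in> mod_hom R M N; module R M; module R N; x \<in> carrier M; y \<in> carrier M\<rbrakk>
    \<Longrightarrow> h (x \<ominus>\<^bsub>M\<^esub> y) = h x \<ominus>\<^bsub>N\<^esub> h y"
proof -
  assume h: "h \<in> mod_hom R M N" and MN: "module R M" "module R N" and xy: "x \<in> carrier M" "y \<in> carrier M"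
  have "h (x \<ominus>\<^bsub>M\<^esub> y) \<oplus>\<^bsub>N\<^esub> h y = h x"
    using mod_hom_add[OF h, of "x \<ominus>\<^bsub>M\<^esub> y" y] xy MN by simp
  then show ?thesis using mod_hom_closed[OF h] MN xy by (simp add: mod_eq_diff_iff)
qed

lemma mod_hom_cong:
  assumes "h \<in> mod_hom R M N" "module R M" "\<And>x. x \<in> carrier M \<Longrightarrow> k x = h x"
  shows "k \<in> mod_hom R M N"
  by (rule mod_homI) (use assms mod_hom_rules[OF assms(1)] in simp_all)

lemma mod_hom_comp [intro]:
  "\<lbrakk>h \<in> mod_hom R M N; k \<in> mod_hom R N L\<rbrakk> \<Longrightarrow> (\<lambda>x. k (h x)) \<in> mod_hom R M L"
  by (rule mod_homI) (simp_all add: mod_hom_rules[of h] mod_hom_rules[of k])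

lemma mod_hom_id [intro, simp]: "(\<lambda>x. x) \<in> mod_hom R M M"
  by (simp add: mod_hom_def)

lemma mod_hom_zero_fun [intro, simp]: "module R N \<Longrightarrow> (\<lambda>x. \<zero>\<^bsub>N\<^esub>) \<in> mod_hom R M N"
  by (simp add: mod_hom_def)

lemma mod_hom_add_fun [intro]:
  "\<lbrakk>h \<in> mod_hom R M N; k \<in> mod_hom R M N; module R N\<rbrakk>
    \<Longrightarrow> (\<lambda>x. h x \<oplus>\<^bsub>N\<^esub> k x) \<in> mod_hom R M N"
  by (rule mod_homI)
    (simp_all add: mod_hom_rules[of h M N] mod_hom_rules[of k M N] mod_smult_add mod_add_assoc mod_add_left_commute)

lemma mod_hom_diff_fun [intro]:
  assumes h: "h \<in> mod_hom R M N" and k: "k \<in> mod_hom R M N" and M: "module R M" and N: "module R N"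
  shows "(\<lambda>x. h x \<ominus>\<^bsub>N\<^esub> k x) \<in> mod_hom R M N"
proof (rule mod_homI)
  note cl = mod_hom_rules[OF h] mod_hom_rules[OF k]
  fix x y assume xy: "x \<in> carrier M" "y \<in> carrier M"
  have "(h x \<ominus>\<^bsub>N\<^esub> k x) \<oplus>\<^bsub>N\<^esub> (h y \<ominus>\<^bsub>N\<^esub> k y) \<oplus>\<^bsub>N\<^esub> (k x \<oplus>\<^bsub>N\<^esub> k y)
    = ((h x \<ominus>\<^bsub>N\<^esub> k x) \<oplus>\<^bsub>N\<^esub> k x) \<oplus>\<^bsub>N\<^esub> ((h y \<ominus>\<^bsub>N\<^esub> k y) \<oplus>\<^bsub>N\<^esub> k y)"
    using cl N xy by (simp add: mod_add_assoc mod_add_left_commute del: mod_diff_add)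
  also have "\<dots> = h x \<oplus>\<^bsub>N\<^esub> h y" using cl N xy by simp
  finally show "h (x \<oplus>\<^bsub>M\<^esub> y) \<ominus>\<^bsub>N\<^esub> k (x \<oplus>\<^bsub>M\<^esub> y) = h x \<ominus>\<^bsub>N\<^esub> k x \<oplus>\<^bsub>N\<^esub> (h y \<ominus>\<^bsub>N\<^esub> k y)"
    using cl N xy by (simp add: mod_eq_diff_iff eq_commute)
qed (use M N mod_hom_rules[OF h] mod_hom_rules[OF k] in \<open>simp_all add: mod_smult_diff\<close>)

lemma mod_hom_smult_fun:
  "\<lbrakk>h \<in> mod_hom R M N; a \<in> carrier R; module R N\<rbrakk> \<Longrightarrow> (\<lambda>x. a \<odot>\<^bsub>N\<^esub> h x) \<in> mod_hom R M N"
  by (rule mod_homI)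
    (simp_all add: mod_hom_rules[of h M N] mod_smult_add module.smult_assoc1[symmetric] m_comm)

lemma a_kernel_iff [simp]: "x \<in> a_kernel M N h \<longleftrightarrow> x \<in> carrier M \<and> h x = \<zero>\<^bsub>N\<^esub>"
  by (simp add: a_kernel_def')

section \<open>Submodules, kernels, images and factorisation\<close>

lemma submoduleI':
  assumes M: "module R M" and "H \<subseteq> carrier M" "\<zero>\<^bsub>M\<^esub> \<in> H"
    and "\<And>x y. \<lbrakk>x \<in> H; y \<in> H\<rbrakk> \<Longrightarrow> x \<oplus>\<^bsub>M\<^esub> y \<in> H"
    and sm: "\<And>a x. \<lbrakk>a \<in> carrier R; x \<in> H\<rbrakk> \<Longrightarrow> a \<odot>\<^bsub>M\<^esub> x \<in> H"
  shows "submodule H R M"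
proof (rule module.submoduleI[OF M])
  fix x assume x: "x \<in> H"
  then have "\<ominus>\<^bsub>M\<^esub> x = (\<ominus> \<one>) \<odot>\<^bsub>M\<^esub> x"
    using assms(2) module.smult_l_minus[OF M, of \<one> x] module.smult_one[OF M] by auto
  then show "\<ominus>\<^bsub>M\<^esub> x \<in> H" using sm[of "\<ominus> \<one>" x] x by simp
qed (use assms in auto)

lemma submodule_subset: "\<lbrakk>module R M; submodule H R M\<rbrakk> \<Longrightarrow> H \<subseteq> carrier M"
  by (meson module.submoduleE(1))

lemma submodule_zero: "\<lbrakk>module R M; submodule H R M\<rbrakk> \<Longrightarrow> \<zero>\<^bsub>M\<^esub> \<in> H"
  by (metis monoid.simps(2) submodule.axioms(1) subgroup.one_closed)

lemma submodule_add: "\<lbrakk>module R M; submodule H R M; x \<in> H; y \<in> H\<rbrakk> \<Longrightarrow> x \<oplus>\<^bsub>M\<^esub> y \<in> H"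
  by (meson module.submoduleE(5))

lemma submodule_smult: "\<lbrakk>module R M; submodule H R M; a \<in> carrier R; x \<in> H\<rbrakk> \<Longrightarrow> a \<odot>\<^bsub>M\<^esub> x \<in> H"
  by (meson module.submoduleE(4))

lemma submodule_kernel:
  assumes "module R M" "module R N" "h \<in> mod_hom R M N"
  shows "submodule (a_kernel M N h) R M"
  by (rule submoduleI')
    (use assms mod_hom_rules[OF assms(3)] mod_hom_diff[OF assms(3,1,2)] mod_hom_zero[OF assms(3,1,2)] in auto)

lemma submodule_image:
  assumes M: "module R M" and N: "module R N" and h: "h \<in> mod_hom R M N"
  shows "submodule (h ` carrier M) R N"
proof (rule submoduleI'[OF N])
  show "h ` carrier M \<subseteq> carrier N" using mod_hom_closed[OF h] by blast
  show "\<zero>\<^bsub>N\<^esub> \<in> h ` carrier M"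
    using mod_hom_zero[OF h M N] mod_zero_closed[OF M] by (metis image_eqI)
  fix x y assume "x \<in> h ` carrier M" "y \<in> h ` carrier M"
  then obtain u v where uv: "u \<in> carrier M" "x = h u" "v \<in> carrier M" "y = h v" by blast
  then have "x \<oplus>\<^bsub>N\<^esub> y = h (u \<oplus>\<^bsub>M\<^esub> v)" by (simp add: mod_hom_add[OF h])
  then show "x \<oplus>\<^bsub>N\<^esub> y \<in> h ` carrier M" using uv M by (metis imageI mod_add_closed)
next
  fix a x assume a: "a \<in> carrier R" and "x \<in> h ` carrier M"
  then obtain u where u: "u \<in> carrier M" "x = h u" by blast
  then have "a \<odot>\<^bsub>N\<^esub> x = h (a \<odot>\<^bsub>M\<^esub> u)" by (simp add: a mod_hom_smult[OF h])
  then show "a \<odot>\<^bsub>N\<^esub> x \<in> h ` carrier M" using a u M by (metis imageI mod_smult_closed)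
qed

lemma submodule_preimage:
  assumes "module R M" "module R N" "h \<in> mod_hom R M N" "submodule L R N"
  shows "submodule {x \<in> carrier M. h x \<in> L} R M"
  by (rule submoduleI')
    (use assms mod_hom_rules[OF assms(3)] mod_hom_diff[OF assms(3,1,2)] mod_hom_zero[OF assms(3,1,2)] in \<open>auto simp: submodule_add submodule_smult submodule_zero\<close>)

lemma submodule_carrier: "module R M \<Longrightarrow> submodule (carrier M) R M"
  by (rule module.carrier_is_submodule)

lemma restrict_module: "\<lbrakk>module R M; submodule H R M\<rbrakk> \<Longrightarrow> module R (M\<lparr>carrier := H\<rparr>)"
  by (rule submodule.submodule_is_module)

lemma mod_hom_into_submodule:
  "\<lbrakk>h \<in> mod_hom R M N; h ` carrier M \<subseteq> H\<rbrakk> \<Longrightarrow> h \<in> mod_hom R M (N\<lparr>carrier := H\<rparr>)"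
  by (auto simp: mod_hom_def)

lemma mod_hom_from_submodule:
  "\<lbrakk>h \<in> mod_hom R M (N\<lparr>carrier := H\<rparr>); H \<subseteq> carrier N\<rbrakk> \<Longrightarrow> h \<in> mod_hom R M N"
  by (auto simp: mod_hom_def)

lemma mod_hom_on_submodule:
  "\<lbrakk>h \<in> mod_hom R M N; H \<subseteq> carrier M\<rbrakk> \<Longrightarrow> h \<in> mod_hom R (M\<lparr>carrier := H\<rparr>) N"
  unfolding mod_hom_def by (auto simp: subset_iff)

text \<open>\<open>k'\<close> applies \<open>k\<close> to a chosen preimage. Two preimages differ by
  an element of the kernel of \<open>h\<close>, on which \<open>k\<close> vanishes, so the choice
  does not matter. Inverses, maps out of transposes and extensions of functionals are all obtained
  from this statement.\<close>

lemma mod_hom_factor: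
  assumes M: "module R M" and N: "module R N" and L: "module R L"
    and h: "h \<in> mod_hom R M N" and k: "k \<in> mod_hom R M L"
    and onto: "h ` carrier M = carrier N"
    and ker: "\<And>x. \<lbrakk>x \<in> carrier M; h x = \<zero>\<^bsub>N\<^esub>\<rbrakk> \<Longrightarrow> k x = \<zero>\<^bsub>L\<^esub>"
  shows "\<exists>k'\<in>mod_hom R N L. \<forall>x\<in>carrier M. k' (h x) = k x"
proof -
  define k' where "k' y = k (SOME x. x \<in> carrier M \<and> h x = y)" for y
  have k': "k' (h x) = k x" if x: "x \<in> carrier M" for x
  proof -
    define x' where "x' = (SOME z. z \<in> carrier M \<and> h z = h x)"
    have x': "x' \<in> carrier M" "h x' = h x"
      using someI[of "\<lambda>z. z \<in> carrier M \<and> h z = h x" x] x by (auto simp: x'_def)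
    have "h (x' \<ominus>\<^bsub>M\<^esub> x) = \<zero>\<^bsub>N\<^esub>" using x x' mod_hom_closed[OF h] M N by (simp add: mod_hom_diff[OF h])
    then have "k (x' \<ominus>\<^bsub>M\<^esub> x) = \<zero>\<^bsub>L\<^esub>" using ker x x' M by simp
    then have "k x' = k x" using x x' mod_hom_closed[OF k] M L by (simp add: mod_hom_diff[OF k])
    then show ?thesis by (simp add: k'_def x'_def)
  qed
  have "k' \<in> mod_hom R N L"
  proof (rule mod_homI)
    fix y assume "y \<in> carrier N"
    then obtain x where "x \<in> carrier M" "y = h x" using onto by blast
    then show "k' y \<in> carrier L" using mod_hom_closed[OF k] k' by simp
  next
    fix y z assume "y \<in> carrier N" "z \<in> carrier N"
    then obtain u v where "u \<in> carrier M" "y = h u" "v \<in> carrier M" "z = h v"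
      using onto by blast
    then show "k' (y \<oplus>\<^bsub>N\<^esub> z) = k' y \<oplus>\<^bsub>L\<^esub> k' z"
      by (simp add: mod_hom_add[OF h, symmetric] k' M mod_hom_add[OF k])
  next
    fix a y assume "a \<in> carrier R" "y \<in> carrier N"
    then obtain u where "u \<in> carrier M" "y = h u" 
      using onto by blast
    with \<open>a \<in> carrier R\<close> show "k' (a \<odot>\<^bsub>N\<^esub> y) = a \<odot>\<^bsub>L\<^esub> k' y"
      by (simp add: mod_hom_smult[OF h, symmetric] k' M mod_hom_smult[OF k])
  qed
  then show ?thesis using k' by blast
qed

text \<open>The inverse is the identity of \<open>M\<close> factored through the surjection
  \<open>h\<close>; injectivity supplies the condition on the kernel.\<close>

lemma mod_hom_inverse:
  assumes M: "module R M" and N: "module R N"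
    and h: "h \<in> mod_hom R M N" and bij: "bij_betw h (carrier M) (carrier N)"
  shows "\<exists>h'\<in>mod_hom R N M. (\<forall>x\<in>carrier M. h' (h x) = x) \<and> (\<forall>y\<in>carrier N. h (h' y) = y)"
proof -
  have "\<exists>h'\<in>mod_hom R N M. \<forall>x\<in>carrier M. h' (h x) = (\<lambda>x. x) x"
  proof (rule mod_hom_factor[OF M N M h])
    fix x assume "x \<in> carrier M" "h x = \<zero>\<^bsub>N\<^esub>"
    then show "x = \<zero>\<^bsub>M\<^esub>"
      using bij mod_hom_zero[OF h M N] M by (metis bij_betw_def inj_onD mod_zero_closed)
  qed (use bij in \<open>auto simp: bij_betw_def\<close>)
  moreover have "carrier N = h ` carrier M" using bij by (auto simp: bij_betw_def)
  ultimately show ?thesis by auto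
qed

lemma bij_betw_mutual_inverse:
  assumes "h \<in> mod_hom R M N" "h' \<in> mod_hom R N M"
    and "\<And>x. x \<in> carrier M \<Longrightarrow> h' (h x) = x" "\<And>y. y \<in> carrier N \<Longrightarrow> h (h' y) = y"
  shows "bij_betw h (carrier M) (carrier N)"
proof (rule bij_betw_byWitness[of _ h'])
  show "h ` carrier M \<subseteq> carrier N" "h' ` carrier N \<subseteq> carrier M"
    using mod_hom_closed[OF assms(1)] mod_hom_closed[OF assms(2)] by blast+
qed (use assms(3,4) in blast)+

lemma mem_set_add_iff: "x \<in> set_add M H K \<longleftrightarrow> (\<exists>h\<in>H. \<exists>k\<in>K. x = h \<oplus>\<^bsub>M\<^esub> k)"
  by (auto simp: set_add_def')

end

section \<open>Projective modules\<close>

context cring begin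

section \<open>The regular, free, product and Hom modules\<close>

lemma reg_mod_simps [simp]:
  "carrier (reg_mod R) = carrier R" "\<zero>\<^bsub>reg_mod R\<^esub> = \<zero>" "x \<oplus>\<^bsub>reg_mod R\<^esub> y = x \<oplus> y"
  "a \<odot>\<^bsub>reg_mod R\<^esub> x = a \<otimes> x"
  by (simp_all add: reg_mod_def)

lemma module_reg_mod [simp]: "module R (reg_mod R)"
  by (rule moduleI') (simp_all add: a_ac m_assoc l_distr r_distr)

lemma free_mod_simps [simp]:
  "carrier (free_mod R n) = {..<n} \<rightarrow>\<^sub>E carrier R" "\<zero>\<^bsub>free_mod R n\<^esub> = (\<lambda>i\<in>{..<n}. \<zero>)"
  "x \<oplus>\<^bsub>free_mod R n\<^esub> y = (\<lambda>i\<in>{..<n}. x i \<oplus> y i)"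
  "a \<odot>\<^bsub>free_mod R n\<^esub> x = (\<lambda>i\<in>{..<n}. a \<otimes> x i)"
  by (simp_all add: free_mod_def)

lemma module_free_mod [simp]: "module R (free_mod R n)"
proof (rule moduleI')
  fix x y assume "x \<in> carrier (free_mod R n)" "y \<in> carrier (free_mod R n)"
  then show "x \<oplus>\<^bsub>free_mod R n\<^esub> y = y \<oplus>\<^bsub>free_mod R n\<^esub> x"
    by (auto simp: PiE_iff intro!: restrict_ext) (auto intro: a_comm)
next
  fix x assume "x \<in> carrier (free_mod R n)"
  then show "\<zero>\<^bsub>free_mod R n\<^esub> \<oplus>\<^bsub>free_mod R n\<^esub> x = x" "\<one> \<odot>\<^bsub>free_mod R n\<^esub> x = x"
    by (simp_all add: PiE_iff fun_eq_iff extensional_def)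
qed (auto intro!: restrict_ext simp: PiE_iff a_assoc m_assoc l_distr r_distr)

lemma dsum_simps [simp]:
  "carrier (dsum M N) = carrier M \<times> carrier N" "\<zero>\<^bsub>dsum M N\<^esub> = (\<zero>\<^bsub>M\<^esub>, \<zero>\<^bsub>N\<^esub>)"
  "(x, y) \<oplus>\<^bsub>dsum M N\<^esub> (x', y') = (x \<oplus>\<^bsub>M\<^esub> x', y \<oplus>\<^bsub>N\<^esub> y')"
  "a \<odot>\<^bsub>dsum M N\<^esub> (x, y) = (a \<odot>\<^bsub>M\<^esub> x, a \<odot>\<^bsub>N\<^esub> y)"
  by (simp_all add: dsum_def)

lemma module_dsum [simp]:
  assumes "module R M" "module R N"
  shows "module R (dsum M N)"
proof -
  interpret M: module R M by fact
  interpret N: module R N by fact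
  show ?thesis
    by (rule moduleI') (auto simp: mod_add_assoc M.smult_l_distr N.smult_l_distr mod_smult_add
        M.smult_assoc1 N.smult_assoc1 assms intro: M.a_comm N.a_comm)
qed

lemma mod_hom_fst: "fst \<in> mod_hom R (dsum M N) M"
  and mod_hom_snd: "snd \<in> mod_hom R (dsum M N) N"
  by (rule mod_homI, auto)+

lemma mod_hom_Pair:
  assumes "h \<in> mod_hom R L M" "k \<in> mod_hom R L N"
  shows "(\<lambda>x. (h x, k x)) \<in> mod_hom R L (dsum M N)"
  by (rule mod_homI) (use mod_hom_rules[OF assms(1)] mod_hom_rules[OF assms(2)] in simp_all)

lemma mod_hom_inl: "module R N \<Longrightarrow> (\<lambda>x. (x, \<zero>\<^bsub>N\<^esub>)) \<in> mod_hom R M (dsum M N)"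
  and mod_hom_inr: "module R M \<Longrightarrow> (\<lambda>y. (\<zero>\<^bsub>M\<^esub>, y)) \<in> mod_hom R N (dsum M N)"
  by (auto intro!: mod_homI)

lemma Hom_mod_simps [simp]:
  "carrier (Hom_mod R M N) = mod_hom R M N \<inter> extensional (carrier M)"
  "\<zero>\<^bsub>Hom_mod R M N\<^esub> = (\<lambda>x\<in>carrier M. \<zero>\<^bsub>N\<^esub>)"
  "h \<oplus>\<^bsub>Hom_mod R M N\<^esub> k = (\<lambda>x\<in>carrier M. h x \<oplus>\<^bsub>N\<^esub> k x)"
  "a \<odot>\<^bsub>Hom_mod R M N\<^esub> h = (\<lambda>x\<in>carrier M. a \<odot>\<^bsub>N\<^esub> h x)"
  by (simp_all add: Hom_mod_def)

lemma mod_hom_restrict [simp]: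
  "module R M \<Longrightarrow> h \<in> mod_hom R M N \<Longrightarrow> restrict h (carrier M) \<in> mod_hom R M N"
  by (erule mod_hom_cong) auto

lemma module_Hom_mod [simp]:
  assumes M: "module R M" and N: "module R N"
  shows "module R (Hom_mod R M N)"
proof -
  let ?H = "Hom_mod R M N"
  interpret N: module R N by fact
  show ?thesis
  proof (rule moduleI')
    fix h k assume "h \<in> carrier ?H" "k \<in> carrier ?H"
    then show "h \<oplus>\<^bsub>?H\<^esub> k \<in> carrier ?H"
      using M N by (simp add: mod_hom_add_fun)
  next
    fix a h assume "a \<in> carrier R" "h \<in> carrier ?H"
    then show "a \<odot>\<^bsub>?H\<^esub> h \<in> carrier ?H"
      using M N by (simp add: mod_hom_smult_fun)
  next
    fix h k l assume "h \<in> carrier ?H" "k \<in> carrier ?H"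
      "l \<in> carrier ?H"
    then show "h \<oplus>\<^bsub>?H\<^esub> k \<oplus>\<^bsub>?H\<^esub> l = h \<oplus>\<^bsub>?H\<^esub> (k \<oplus>\<^bsub>?H\<^esub> l)"
      using N by (auto intro!: restrict_ext simp: mod_add_assoc mod_hom_closed[of _ M N])
  next
    fix h k assume "h \<in> carrier ?H" "k \<in> carrier ?H"
    then show "h \<oplus>\<^bsub>?H\<^esub> k = k \<oplus>\<^bsub>?H\<^esub> h"
      using N by (auto intro!: restrict_ext simp: mod_add_commute mod_hom_closed[of _ M N])
  next
    fix h assume "h \<in> carrier ?H"
    then show "\<zero>\<^bsub>?H\<^esub> \<oplus>\<^bsub>?H\<^esub> h = h" "\<one> \<odot>\<^bsub>?H\<^esub> h = h"
      "\<zero> \<odot>\<^bsub>?H\<^esub> h = \<zero>\<^bsub>?H\<^esub>"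
      using N by (auto intro!: extensionalityI[of _ "carrier M"] simp: mod_hom_closed[of _ M N])
  next
    fix a b h assume "a \<in> carrier R" "b \<in> carrier R" "h \<in> carrier ?H"
    then show "(a \<oplus> b) \<odot>\<^bsub>?H\<^esub> h = a \<odot>\<^bsub>?H\<^esub> h \<oplus>\<^bsub>?H\<^esub> b \<odot>\<^bsub>?H\<^esub> h"
      "(a \<otimes> b) \<odot>\<^bsub>?H\<^esub> h = a \<odot>\<^bsub>?H\<^esub> (b \<odot>\<^bsub>?H\<^esub> h)"
      using N by (auto intro!: restrict_ext simp: N.smult_l_distr N.smult_assoc1 mod_hom_closed[of _ M N])
  next
    fix a h k assume "a \<in> carrier R" "h \<in> carrier ?H" "k \<in> carrier ?H"
    then show "a \<odot>\<^bsub>?H\<^esub> (h \<oplus>\<^bsub>?H\<^esub> k)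
      = a \<odot>\<^bsub>?H\<^esub> h \<oplus>\<^bsub>?H\<^esub> a \<odot>\<^bsub>?H\<^esub> k"
      using N by (auto intro!: restrict_ext simp: mod_smult_add mod_hom_closed[of _ M N])
  qed (use M N in simp)
qed

end

section \<open>Linear combinations and the universal property of the free module\<close>

primrec lincomb :: "('a, 'b) module \<Rightarrow> nat \<Rightarrow> (nat \<Rightarrow> 'a) \<Rightarrow> (nat \<Rightarrow> 'b) \<Rightarrow> 'b" where
  "lincomb M 0 v m = \<zero>\<^bsub>M\<^esub>"
| "lincomb M (Suc n) v m = lincomb M n v m \<oplus>\<^bsub>M\<^esub> v n \<odot>\<^bsub>M\<^esub> m n"

context cring begin

lemma lincomb_mem_submodule:
  assumes "module R M" "submodule N R M" "\<And>k. k < n \<Longrightarrow> v k \<in> carrier R" "\<And>k. k < n \<Longrightarrow> m k \<in> N"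
  shows "lincomb M n v m \<in> N"
  using assms(3,4) by (induction n) (simp_all add: assms(1,2) submodule_zero submodule_add submodule_smult)

lemma lincomb_closed:
  assumes "module R M" "\<And>k. k < n \<Longrightarrow> v k \<in> carrier R" "\<And>k. k < n \<Longrightarrow> m k \<in> carrier M"
  shows "lincomb M n v m \<in> carrier M"
  by (rule lincomb_mem_submodule) (use assms submodule_carrier in auto)

lemma lincomb_cong:
  assumes "\<And>k. k < n \<Longrightarrow> v k = w k" "\<And>k. k < n \<Longrightarrow> m k = l k"
  shows "lincomb M n v m = lincomb M n w l"
  using assms by (induction n) simp_all

lemma lincomb_hom:
  assumes "module R M" "module R N" "h \<in> mod_hom R M N"
    and "\<And>k. k < n \<Longrightarrow> v k \<in> carrier R" "\<And>k. k < n \<Longrightarrow> m k \<in> carrier M"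
  shows "h (lincomb M n v m) = lincomb N n v (\<lambda>k. h (m k))"
  using assms(4,5)
  by (induction n) (simp_all add: assms(1,2) mod_hom_zero[OF assms(3)] mod_hom_rules[OF assms(3)] lincomb_closed)

lemma mod_add_swap:
  assumes "module R M" "x \<in> carrier M" "y \<in> carrier M" "z \<in> carrier M" "w \<in> carrier M"
  shows "x \<oplus>\<^bsub>M\<^esub> y \<oplus>\<^bsub>M\<^esub> (z \<oplus>\<^bsub>M\<^esub> w) = (x \<oplus>\<^bsub>M\<^esub> z) \<oplus>\<^bsub>M\<^esub> (y \<oplus>\<^bsub>M\<^esub> w)"
  using assms by (simp add: mod_add_assoc mod_add_left_commute)

lemma lincomb_add_left:
  assumes M: "module R M" and "\<And>k. k < n \<Longrightarrow> v k \<in> carrier R" "\<And>k. k < n \<Longrightarrow> w k \<in> carrier R"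
    and "\<And>k. k < n \<Longrightarrow> m k \<in> carrier M"
  shows "lincomb M n (\<lambda>k. v k \<oplus> w k) m = lincomb M n v m \<oplus>\<^bsub>M\<^esub> lincomb M n w m"
  using assms(2-)
  by (induction n) (simp_all add: M module.smult_l_distr[OF M] mod_add_swap lincomb_closed)

lemma lincomb_smult_left:
  assumes M: "module R M" and a: "a \<in> carrier R" and "\<And>k. k < n \<Longrightarrow> v k \<in> carrier R"
    and "\<And>k. k < n \<Longrightarrow> m k \<in> carrier M"
  shows "lincomb M n (\<lambda>k. a \<otimes> v k) m = a \<odot>\<^bsub>M\<^esub> lincomb M n v m"
  using assms(3-)
  by (induction n) (simp_all add: M a module.smult_assoc1[OF M] mod_smult_add lincomb_closed)

lemma lincomb_add_right:
  assumes M: "module R M" and "\<And>k. k < n \<Longrightarrow> v k \<in> carrier R"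
    and "\<And>k. k < n \<Longrightarrow> m k \<in> carrier M" "\<And>k. k < n \<Longrightarrow> l k \<in> carrier M"
  shows "lincomb M n v (\<lambda>k. m k \<oplus>\<^bsub>M\<^esub> l k) = lincomb M n v m \<oplus>\<^bsub>M\<^esub> lincomb M n v l"
  using assms(2-)
  by (induction n) (simp_all add: M mod_smult_add mod_add_swap lincomb_closed)

lemma lincomb_smult_right:
  assumes M: "module R M" and a: "a \<in> carrier R" and "\<And>k. k < n \<Longrightarrow> v k \<in> carrier R"
    and "\<And>k. k < n \<Longrightarrow> m k \<in> carrier M"
  shows "lincomb M n v (\<lambda>k. a \<odot>\<^bsub>M\<^esub> m k) = a \<odot>\<^bsub>M\<^esub> lincomb M n v m"
  using assms(3-)
  by (induction n) (simp_all add: M a mod_smult_add lincomb_closed module.smult_assoc1[OF M, symmetric] m_comm)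

text \<open>Existence half of the universal property of the free module: the \<open>k\<close>-th
  unit vector is to go to \<open>m k\<close>. The uniqueness half is
  \<open>mod_hom_free_eq_lincomb\<close>.\<close>

lemma mod_hom_lincomb:
  assumes M: "module R M" and m: "\<And>k. k < n \<Longrightarrow> m k \<in> carrier M"
  shows "(\<lambda>v. lincomb M n v m) \<in> mod_hom R (free_mod R n) M"
proof (rule mod_homI)
  fix v w assume vw: "v \<in> carrier (free_mod R n)" "w \<in> carrier (free_mod R n)"
  then have "lincomb M n (\<lambda>i\<in>{..<n}. v i \<oplus> w i) m = lincomb M n (\<lambda>i. v i \<oplus> w i) m"
    by (intro lincomb_cong) auto
  then show "lincomb M n (v \<oplus>\<^bsub>free_mod R n\<^esub> w) m = lincomb M n v m \<oplus>\<^bsub>M\<^esub> lincomb M n w m"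
    using lincomb_add_left[OF M, of n v w m] m vw by (simp add: PiE_iff)
next
  fix a v assume a: "a \<in> carrier R" and v: "v \<in> carrier (free_mod R n)"
  then have "lincomb M n (\<lambda>i\<in>{..<n}. a \<otimes> v i) m = lincomb M n (\<lambda>i. a \<otimes> v i) m"
    by (intro lincomb_cong) auto
  then show "lincomb M n (a \<odot>\<^bsub>free_mod R n\<^esub> v) m = a \<odot>\<^bsub>M\<^esub> lincomb M n v m"
    using lincomb_smult_left[OF M a, of n v m] m v by (simp add: PiE_iff)
qed (auto intro!: lincomb_closed assms)

definition unit_vec :: "nat \<Rightarrow> nat \<Rightarrow> nat \<Rightarrow> 'a" where
  "unit_vec n k = (\<lambda>i\<in>{..<n}. if i = k then \<one> else \<zero>)"

lemma unit_vec_closed [simp]: "unit_vec n k \<in> {..<n} \<rightarrow>\<^sub>E carrier R"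
  by (auto simp: unit_vec_def)

lemma lincomb_unit_vec:
  assumes v: "v \<in> {..<n} \<rightarrow>\<^sub>E carrier R"
  shows "lincomb (free_mod R n) n v (unit_vec n) = v"
proof -
  \<comment> \<open>The first \<open>k\<close> terms add up to \<open>v\<close> cut off at
    \<open>k\<close>; in this form the claim goes through by induction.\<close>
  have "lincomb (free_mod R n) k v (unit_vec n) = (\<lambda>i\<in>{..<n}. if i < k then v i else \<zero>)"
    if "k \<le> n" for k
    using that v by (induction k) (auto simp: unit_vec_def fun_eq_iff PiE_iff less_Suc_eq)
  then show ?thesis using v by (auto simp: fun_eq_iff PiE_iff extensional_def)
qed

lemma mod_hom_free_eq_lincomb:
  assumes N: "module R N" and h: "h \<in> mod_hom R (free_mod R n) N" and v: "v \<in> carrier (free_mod R n)"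
  shows "h v = lincomb N n v (\<lambda>k. h (unit_vec n k))"
proof -
  have "h v = h (lincomb (free_mod R n) n v (unit_vec n))"
    using v by (simp add: lincomb_unit_vec)
  also have "\<dots> = lincomb N n v (\<lambda>k. h (unit_vec n k))"
    using v by (intro lincomb_hom[OF _ N h]) auto
  finally show ?thesis .
qed

section \<open>Finitely generated projective modules\<close>

lemma fg_projective_module: "fg_projective R P \<Longrightarrow> module R P"
  by (simp add: fg_projective_def)

text \<open>The lift is made on the free module: the images of the unit vectors under
  \<open>h p\<close> are lifted one at a time along \<open>q\<close>. Composing with
  \<open>i\<close> brings it back to \<open>P\<close>, since \<open>p i\<close> is the
  identity.\<close>

lemma fg_projective_lift:
  assumes P: "fg_projective R P" and M: "module R M" and N: "module R N"
    and q: "q \<in> mod_hom R M N" and onto: "carrier N \<subseteq> q ` carrier M" and h: "h \<in> mod_hom R P N"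
  shows "\<exists>h'\<in>mod_hom R P M. \<forall>x\<in>carrier P. q (h' x) = h x"
proof -
  obtain n i p where i: "i \<in> mod_hom R P (free_mod R n)" and p: "p \<in> mod_hom R (free_mod R n) P"
    and pi: "\<And>x. x \<in> carrier P \<Longrightarrow> p (i x) = x"
    using P by (auto simp: fg_projective_def)
  have hp: "(\<lambda>v. h (p v)) \<in> mod_hom R (free_mod R n) N"
    by (rule mod_hom_comp[OF p h])
  have "\<exists>m. m \<in> carrier M \<and> q m = h (p (unit_vec n k))" for k
    using onto mod_hom_closed[OF hp, of "unit_vec n k"] by force
  then obtain m where m: "\<And>k. m k \<in> carrier M" "\<And>k. q (m k) = h (p (unit_vec n k))" by metis
  have "(\<lambda>x. lincomb M n (i x) m) \<in> mod_hom R P M"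
    by (rule mod_hom_comp[OF i mod_hom_lincomb[OF M]]) (rule m)
  moreover have "q (lincomb M n (i x) m) = h x" if x: "x \<in> carrier P" for x
  proof -
    have ix: "i x \<in> {..<n} \<rightarrow>\<^sub>E carrier R" using mod_hom_closed[OF i x] by simp
    then have "q (lincomb M n (i x) m) = lincomb N n (i x) (\<lambda>k. h (p (unit_vec n k)))"
      using lincomb_hom[OF M N q, of n "i x" m] m(1) by (simp add: m(2) PiE_iff)
    also have "\<dots> = h (p (i x))" using mod_hom_free_eq_lincomb[OF N hp, of "i x"] ix by simp
    finally show ?thesis by (simp add: pi x)
  qed
  ultimately show ?thesis by (intro bexI ballI)
qed

lemma fg_projective_retract:
  assumes "fg_projective R P" "module R X" "i \<in> mod_hom R X P" "p \<in> mod_hom R P X"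
    "\<And>x. x \<in> carrier X \<Longrightarrow> p (i x) = x"
  shows "fg_projective R X"
proof -
  obtain n j q where j: "j \<in> mod_hom R P (free_mod R n)" and q: "q \<in> mod_hom R (free_mod R n) P"
    and qj: "\<And>x. x \<in> carrier P \<Longrightarrow> q (j x) = x"
    using assms(1) by (auto simp: fg_projective_def)
  show ?thesis unfolding fg_projective_def
  proof (intro conjI exI bexI ballI)
    show "(\<lambda>x. j (i x)) \<in> mod_hom R X (free_mod R n)" "(\<lambda>x. p (q x)) \<in> mod_hom R (free_mod R n) X"
      using assms j q by blast+
  qed (use assms qj mod_hom_closed[OF assms(3)] in auto)
qed

lemma fg_projective_dsum:
  assumes "fg_projective R P" "fg_projective R Q"
  shows "fg_projective R (dsum P Q)"
proof -
  obtain m i p where i: "i \<in> mod_hom R P (free_mod R m)" and p: "p \<in> mod_hom R (free_mod R m) P"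
    and pi: "\<And>x. x \<in> carrier P \<Longrightarrow> p (i x) = x"
    using assms(1) by (auto simp: fg_projective_def)
  obtain n j q where j: "j \<in> mod_hom R Q (free_mod R n)" and q: "q \<in> mod_hom R (free_mod R n) Q"
    and qj: "\<And>x. x \<in> carrier Q \<Longrightarrow> q (j x) = x"
    using assms(2) by (auto simp: fg_projective_def)
  have free: "fg_projective R (dsum (free_mod R m) (free_mod R n))"
    unfolding fg_projective_def
  proof (intro conjI exI bexI ballI)
    \<comment> \<open>Concatenation of vectors and its inverse; the second block starts at index
      \<open>m\<close>.\<close>
    let ?i = "\<lambda>(x, y). \<lambda>k\<in>{..<m+n}. if k < m then x k else y (k - m)"
    let ?p = "\<lambda>v. (\<lambda>k\<in>{..<m}. v k, \<lambda>k\<in>{..<n}. v (k + m))"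
    show "?i \<in> mod_hom R (dsum (free_mod R m) (free_mod R n)) (free_mod R (m+n))"
      by (rule mod_homI) (auto simp: fun_eq_iff PiE_iff)
    show "?p \<in> mod_hom R (free_mod R (m+n)) (dsum (free_mod R m) (free_mod R n))"
      by (rule mod_homI) (auto simp: fun_eq_iff PiE_iff)
    fix x assume "x \<in> carrier (dsum (free_mod R m) (free_mod R n))"
    then show "?p (?i x) = x" by (auto simp: fun_eq_iff PiE_iff extensional_def)
  qed simp
  show ?thesis
  proof (rule fg_projective_retract[OF free])
    show "(\<lambda>z. (i (fst z), j (snd z))) \<in> mod_hom R (dsum P Q) (dsum (free_mod R m) (free_mod R n))"
      by (intro mod_hom_Pair mod_hom_comp[OF mod_hom_fst i] mod_hom_comp[OF mod_hom_snd j])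
    show "(\<lambda>z. (p (fst z), q (snd z))) \<in> mod_hom R (dsum (free_mod R m) (free_mod R n)) (dsum P Q)"
      by (intro mod_hom_Pair mod_hom_comp[OF mod_hom_fst p] mod_hom_comp[OF mod_hom_snd q])
  qed (use assms pi qj in \<open>auto simp: fg_projective_module\<close>)
qed

lemma fg_projective_fg:
  assumes P: "fg_projective R P"
  shows "fg_module R P"
proof -
  have M: "module R P" using P by (rule fg_projective_module)
  obtain n i p where i: "i \<in> mod_hom R P (free_mod R n)" and p: "p \<in> mod_hom R (free_mod R n) P"
    and pi: "\<And>x. x \<in> carrier P \<Longrightarrow> p (i x) = x"
    using P by (auto simp: fg_projective_def)
  let ?S = "(\<lambda>k. p (unit_vec n k)) ` {..<n}"
  have "N = carrier P" if N: "submodule N R P" and S: "?S \<subseteq> N" for N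
  proof
    show "carrier P \<subseteq> N"
    proof
      fix x assume x: "x \<in> carrier P"
      have ix: "i x \<in> carrier (free_mod R n)" using mod_hom_closed[OF i x] .
      have "lincomb P n (i x) (\<lambda>k. p (unit_vec n k)) \<in> N"
        using S ix by (intro lincomb_mem_submodule[OF M N]) (auto simp: PiE_iff)
      then show "x \<in> N" using mod_hom_free_eq_lincomb[OF M p ix] pi[OF x] by simp
    qed
  qed (use submodule_subset[OF M N] in auto)
  moreover have "?S \<subseteq> carrier P" using mod_hom_closed[OF p] by auto
  ultimately show ?thesis unfolding fg_module_def using M by blast
qed

text \<open>Generation is expressed through submodules: the preimage of a submodule of
  \<open>N\<close> containing \<open>h\<close> applied to the generators contains the generators of
  \<open>M\<close>, hence is everything.\<close>

lemma fg_module_image: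
  assumes M: "fg_module R M" and N: "module R N" and h: "h \<in> mod_hom R M N"
    and onto: "h ` carrier M = carrier N"
  shows "fg_module R N"
proof -
  have M': "module R M" using M by (simp add: fg_module_def)
  obtain S where S: "finite S" "S \<subseteq> carrier M" "\<And>N. \<lbrakk>submodule N R M; S \<subseteq> N\<rbrakk> \<Longrightarrow> N = carrier M"
    using M by (auto simp: fg_module_def)
  have "L = carrier N" if L: "submodule L R N" and "h ` S \<subseteq> L" for L
  proof
    have "{x \<in> carrier M. h x \<in> L} = carrier M"
      using S that by (intro S(3) submodule_preimage[OF M' N h L]) auto
    then show "carrier N \<subseteq> L" unfolding onto[symmetric] by blast
  qed (use submodule_subset[OF N L] in auto)
  then show ?thesis unfolding fg_module_def using N S(1,2) onto
    by (intro conjI exI[of _ "h ` S"]) auto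
qed

text \<open>The dual of a summand of \<open>R^n\<close> is a summand of the dual of
  \<open>R^n\<close>, which is \<open>R^n\<close> again. \<open>?i\<close> evaluates a functional at
  the generators \<open>p (unit_vec n k)\<close>, and \<open>?p\<close> turns a vector
  \<open>v\<close> into the functional that sends \<open>x\<close> to the sum of the products of the
  entries of \<open>i x\<close> and \<open>v\<close>.\<close>

lemma fg_projective_dual:
  assumes P: "fg_projective R P"
  shows "fg_projective R (dual R P)"
proof -
  have M: "module R P" using P by (rule fg_projective_module)
  obtain n i p where i: "i \<in> mod_hom R P (free_mod R n)" and p: "p \<in> mod_hom R (free_mod R n) P"
    and pi: "\<And>x. x \<in> carrier P \<Longrightarrow> p (i x) = x"
    using P by (auto simp: fg_projective_def)
  have pu: "p (unit_vec n k) \<in> carrier P" for k by (rule mod_hom_closed[OF p]) simp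
  have ix: "i x k \<in> carrier R" if "x \<in> carrier P" "k < n" for x k
    using mod_hom_closed[OF i that(1)] that(2) by auto
  show ?thesis
    unfolding fg_projective_def
  proof (intro conjI exI bexI ballI)
    let ?i = "\<lambda>\<phi>. \<lambda>k\<in>{..<n}. \<phi> (p (unit_vec n k))"
    let ?p = "\<lambda>v. \<lambda>x\<in>carrier P. lincomb (reg_mod R) n (i x) v"
    show "?i \<in> mod_hom R (dual R P) (free_mod R n)"
      by (rule mod_homI) (auto simp: fun_eq_iff pu mod_hom_closed[of _ P "reg_mod R", simplified])
    show "?p \<in> mod_hom R (free_mod R n) (dual R P)"
    proof (rule mod_homI)
      fix v assume v: "v \<in> carrier (free_mod R n)"
      have "(\<lambda>x. lincomb (reg_mod R) n (i x) v) \<in> mod_hom R P (reg_mod R)"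
        using v by (intro mod_hom_comp[OF i mod_hom_lincomb]) auto
      then show "?p v \<in> carrier (dual R P)" using M by simp
    next
      fix v w assume vw: "v \<in> carrier (free_mod R n)" "w \<in> carrier (free_mod R n)"
      have "lincomb (reg_mod R) n (i x) (\<lambda>k\<in>{..<n}. v k \<oplus> w k)
        = lincomb (reg_mod R) n (i x) v \<oplus> lincomb (reg_mod R) n (i x) w" if x: "x \<in> carrier P" for x
      proof -
        have "lincomb (reg_mod R) n (i x) (\<lambda>k\<in>{..<n}. v k \<oplus> w k)
          = lincomb (reg_mod R) n (i x) (\<lambda>k. v k \<oplus>\<^bsub>reg_mod R\<^esub> w k)"
          by (rule lincomb_cong) auto
        also have "\<dots> = lincomb (reg_mod R) n (i x) v \<oplus>\<^bsub>reg_mod R\<^esub> lincomb (reg_mod R) n (i x) w"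
          using vw ix x by (intro lincomb_add_right) auto
        finally show ?thesis by simp
      qed
      then show "?p (v \<oplus>\<^bsub>free_mod R n\<^esub> w) = ?p v \<oplus>\<^bsub>dual R P\<^esub> ?p w" by (auto intro!: restrict_ext)
    next
      fix a v assume a: "a \<in> carrier R" and v: "v \<in> carrier (free_mod R n)"
      have "lincomb (reg_mod R) n (i x) (\<lambda>k\<in>{..<n}. a \<otimes> v k)
        = a \<otimes> lincomb (reg_mod R) n (i x) v" if x: "x \<in> carrier P" for x
      proof -
        have "lincomb (reg_mod R) n (i x) (\<lambda>k\<in>{..<n}. a \<otimes> v k)
          = lincomb (reg_mod R) n (i x) (\<lambda>k. a \<odot>\<^bsub>reg_mod R\<^esub> v k)"
          by (rule lincomb_cong) auto
        also have "\<dots> = a \<odot>\<^bsub>reg_mod R\<^esub> lincomb (reg_mod R) n (i x) v"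
          using v ix x a by (intro lincomb_smult_right) auto
        finally show ?thesis by simp
      qed
      then show "?p (a \<odot>\<^bsub>free_mod R n\<^esub> v) = a \<odot>\<^bsub>dual R P\<^esub> ?p v" by (auto intro!: restrict_ext)
    qed
    fix \<phi> assume \<phi>: "\<phi> \<in> carrier (dual R P)"
    have "lincomb (reg_mod R) n (i x) (\<lambda>k\<in>{..<n}. \<phi> (p (unit_vec n k))) = \<phi> x" if x: "x \<in> carrier P" for x
    proof -
      have "\<phi> x = \<phi> (p (i x))" by (simp add: pi x)
      also have "\<dots> = lincomb (reg_mod R) n (i x) (\<lambda>k. \<phi> (p (unit_vec n k)))"
        using \<phi> by (intro mod_hom_free_eq_lincomb mod_hom_comp[OF p]) (use mod_hom_closed[OF i x] in auto)
      also have "\<dots> = lincomb (reg_mod R) n (i x) (\<lambda>k\<in>{..<n}. \<phi> (p (unit_vec n k)))"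
        by (rule lincomb_cong) auto
      finally show ?thesis by simp
    qed
    then show "?p (?i \<phi>) = \<phi>" using \<phi> by (auto intro!: extensionalityI[of _ "carrier P"])
  qed (use M in simp)
qed

end

section \<open>Projective covers and minimal presentations\<close>

text \<open>Minimality is left out because the targets of a minimal presentation in the category
  only give a presentation of this weaker kind.\<close>

definition presentation :: "('a, 'm) ring_scheme \<Rightarrow> ('a, 'p) module \<Rightarrow> ('p \<Rightarrow> 'q) \<Rightarrow>
    ('a, 'q) module \<Rightarrow> ('q \<Rightarrow> 'b) \<Rightarrow> ('a, 'b) module \<Rightarrow> bool" where
  "presentation R P1 d P0 e M \<longleftrightarrow> module R M \<and> fg_projective R P1 \<and> fg_projective R P0 \<and>
    d \<in> mod_hom R P1 P0 \<and> e \<in> mod_hom R P0 M \<and> e ` carrier P0 = carrier M \<and>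
    d ` carrier P1 = a_kernel P0 M e"

text \<open>The first complex is a direct summand of the second over \<open>M\<close>: the
  composites \<open>b s\<close> are equal to the identity and not merely homotopic to it, while
  nothing is asked of \<open>s b\<close>. Equality in degree 1 is what makes the induced maps of
  transposes split exactly.\<close>

definition retraction :: "('a, 'm) ring_scheme \<Rightarrow> ('a, 'p1) module \<Rightarrow> ('p1 \<Rightarrow> 'p0) \<Rightarrow> ('a, 'p0) module \<Rightarrow>
    ('p0 \<Rightarrow> 'b) \<Rightarrow> ('a, 'q1) module \<Rightarrow> ('q1 \<Rightarrow> 'q0) \<Rightarrow> ('a, 'q0) module \<Rightarrow> ('q0 \<Rightarrow> 'b) \<Rightarrow>
    ('p1 \<Rightarrow> 'q1) \<Rightarrow> ('p0 \<Rightarrow> 'q0) \<Rightarrow> ('q1 \<Rightarrow> 'p1) \<Rightarrow> ('q0 \<Rightarrow> 'p0) \<Rightarrow> bool" where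
  "retraction R P1 d P0 e Q1 d' Q0 e' s1 s0 b1 b0 \<longleftrightarrow>
    s1 \<in> mod_hom R P1 Q1 \<and> s0 \<in> mod_hom R P0 Q0 \<and> b1 \<in> mod_hom R Q1 P1 \<and> b0 \<in> mod_hom R Q0 P0 \<and>
    (\<forall>x\<in>carrier P0. e' (s0 x) = e x) \<and> (\<forall>x\<in>carrier Q0. e (b0 x) = e' x) \<and>
    (\<forall>x\<in>carrier P1. d' (s1 x) = s0 (d x)) \<and> (\<forall>x\<in>carrier Q1. d (b1 x) = b0 (d' x)) \<and>
    (\<forall>x\<in>carrier P0. b0 (s0 x) = x) \<and> (\<forall>x\<in>carrier P1. b1 (s1 x) = x)"

lemma retractionD:
  assumes "retraction R P1 d P0 e Q1 d' Q0 e' s1 s0 b1 b0"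
  shows "s1 \<in> mod_hom R P1 Q1" "s0 \<in> mod_hom R P0 Q0" "b1 \<in> mod_hom R Q1 P1" "b0 \<in> mod_hom R Q0 P0"
    "\<And>x. x \<in> carrier P0 \<Longrightarrow> e' (s0 x) = e x" "\<And>x. x \<in> carrier Q0 \<Longrightarrow> e (b0 x) = e' x"
    "\<And>x. x \<in> carrier P1 \<Longrightarrow> d' (s1 x) = s0 (d x)" "\<And>x. x \<in> carrier Q1 \<Longrightarrow> d (b1 x) = b0 (d' x)"
    "\<And>x. x \<in> carrier P0 \<Longrightarrow> b0 (s0 x) = x" "\<And>x. x \<in> carrier P1 \<Longrightarrow> b1 (s1 x) = x"
  using assms unfolding retraction_def by simp_all

context cring begin

lemma proj_cover_endo_surj:
  assumes cover: "proj_cover R P e M" and M: "module R M" and h: "h \<in> mod_hom R P P"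
    and eh: "\<And>x. x \<in> carrier P \<Longrightarrow> e (h x) = e x"
  shows "h ` carrier P = carrier P"
proof -
  have P: "module R P" and e: "e \<in> mod_hom R P M" and sup: "superfluous R P (a_kernel P M e)"
    using cover by (simp_all add: proj_cover_def fg_projective_module)
  note cl = mod_hom_closed[OF h] mod_hom_closed[OF e]
  have "set_add P (a_kernel P M e) (h ` carrier P) = carrier P"
  proof
    show "carrier P \<subseteq> set_add P (a_kernel P M e) (h ` carrier P)"
    proof
      fix x assume x: "x \<in> carrier P"
      have "e (x \<ominus>\<^bsub>P\<^esub> h x) = \<zero>\<^bsub>M\<^esub>" using x cl P M by (simp add: mod_hom_diff[OF e] eh)
      then have "x \<ominus>\<^bsub>P\<^esub> h x \<in> a_kernel P M e" using x cl P by simp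
      moreover have "x = x \<ominus>\<^bsub>P\<^esub> h x \<oplus>\<^bsub>P\<^esub> h x" using x cl P by simp
      ultimately show "x \<in> set_add P (a_kernel P M e) (h ` carrier P)"
        using x unfolding mem_set_add_iff by (metis imageI)
    qed
  qed (use cl P in \<open>auto simp: mem_set_add_iff\<close>)
  then show ?thesis using sup submodule_image[OF P P h] by (simp add: superfluous_def)
qed

text \<open>Being surjective onto a projective module, \<open>h\<close> has a section
  \<open>k\<close>. This is again an endomorphism over \<open>M\<close>, hence surjective as well,
  and that makes \<open>h\<close> injective.\<close>

lemma proj_cover_endo_bij:
  assumes cover: "proj_cover R P e M" and M: "module R M" and h: "h \<in> mod_hom R P P"
    and eh: "\<And>x. x \<in> carrier P \<Longrightarrow> e (h x) = e x"
  shows "bij_betw h (carrier P) (carrier P)"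
proof -
  have fgP: "fg_projective R P" and P: "module R P"
    using cover by (simp_all add: proj_cover_def fg_projective_module)
  have surj: "h ` carrier P = carrier P" by (rule proj_cover_endo_surj[OF cover M h eh])
  obtain k where k: "k \<in> mod_hom R P P" and hk: "\<And>x. x \<in> carrier P \<Longrightarrow> h (k x) = x"
    using fg_projective_lift[OF fgP P P h _ mod_hom_id] surj by auto
  have "e (k x) = e x" if "x \<in> carrier P" for x
    using eh[of "k x"] hk[OF that] mod_hom_closed[OF k that] by simp
  then have "k ` carrier P = carrier P" by (rule proj_cover_endo_surj[OF cover M k])
  then have "inj_on h (carrier P)"
    using hk by (metis (no_types, lifting) image_iff inj_onI)
  then show ?thesis using surj by (simp add: bij_betw_def)
qed

text \<open>Correcting a lift by the inverse of an automorphism makes the projective cover a direct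
  summand on the nose.\<close>

lemma proj_cover_retract:
  assumes cover: "proj_cover R P e M" and M: "module R M" and N: "module R N"
    and Q: "fg_projective R Q" and q: "q \<in> mod_hom R Q N" and onto: "q ` carrier Q = carrier N"
    and \<sigma>: "\<sigma> \<in> mod_hom R M N" and \<beta>: "\<beta> \<in> mod_hom R N M"
    and \<beta>\<sigma>: "\<And>x. x \<in> carrier M \<Longrightarrow> \<beta> (\<sigma> x) = x"
  obtains s b where "s \<in> mod_hom R P Q" "b \<in> mod_hom R Q P"
    "\<And>x. x \<in> carrier P \<Longrightarrow> q (s x) = \<sigma> (e x)" "\<And>x. x \<in> carrier Q \<Longrightarrow> e (b x) = \<beta> (q x)"
    "\<And>x. x \<in> carrier P \<Longrightarrow> b (s x) = x"
proof -
  have fgP: "fg_projective R P" and P: "module R P" and e: "e \<in> mod_hom R P M"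
    and eP: "e ` carrier P = carrier M"
    using cover by (simp_all add: proj_cover_def fg_projective_module)
  have mQ: "module R Q" using Q by (rule fg_projective_module)
  obtain s where s: "s \<in> mod_hom R P Q" and qs: "\<And>x. x \<in> carrier P \<Longrightarrow> q (s x) = \<sigma> (e x)"
    using fg_projective_lift[OF fgP mQ N q _ mod_hom_comp[OF e \<sigma>]] onto by auto
  obtain c where c: "c \<in> mod_hom R Q P" and ec: "\<And>x. x \<in> carrier Q \<Longrightarrow> e (c x) = \<beta> (q x)"
    using fg_projective_lift[OF Q P M e _ mod_hom_comp[OF q \<beta>]] eP by auto
  have cs: "(\<lambda>x. c (s x)) \<in> mod_hom R P P" by (rule mod_hom_comp[OF s c])
  have ecs: "e (c (s x)) = e x" if x: "x \<in> carrier P" for x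
    by (simp add: ec[OF mod_hom_closed[OF s x]] qs[OF x] \<beta>\<sigma>[OF mod_hom_closed[OF e x]])
  have bij: "bij_betw (\<lambda>x. c (s x)) (carrier P) (carrier P)"
    by (rule proj_cover_endo_bij[OF cover M cs ecs])
  obtain k where k: "k \<in> mod_hom R P P" and kcs: "\<And>x. x \<in> carrier P \<Longrightarrow> k (c (s x)) = x"
    and csk: "\<And>x. x \<in> carrier P \<Longrightarrow> c (s (k x)) = x"
    using mod_hom_inverse[OF P P cs bij] by auto
  have ek: "e (k x) = e x" if x: "x \<in> carrier P" for x
    using ecs[OF mod_hom_closed[OF k x]] csk[OF x] by simp
  show thesis
  proof (rule that[OF s mod_hom_comp[OF c k] qs _ kcs])
    fix x assume x: "x \<in> carrier Q"
    show "e (k (c x)) = \<beta> (q x)" by (simp add: ek[OF mod_hom_closed[OF c x]] ec[OF x])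
  qed
qed

text \<open>\<open>s b\<close> is an endomorphism over \<open>N\<close> of a projective cover, hence
  injective, and it is idempotent because \<open>b s\<close> is the identity. An injective
  idempotent is the identity.\<close>

lemma proj_cover_retract_iso:
  assumes cover: "proj_cover R Q q N" and N: "module R N"
    and s: "s \<in> mod_hom R P Q" and b: "b \<in> mod_hom R Q P"
    and qs: "\<And>x. x \<in> carrier P \<Longrightarrow> q (s x) = \<sigma> (e x)"
    and eb: "\<And>x. x \<in> carrier Q \<Longrightarrow> e (b x) = \<beta> (q x)"
    and \<sigma>\<beta>: "\<And>y. y \<in> carrier N \<Longrightarrow> \<sigma> (\<beta> y) = y"
    and bs: "\<And>x. x \<in> carrier P \<Longrightarrow> b (s x) = x" and x: "x \<in> carrier Q"
  shows "s (b x) = x"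
proof -
  have q: "q \<in> mod_hom R Q N" using cover by (simp add: proj_cover_def)
  have "bij_betw (\<lambda>x. s (b x)) (carrier Q) (carrier Q)"
  proof (rule proj_cover_endo_bij[OF cover N mod_hom_comp[OF b s]])
    fix x assume x: "x \<in> carrier Q"
    show "q (s (b x)) = q x"
      by (simp add: qs[OF mod_hom_closed[OF b x]] eb[OF x] \<sigma>\<beta>[OF mod_hom_closed[OF q x]])
  qed
  then have "inj_on (\<lambda>x. s (b x)) (carrier Q)" by (simp add: bij_betw_def)
  moreover have "s (b (s (b x))) = s (b x)" by (simp add: bs[OF mod_hom_closed[OF b x]])
  ultimately show ?thesis
    using x mod_hom_closed[OF s mod_hom_closed[OF b x]] by (auto dest: inj_onD)
qed

lemma min_pres_presentation:
  assumes pres: "min_pres R P1 d P0 e M" and M: "module R M"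
  shows "presentation R P1 d P0 e M"
proof -
  have "d \<in> mod_hom R P1 (P0\<lparr>carrier := a_kernel P0 M e\<rparr>)"
    using pres by (simp add: min_pres_def proj_cover_def)
  then have "d \<in> mod_hom R P1 P0" by (rule mod_hom_from_submodule) auto
  then show ?thesis using pres M by (simp add: min_pres_def proj_cover_def presentation_def)
qed

text \<open>The comparison of covers is made twice: over the identity of \<open>M\<close> in degree
  0, and then in degree 1 over \<open>s0\<close> and \<open>b0\<close> restricted to the kernels of
  the augmentations. For the second use \<open>proj_cover_retract\<close> has to allow two different
  base modules.\<close>

lemma min_pres_retract:
  assumes P: "min_pres R P1 d P0 e M" and Q: "presentation R Q1 d' Q0 e' M"
  obtains s1 s0 b1 b0 where "retraction R P1 d P0 e Q1 d' Q0 e' s1 s0 b1 b0"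
proof -
  have M: "module R M" and Q1: "fg_projective R Q1" and Q0: "fg_projective R Q0"
    and d': "d' \<in> mod_hom R Q1 Q0" and e': "e' \<in> mod_hom R Q0 M" and e'Q: "e' ` carrier Q0 = carrier M"
    and d'Q: "d' ` carrier Q1 = a_kernel Q0 M e'"
    using Q by (simp_all add: presentation_def)
  have c0: "proj_cover R P0 e M" and c1: "proj_cover R P1 d (P0\<lparr>carrier := a_kernel P0 M e\<rparr>)"
    using P by (simp_all add: min_pres_def)
  have e: "e \<in> mod_hom R P0 M" and mP0: "module R P0"
    using c0 by (simp_all add: proj_cover_def fg_projective_module)
  have mQ0: "module R Q0" using Q0 by (rule fg_projective_module)
  obtain s0 b0 where s0: "s0 \<in> mod_hom R P0 Q0" and b0: "b0 \<in> mod_hom R Q0 P0"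
    and es: "\<And>x. x \<in> carrier P0 \<Longrightarrow> e' (s0 x) = e x" and eb: "\<And>x. x \<in> carrier Q0 \<Longrightarrow> e (b0 x) = e' x"
    and bs0: "\<And>x. x \<in> carrier P0 \<Longrightarrow> b0 (s0 x) = x"
    using proj_cover_retract[OF c0 M M Q0 e' e'Q mod_hom_id mod_hom_id] by auto
  let ?M = "P0\<lparr>carrier := a_kernel P0 M e\<rparr>" and ?N = "Q0\<lparr>carrier := a_kernel Q0 M e'\<rparr>"
  have mM: "module R ?M" by (rule restrict_module[OF mP0 submodule_kernel[OF mP0 M e]])
  have mN: "module R ?N" by (rule restrict_module[OF mQ0 submodule_kernel[OF mQ0 M e']])
  have \<sigma>: "s0 \<in> mod_hom R ?M ?N"
    by (rule mod_hom_into_submodule[OF mod_hom_on_submodule[OF s0]])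
       (use mod_hom_closed[OF s0] es in auto)
  have \<beta>: "b0 \<in> mod_hom R ?N ?M"
    by (rule mod_hom_into_submodule[OF mod_hom_on_submodule[OF b0]])
       (use mod_hom_closed[OF b0] eb in auto)
  have d'': "d' \<in> mod_hom R Q1 ?N" by (rule mod_hom_into_submodule[OF d']) (simp add: d'Q)
  have onto: "d' ` carrier Q1 = carrier ?N" by (simp add: d'Q)
  have bs': "b0 (s0 x) = x" if "x \<in> carrier ?M" for x using bs0 that by simp
  obtain s1 b1 where s1: "s1 \<in> mod_hom R P1 Q1" and b1: "b1 \<in> mod_hom R Q1 P1"
    and ds: "\<And>x. x \<in> carrier P1 \<Longrightarrow> d' (s1 x) = s0 (d x)" and db: "\<And>x. x \<in> carrier Q1 \<Longrightarrow> d (b1 x) = b0 (d' x)"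
    and bs1: "\<And>x. x \<in> carrier P1 \<Longrightarrow> b1 (s1 x) = x"
    using proj_cover_retract[OF c1 mM mN Q1 d'' onto \<sigma> \<beta> bs'] by auto
  show thesis
    by (rule that[of s1 s0 b1 b0]) (simp add: retraction_def s1 s0 b1 b0 es eb ds db bs0 bs1)
qed

text \<open>Minimality of the second presentation leaves no room for a complement. Degree 0 has to
  come first: that \<open>s0 b0\<close> is the identity on the kernel is the hypothesis needed in
  degree 1.\<close>

lemma min_pres_retraction_iso:
  assumes r: "retraction R P1 d P0 e Q1 d' Q0 e' s1 s0 b1 b0" and Q: "min_pres R Q1 d' Q0 e' M"
    and M: "module R M" and x: "x \<in> carrier Q1"
  shows "s1 (b1 x) = x"
proof -
  note r = retractionD[OF r]
  have c0: "proj_cover R Q0 e' M" and c1: "proj_cover R Q1 d' (Q0\<lparr>carrier := a_kernel Q0 M e'\<rparr>)"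
    using Q by (simp_all add: min_pres_def)
  have Q0: "module R Q0" and e': "e' \<in> mod_hom R Q0 M"
    using c0 by (simp_all add: proj_cover_def fg_projective_module)
  have N: "module R (Q0\<lparr>carrier := a_kernel Q0 M e'\<rparr>)"
    by (rule restrict_module[OF Q0 submodule_kernel[OF Q0 M e']])
  have sb0: "s0 (b0 y) = y" if "y \<in> carrier Q0" for y
    using proj_cover_retract_iso[where \<sigma> = "\<lambda>x. x" and \<beta> = "\<lambda>x. x" and e = e, OF c0 M r(2,4)] r(5,6,9) that
    by simp
  show ?thesis
    using proj_cover_retract_iso[where \<sigma> = s0 and \<beta> = b0 and e = d, OF c1 N r(1,3)] r(7,8,10) x sb0
    by simp
qed

text \<open>A projective object is handled as a split exact sequence
  \<open>src F \<rightarrow> tgt F \<rightarrow> Q\<close> with retraction \<open>r\<close> and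
  section \<open>j\<close>, so that the isomorphism with a direct sum of \<open>P = P\<close> and
  \<open>0 \<rightarrow> Q\<close> has to be unpacked only once.\<close>

definition splits :: "('a, 'x, 'y) mobj \<Rightarrow> ('a, 'z) module \<Rightarrow> ('y \<Rightarrow> 'x) \<Rightarrow> ('y \<Rightarrow> 'z) \<Rightarrow> ('z \<Rightarrow> 'y) \<Rightarrow> bool"
  where "splits F Q r p j \<longleftrightarrow> fg_projective R (src F) \<and> fg_projective R (tgt F) \<and> fg_projective R Q \<and>
    arr F \<in> mod_hom R (src F) (tgt F) \<and>
    r \<in> mod_hom R (tgt F) (src F) \<and> p \<in> mod_hom R (tgt F) Q \<and> j \<in> mod_hom R Q (tgt F) \<and>
    (\<forall>x\<in>carrier (src F). r (arr F x) = x \<and> p (arr F x) = \<zero>\<^bsub>Q\<^esub>) \<and>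
    (\<forall>z\<in>carrier Q. r (j z) = \<zero>\<^bsub>src F\<^esub> \<and> p (j z) = z) \<and>
    (\<forall>y\<in>carrier (tgt F). arr F (r y) \<oplus>\<^bsub>tgt F\<^esub> j (p y) = y)"

lemma splitsD:
  assumes "splits F Q r p j"
  shows "fg_projective R (src F)" "fg_projective R (tgt F)" "fg_projective R Q"
    "module R (src F)" "module R (tgt F)" "module R Q"
    "arr F \<in> mod_hom R (src F) (tgt F)" "r \<in> mod_hom R (tgt F) (src F)"
    "p \<in> mod_hom R (tgt F) Q" "j \<in> mod_hom R Q (tgt F)"
    "\<And>x. x \<in> carrier (src F) \<Longrightarrow> r (arr F x) = x" "\<And>x. x \<in> carrier (src F) \<Longrightarrow> p (arr F x) = \<zero>\<^bsub>Q\<^esub>"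
    "\<And>z. z \<in> carrier Q \<Longrightarrow> r (j z) = \<zero>\<^bsub>src F\<^esub>" "\<And>z. z \<in> carrier Q \<Longrightarrow> p (j z) = z"
    "\<And>y. y \<in> carrier (tgt F) \<Longrightarrow> arr F (r y) \<oplus>\<^bsub>tgt F\<^esub> j (p y) = y"
  using assms by (simp_all add: splits_def fg_projective_module)

text \<open>A map that vanishes on the source factors through \<open>p\<close>: apply
  \<open>b\<close> to the decomposition of \<open>y\<close> into its parts in \<open>src F\<close>
  and in \<open>Q\<close>.\<close>

lemma splits_vanishing:
  assumes F: "splits F Q r p j" and L: "module R L" and b: "b \<in> mod_hom R (tgt F) L"
    and bF: "\<And>x. x \<in> carrier (src F) \<Longrightarrow> b (arr F x) = \<zero>\<^bsub>L\<^esub>" and y: "y \<in> carrier (tgt F)"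
  shows "b (j (p y)) = b y"
proof -
  note s = splitsD[OF F]
  have r: "r y \<in> carrier (src F)" and jp: "j (p y) \<in> carrier (tgt F)" and Fr: "arr F (r y) \<in> carrier (tgt F)"
    using y mod_hom_closed[OF s(8)] mod_hom_closed[OF s(9)] mod_hom_closed[OF s(10)] mod_hom_closed[OF s(7)]
    by simp_all
  have "b y = b (arr F (r y) \<oplus>\<^bsub>tgt F\<^esub> j (p y))" by (simp add: s(15)[OF y])
  also have "\<dots> = b (arr F (r y)) \<oplus>\<^bsub>L\<^esub> b (j (p y))" by (rule mod_hom_add[OF b Fr jp])
  also have "\<dots> = b (j (p y))" using bF[OF r] mod_hom_closed[OF b jp] L by simp
  finally show ?thesis by simp
qed

lemma zero_mod_simps [simp]:
  "carrier (zero_mod R) = {\<zero>}" "\<zero>\<^bsub>zero_mod R\<^esub> = \<zero>" "x \<oplus>\<^bsub>zero_mod R\<^esub> y = x \<oplus> y"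
  "a \<odot>\<^bsub>zero_mod R\<^esub> x = a \<otimes> x"
  by (simp_all add: zero_mod_def)

lemma module_zero_mod [simp]: "module R (zero_mod R)"
  by (rule moduleI') simp_all

lemma M_projective_splits:
  fixes F :: "('a, 'x, 'y) mobj"
  assumes "M_projective R F"
  obtains Q :: "('a, nat \<Rightarrow> 'a) module" and r p j where "splits F Q r p j"
proof -
  let ?X = "src F" and ?Y = "tgt F"
  obtain P Q :: "('a, nat \<Rightarrow> 'a) module" where P: "fg_projective R P" and Q: "fg_projective R Q"
    and iso: "M_iso R F (M_dsum (id_obj P) (zero_obj R Q))" and obj: "M_obj R F"
    using assms by (auto simp: M_projective_def)
  have mX: "module R ?X" and mY: "module R ?Y" and f: "arr F \<in> mod_hom R ?X ?Y"
    using obj by (simp_all add: M_obj_def fg_module_def)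
  have mP: "module R P" and mQ: "module R Q" using P Q by (simp_all add: fg_projective_module)
  let ?PX = "dsum P (zero_mod R)" and ?PY = "dsum P Q"
  have mPX: "module R ?PX" and mPY: "module R ?PY" using mP mQ by simp_all
  obtain u v where u: "u \<in> mod_hom R ?X ?PX" and v: "v \<in> mod_hom R ?Y ?PY"
    and vf: "\<And>x. x \<in> carrier ?X \<Longrightarrow> v (arr F x) = map_prod (\<lambda>x. x) (\<lambda>_. \<zero>\<^bsub>Q\<^esub>) (u x)"
    and bu: "bij_betw u (carrier ?X) (carrier ?PX)" and bv: "bij_betw v (carrier ?Y) (carrier ?PY)"
    using iso by (auto simp: M_iso_def M_hom_def M_dsum_def id_obj_def zero_obj_def)
  obtain u' where u': "u' \<in> mod_hom R ?PX ?X" and u'u: "\<And>x. x \<in> carrier ?X \<Longrightarrow> u' (u x) = x"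
    and uu': "\<And>x. x \<in> carrier ?PX \<Longrightarrow> u (u' x) = x"
    using mod_hom_inverse[OF mX mPX u bu] by auto
  obtain v' where v': "v' \<in> mod_hom R ?PY ?Y" and v'v: "\<And>x. x \<in> carrier ?Y \<Longrightarrow> v' (v x) = x"
    and vv': "\<And>x. x \<in> carrier ?PY \<Longrightarrow> v (v' x) = x"
    using mod_hom_inverse[OF mY mPY v bv] by auto
  have vfst: "(\<lambda>y. fst (v y)) \<in> mod_hom R ?Y P" by (rule mod_hom_comp[OF v mod_hom_fst])
  have inl: "(\<lambda>x. (x, \<zero>)) \<in> mod_hom R P ?PX"
    using mod_hom_inl[OF module_zero_mod, of P] by simp
  \<comment> \<open>In the coordinates of \<open>v y\<close> in \<open>P \<times> Q\<close>, the
    maps \<open>r\<close> and \<open>p\<close> are the two projections and \<open>j\<close> is the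
    inclusion of \<open>Q\<close>. The entry \<open>\<zero>\<close> in \<open>r\<close> is the only
    element of the zero module, which is the second factor of the source.\<close>
  define r where "r y = u' (fst (v y), \<zero>)" for y
  define p where "p y = snd (v y)" for y
  define j where "j z = v' (\<zero>\<^bsub>P\<^esub>, z)" for z
  have r: "r \<in> mod_hom R ?Y ?X"
    unfolding r_def by (rule mod_hom_comp[OF mod_hom_comp[OF vfst inl] u'])
  have p: "p \<in> mod_hom R ?Y Q" unfolding p_def by (rule mod_hom_comp[OF v mod_hom_snd])
  have j: "j \<in> mod_hom R Q ?Y" unfolding j_def by (rule mod_hom_comp[OF mod_hom_inr[OF mP] v'])
  have vf': "v (arr F x) = (fst (u x), \<zero>\<^bsub>Q\<^esub>)" if "x \<in> carrier ?X" for x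
    by (simp add: vf[OF that] map_prod_def split_beta)
  have u0: "(fst (u x), \<zero>) = u x" if "x \<in> carrier ?X" for x
    using mod_hom_closed[OF u that] by auto
  have fp: "fst (v y) \<in> carrier P" "snd (v y) \<in> carrier Q" if "y \<in> carrier ?Y" for y
    using mod_hom_closed[OF v that] by auto
  have rf: "r (arr F x) = x" "p (arr F x) = \<zero>\<^bsub>Q\<^esub>" if x: "x \<in> carrier ?X" for x
    by (simp_all add: r_def p_def vf'[OF x] u0[OF x] u'u[OF x])
  have vj: "v (j z) = (\<zero>\<^bsub>P\<^esub>, z)" if z: "z \<in> carrier Q" for z
    unfolding j_def by (rule vv') (simp add: z mP)
  have rj: "r (j z) = \<zero>\<^bsub>?X\<^esub>" "p (j z) = z" if z: "z \<in> carrier Q" for z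
    using mod_hom_zero[OF u' mPX mX] by (simp_all add: r_def p_def vj[OF z])
  have sum: "arr F (r y) \<oplus>\<^bsub>?Y\<^esub> j (p y) = y" if y: "y \<in> carrier ?Y" for y
  proof -
    have ry: "r y \<in> carrier ?X" and py: "p y \<in> carrier Q"
      using mod_hom_closed[OF r y] mod_hom_closed[OF p y] .
    have "u (r y) = (fst (v y), \<zero>)" unfolding r_def by (rule uu') (simp add: fp[OF y])
    then have vfr: "v (arr F (r y)) = (fst (v y), \<zero>\<^bsub>Q\<^esub>)" by (simp add: vf'[OF ry])
    have "v (arr F (r y) \<oplus>\<^bsub>?Y\<^esub> j (p y)) = (fst (v y), \<zero>\<^bsub>Q\<^esub>) \<oplus>\<^bsub>?PY\<^esub> (\<zero>\<^bsub>P\<^esub>, snd (v y))"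
      using mod_hom_add[OF v mod_hom_closed[OF f ry] mod_hom_closed[OF j py]] vfr vj[OF py]
      by (simp add: p_def)
    also have "\<dots> = v y" using fp[OF y] mP mQ by simp
    finally have "v' (v (arr F (r y) \<oplus>\<^bsub>?Y\<^esub> j (p y))) = v' (v y)" by simp
    then show ?thesis using mod_hom_closed[OF f ry] mod_hom_closed[OF j py] y mY by (simp add: v'v)
  qed
  have "fg_projective R ?PY" by (rule fg_projective_dsum[OF P Q])
  then have fgY: "fg_projective R ?Y" by (rule fg_projective_retract[OF _ mY v v' v'v])
  have fgX: "fg_projective R ?X"
  proof (rule fg_projective_retract[OF fgY mX f r])
    show "r (arr F x) = x" if "x \<in> carrier ?X" for x by (rule rf(1)[OF that])
  qed
  have "splits F Q r p j"
    unfolding splits_def using fgX fgY Q f r p j rf rj sum by simp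
  then show thesis by (rule that)
qed

lemma set_add_eq_carrierI:
  assumes M: "module R M" and K: "K \<subseteq> carrier M" and L: "L \<subseteq> carrier M"
    and *: "\<And>x. x \<in> carrier M \<Longrightarrow> \<exists>a\<in>K. x \<ominus>\<^bsub>M\<^esub> a \<in> L"
  shows "set_add M K L = carrier M"
proof
  show "carrier M \<subseteq> set_add M K L"
  proof
    fix x assume x: "x \<in> carrier M"
    obtain a where a: "a \<in> K" "x \<ominus>\<^bsub>M\<^esub> a \<in> L" using *[OF x] by blast
    have "x = a \<oplus>\<^bsub>M\<^esub> (x \<ominus>\<^bsub>M\<^esub> a)" using M K x a by (simp add: subset_iff)
    then show "x \<in> set_add M K L" using a unfolding mem_set_add_iff by blast
  qed
qed (use M K L in \<open>auto simp: mem_set_add_iff subset_iff\<close>)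

lemma set_add_eq_kernel_carrier:
  assumes M: "module R M" and N: "module R N" and h: "h \<in> mod_hom R M N"
  shows "set_add M (a_kernel M N h) (carrier M) = carrier M"
proof (rule set_add_eq_carrierI[OF M])
  fix x assume "x \<in> carrier M"
  then show "\<exists>a\<in>a_kernel M N h. x \<ominus>\<^bsub>M\<^esub> a \<in> carrier M"
    using M mod_hom_zero[OF h M N] by (intro bexI[of _ "\<zero>\<^bsub>M\<^esub>"]) simp_all
qed auto

text \<open>A submodule \<open>L\<close> of \<open>src F\<close> is tested through the subobject
  \<open>(L, tgt F)\<close>, and a submodule \<open>L\<close> of \<open>Q\<close> through the pair
  of \<open>src F\<close> and the preimage of \<open>L\<close> under \<open>p\<close>. A submodule
  of \<open>tgt F\<close> is not reached in this way, since filling the target together with the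
  kernel says nothing about the source.\<close>

lemma M_proj_cover_splits:
  fixes Q :: "('a, 'z) module" and C :: "('a, 'e) module"
  assumes cover: "M_proj_cover R F \<epsilon> G" and F: "splits F Q r p j"
    and A: "module R (src G)" and B: "module R (tgt G)" and f: "arr G \<in> mod_hom R (src G) (tgt G)"
    and C: "module R C"
    and g: "g \<in> mod_hom R (tgt G) C" and onto: "g ` carrier (tgt G) = carrier C"
    and ker: "a_kernel (tgt G) C g = arr G ` carrier (src G)"
  shows "proj_cover R (src F) (fst \<epsilon>) (src G)" "proj_cover R Q (\<lambda>z. g (snd \<epsilon> (j z))) C"
proof -
  let ?X = "src F" and ?Y = "tgt F" and ?A = "src G" and ?B = "tgt G"
  let ?f = "arr F" and ?h = "arr G" and ?e = "fst \<epsilon>" and ?k = "snd \<epsilon>"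
  have X: "module R ?X" and Y: "module R ?Y" and Q: "module R Q"
    and fgX: "fg_projective R ?X" and fgQ: "fg_projective R Q"
    and F': "?f \<in> mod_hom R ?X ?Y"
    and r: "r \<in> mod_hom R ?Y ?X" and p: "p \<in> mod_hom R ?Y Q" and j: "j \<in> mod_hom R Q ?Y"
    and pf: "\<And>x. x \<in> carrier ?X \<Longrightarrow> p (?f x) = \<zero>\<^bsub>Q\<^esub>"
    and pj: "\<And>z. z \<in> carrier Q \<Longrightarrow> p (j z) = z"
    using F by (simp_all add: splits_def fg_projective_module)
  have e: "?e \<in> mod_hom R ?X ?A" and k: "?k \<in> mod_hom R ?Y ?B"
    and kf: "\<And>x. x \<in> carrier ?X \<Longrightarrow> ?k (?f x) = ?h (?e x)"
    and eonto: "?e ` carrier ?X = carrier ?A" and konto: "?k ` carrier ?Y = carrier ?B"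
    and sup: "M_superfluous R F (a_kernel ?X ?A ?e) (a_kernel ?Y ?B ?k)"
    using cover by (auto simp: M_proj_cover_def M_hom_def M_ker_def)
  note cl = mod_hom_closed[OF e] mod_hom_closed[OF k] mod_hom_closed[OF F'] mod_hom_closed[OF r]
    mod_hom_closed[OF p] mod_hom_closed[OF j] mod_hom_closed[OF f] mod_hom_closed[OF g]
  have gh: "g (?h x) = \<zero>\<^bsub>C\<^esub>" if "x \<in> carrier ?A" for x
  proof -
    have "?h x \<in> a_kernel ?B C g" using that unfolding ker by blast
    then show ?thesis by simp
  qed
  show "proj_cover R ?X ?e ?A"
    unfolding proj_cover_def
  proof (intro conjI)
    show "superfluous R ?X (a_kernel ?X ?A ?e)"
      unfolding superfluous_def
    proof (intro allI impI)
      fix L assume L: "submodule L R ?X \<and> set_add ?X (a_kernel ?X ?A ?e) L = carrier ?X"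
      have 1: "submodule (carrier ?Y) R ?Y" using Y by (rule submodule_carrier)
      have 2: "?f ` L \<subseteq> carrier ?Y" using L cl submodule_subset[OF X, of L] by blast
      have 3: "set_add ?Y (a_kernel ?Y ?B ?k) (carrier ?Y) = carrier ?Y"
        by (rule set_add_eq_kernel_carrier[OF Y B k])
      show "L = carrier ?X" using sup L 1 2 3 unfolding M_superfluous_def by blast
    qed
  qed (use fgX e eonto in simp_all)
  let ?q = "\<lambda>z. g (?k (j z))"
  have q: "?q \<in> mod_hom R Q C" by (rule mod_hom_comp[OF mod_hom_comp[OF j k] g])
  have qp: "?q (p y) = g (?k y)" if "y \<in> carrier ?Y" for y
    by (rule splits_vanishing[OF F C mod_hom_comp[OF k g] _ that]) (simp add: kf gh cl)
  show "proj_cover R Q ?q C"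
    unfolding proj_cover_def
  proof (intro conjI)
    show "?q ` carrier Q = carrier C"
    proof
      show "carrier C \<subseteq> ?q ` carrier Q"
      proof
        fix c assume "c \<in> carrier C"
        then obtain b where b: "b \<in> carrier ?B" "c = g b" using onto by blast
        then obtain y where y: "y \<in> carrier ?Y" "b = ?k y" using konto by blast
        have "c = ?q (p y)" by (simp add: qp[OF y(1)] b y)
        then show "c \<in> ?q ` carrier Q" using cl(5)[OF y(1)] by (rule image_eqI)
      qed
    qed (use mod_hom_closed[OF q] in auto)
    show "superfluous R Q (a_kernel Q C ?q)"
      unfolding superfluous_def
    proof (intro allI impI)
      fix L assume L: "submodule L R Q \<and> set_add Q (a_kernel Q C ?q) L = carrier Q"
      then have sL: "submodule L R Q" by simp
      have LQ: "L \<subseteq> carrier Q" by (rule submodule_subset[OF Q sL])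
      let ?L = "{y \<in> carrier ?Y. p y \<in> L}"
      have 1: "submodule ?L R ?Y" by (rule submodule_preimage[OF Y Q p sL])
      have 2: "submodule (carrier ?X) R ?X" using X by (rule submodule_carrier)
      have 3: "?f ` carrier ?X \<subseteq> ?L" using cl pf submodule_zero[OF Q sL] by auto
      have 4: "set_add ?X (a_kernel ?X ?A ?e) (carrier ?X) = carrier ?X"
        by (rule set_add_eq_kernel_carrier[OF X A e])
      have 5: "set_add ?Y (a_kernel ?Y ?B ?k) ?L = carrier ?Y"
      proof (rule set_add_eq_carrierI[OF Y])
        fix y assume y: "y \<in> carrier ?Y"
        have "p y \<in> set_add Q (a_kernel Q C ?q) L" using L cl y by simp
        then obtain z l where z: "z \<in> carrier Q" "?q z = \<zero>\<^bsub>C\<^esub>" and l: "l \<in> L" and pzl: "p y = z \<oplus>\<^bsub>Q\<^esub> l"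
          by (auto simp: mem_set_add_iff)
        have "?k (j z) \<in> a_kernel ?B C g" using z cl by simp
        then obtain a where a: "a \<in> carrier ?A" "?k (j z) = ?h a" unfolding ker by blast
        then obtain x where x: "x \<in> carrier ?X" "a = ?e x" using eonto by blast
        \<comment> \<open>\<open>j z\<close> need not lie in the kernel of the cover of the target;
          only its image in \<open>C\<close> is zero. Subtracting \<open>?f x\<close> moves it into
          that kernel and leaves its component in \<open>Q\<close> unchanged.\<close>
        let ?t = "j z \<ominus>\<^bsub>?Y\<^esub> ?f x"
        have t: "?t \<in> carrier ?Y" using z x cl Y by simp
        have "?k ?t = \<zero>\<^bsub>?B\<^esub>" using z x a cl Y B by (simp add: mod_hom_diff[OF k Y B] kf)
        moreover have "p (y \<ominus>\<^bsub>?Y\<^esub> ?t) = l"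
        proof -
          have "p ?t = z" using z x cl Y Q by (simp add: mod_hom_diff[OF p Y Q] pf pj)
          then show ?thesis using y t z l LQ pzl Q by (simp add: mod_hom_diff[OF p Y Q] subset_iff)
        qed
        ultimately show "\<exists>a\<in>a_kernel ?Y ?B ?k. y \<ominus>\<^bsub>?Y\<^esub> a \<in> ?L"
          using t y l Y by (intro bexI[of _ ?t]) simp_all
      qed auto
      have eq: "carrier ?Y = ?L"
        using sup 1 2 3 4 5 unfolding M_superfluous_def by blast
      \<comment> \<open>The preimage of \<open>L\<close> is all of \<open>tgt F\<close>, so it
        contains \<open>j z\<close>, and \<open>p\<close> brings this back to
        \<open>z\<close>.\<close>
      have "z \<in> L" if z: "z \<in> carrier Q" for z
      proof -
        have "j z \<in> ?L" by (rule subst[where P = "\<lambda>S. j z \<in> S", OF eq cl(6)[OF z]])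
        then show ?thesis using pj[OF z] by simp
      qed
      then show "L = carrier Q" using LQ by blast
    qed
  qed (use fgQ q in simp_all)
qed


text \<open>The statement on covers is used twice. The second time the object is the kernel of the
  first cover, and the row of kernels \<open>?KX \<rightarrow> ?KY \<rightarrow> ?KQ\<close> takes
  the place of \<open>A \<rightarrow> B \<rightarrow> C\<close>. Much of the proof is the part of
  the snake lemma that makes this row exact in the middle and surjective on the right. The last two
  conclusions say that \<open>g\<close> after \<epsilon> and \<open>p0\<close> after \<delta> pass
  to the quotients \<open>Q0\<close> and \<open>Q1\<close>.\<close>

lemma M_min_pres_splits:
  fixes A :: "('a, 'e) module" and C :: "('a, 'd) module"
    and Q0 :: "('a, 'z) module" and Q1 :: "('a, 'w) module"
  assumes pres: "M_min_pres R F1 \<delta> F0 \<epsilon> \<lparr>src = A, tgt = B, arr = f\<rparr>"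
    and F0: "splits F0 Q0 r0 p0 j0" and F1: "splits F1 Q1 r1 p1 j1"
    and A: "module R A" and B: "module R B" and f: "f \<in> mod_hom R A B" and inj: "inj_on f (carrier A)"
    and C: "module R C" and g: "g \<in> mod_hom R B C" and onto: "g ` carrier B = carrier C"
    and ker: "a_kernel B C g = f ` carrier A"
  shows "min_pres R (src F1) (fst \<delta>) (src F0) (fst \<epsilon>) A"
    and "min_pres R Q1 (\<lambda>z. p0 (snd \<delta> (j1 z))) Q0 (\<lambda>z. g (snd \<epsilon> (j0 z))) C"
    and "presentation R (tgt F1) (snd \<delta>) (tgt F0) (snd \<epsilon>) B"
    and "\<And>x. x \<in> carrier (src F1) \<Longrightarrow> snd \<delta> (arr F1 x) = arr F0 (fst \<delta> x)"
    and "\<And>x. x \<in> carrier (src F0) \<Longrightarrow> snd \<epsilon> (arr F0 x) = f (fst \<epsilon> x)"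
    and "\<And>y. y \<in> carrier (tgt F0) \<Longrightarrow> g (snd \<epsilon> (j0 (p0 y))) = g (snd \<epsilon> y)"
    and "\<And>y. y \<in> carrier (tgt F1) \<Longrightarrow> p0 (snd \<delta> (j1 (p1 y))) = p0 (snd \<delta> y)"
proof -
  let ?G = "\<lparr>src = A, tgt = B, arr = f\<rparr>"
  let ?X0 = "src F0" and ?Y0 = "tgt F0" and ?X1 = "src F1" and ?Y1 = "tgt F1"
  let ?F0 = "arr F0" and ?F1 = "arr F1"
  let ?e = "fst \<epsilon>" and ?k = "snd \<epsilon>" and ?d = "fst \<delta>" and ?m = "snd \<delta>"
  note s0 = splitsD[OF F0] and s1 = splitsD[OF F1]
  have c0: "M_proj_cover R F0 \<epsilon> ?G" and c1: "M_proj_cover R F1 \<delta> (M_ker F0 ?G \<epsilon>)"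
    using pres by (simp_all add: M_min_pres_def)
  have e: "?e \<in> mod_hom R ?X0 A" and k: "?k \<in> mod_hom R ?Y0 B"
    and kf: "\<And>x. x \<in> carrier ?X0 \<Longrightarrow> ?k (?F0 x) = f (?e x)"
    and eonto: "?e ` carrier ?X0 = carrier A" and konto: "?k ` carrier ?Y0 = carrier B"
    using c0 by (auto simp: M_proj_cover_def M_hom_def)
  let ?KX = "?X0\<lparr>carrier := a_kernel ?X0 A ?e\<rparr>" and ?KY = "?Y0\<lparr>carrier := a_kernel ?Y0 B ?k\<rparr>"
  have d: "?d \<in> mod_hom R ?X1 ?KX" and m: "?m \<in> mod_hom R ?Y1 ?KY"
    and mF: "\<And>x. x \<in> carrier ?X1 \<Longrightarrow> ?m (?F1 x) = ?F0 (?d x)"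
    and monto: "?m ` carrier ?Y1 = a_kernel ?Y0 B ?k"
    using c1 by (auto simp: M_proj_cover_def M_hom_def M_ker_def)
  have mY: "?m \<in> mod_hom R ?Y1 ?Y0" by (rule mod_hom_from_submodule[OF m]) auto
  have KX: "module R ?KX" by (rule restrict_module[OF s0(4) submodule_kernel[OF s0(4) A e]])
  have KY: "module R ?KY" by (rule restrict_module[OF s0(5) submodule_kernel[OF s0(5) B k]])
  note cl = mod_hom_closed[OF e] mod_hom_closed[OF k] mod_hom_closed[OF s0(7)] mod_hom_closed[OF s0(8)]
    mod_hom_closed[OF s0(9)] mod_hom_closed[OF s0(10)] mod_hom_closed[OF f] mod_hom_closed[OF g]
  have gh: "g (f x) = \<zero>\<^bsub>C\<^esub>" if "x \<in> carrier A" for x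
  proof -
    have "f x \<in> a_kernel B C g" using that unfolding ker by blast
    then show ?thesis by simp
  qed
  let ?q = "\<lambda>z. g (?k (j0 z))"
  have q: "?q \<in> mod_hom R Q0 C" by (rule mod_hom_comp[OF mod_hom_comp[OF s0(10) k] g])
  have qp: "?q (p0 y) = g (?k y)" if "y \<in> carrier ?Y0" for y
    by (rule splits_vanishing[OF F0 C mod_hom_comp[OF k g] _ that]) (simp add: kf gh cl)
  let ?KQ = "Q0\<lparr>carrier := a_kernel Q0 C ?q\<rparr>"
  have KQ: "module R ?KQ" by (rule restrict_module[OF s0(6) submodule_kernel[OF s0(6) C q]])
  have p0K: "p0 \<in> mod_hom R ?KY ?KQ"
  proof (rule mod_hom_into_submodule[OF mod_hom_on_submodule[OF s0(9)]])
    show "p0 ` carrier ?KY \<subseteq> a_kernel Q0 C ?q"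
      using cl qp mod_hom_zero[OF g B C] by auto
  qed auto
  have p0onto: "p0 ` carrier ?KY = carrier ?KQ"
  proof
    show "carrier ?KQ \<subseteq> p0 ` carrier ?KY"
    proof
      fix z assume "z \<in> carrier ?KQ"
      then have z: "z \<in> carrier Q0" "?q z = \<zero>\<^bsub>C\<^esub>" by simp_all
      then have "?k (j0 z) \<in> a_kernel B C g" using cl by simp
      then obtain a where a: "a \<in> carrier A" "?k (j0 z) = f a" unfolding ker by blast
      then obtain x where x: "x \<in> carrier ?X0" "a = ?e x" using eonto by blast
      \<comment> \<open>The correction by \<open>?F0 x\<close> again moves the lift
        \<open>j0 z\<close> into the kernel without changing its image under
        \<open>p0\<close>.\<close>
      let ?t = "j0 z \<ominus>\<^bsub>?Y0\<^esub> ?F0 x"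
      have "?t \<in> carrier ?KY"
        using z x a cl s0(5) B by (simp add: mod_hom_diff[OF k s0(5) B] kf)
      moreover have "p0 ?t = z"
        using z x cl s0(5,6) by (simp add: mod_hom_diff[OF s0(9,5,6)] s0(12,14))
      ultimately show "z \<in> p0 ` carrier ?KY" by (metis imageI)
    qed
  qed (use mod_hom_closed[OF p0K] in blast)
  have F0K: "?F0 \<in> mod_hom R ?KX ?KY"
  proof (rule mod_hom_into_submodule[OF mod_hom_on_submodule[OF s0(7)]])
    show "?F0 ` carrier ?KX \<subseteq> a_kernel ?Y0 B ?k"
      using cl kf mod_hom_zero[OF f A B] by auto
  qed auto
  have p0ker: "a_kernel ?KY ?KQ p0 = ?F0 ` carrier ?KX"
  proof
    show "a_kernel ?KY ?KQ p0 \<subseteq> ?F0 ` carrier ?KX"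
    proof
      fix y assume "y \<in> a_kernel ?KY ?KQ p0"
      then have y: "y \<in> carrier ?Y0" "?k y = \<zero>\<^bsub>B\<^esub>" "p0 y = \<zero>\<^bsub>Q0\<^esub>" by simp_all
      have r: "r0 y \<in> carrier ?X0" using cl y by simp
      have yr: "?F0 (r0 y) = y"
        using s0(15)[OF y(1)] y(3) mod_hom_zero[OF s0(10,6,5)] cl(3)[OF r] s0(5) by simp
      \<comment> \<open>Here it is decisive that \<open>f\<close> is a monomorphism:
        \<open>r0 y\<close> goes to zero in \<open>B\<close>, and this forces it into the kernel
        over \<open>A\<close>.\<close>
      have "f (?e (r0 y)) = f \<zero>\<^bsub>A\<^esub>"
        using kf[OF r] yr y(2) mod_hom_zero[OF f A B] by simp
      then have "?e (r0 y) = \<zero>\<^bsub>A\<^esub>" using inj cl r A by (auto dest: inj_onD)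
      then have "r0 y \<in> carrier ?KX" using r by simp
      then show "y \<in> ?F0 ` carrier ?KX" using yr by (metis imageI)
    qed
    show "?F0 ` carrier ?KX \<subseteq> a_kernel ?KY ?KQ p0"
      using mod_hom_closed[OF F0K] s0(12) by auto
  qed
  have "proj_cover R ?X0 ?e A" "proj_cover R Q0 ?q C"
    using M_proj_cover_splits[OF c0 F0, of C g] A B f C g onto ker by simp_all
  moreover have "proj_cover R ?X1 ?d ?KX" "proj_cover R Q1 (\<lambda>z. p0 (?m (j1 z))) ?KQ"
    using M_proj_cover_splits[OF c1 F1, of ?KQ p0] KX KY F0K KQ p0K p0onto p0ker
    by (simp_all add: M_ker_def subset_iff)
  ultimately show "min_pres R ?X1 ?d ?X0 ?e A" "min_pres R Q1 (\<lambda>z. p0 (?m (j1 z))) Q0 ?q C"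
    by (simp_all add: min_pres_def)
  show "presentation R ?Y1 ?m ?Y0 ?k B"
    using B s0 s1 mY k konto monto by (simp add: presentation_def)
  show "?q (p0 y) = g (?k y)" if "y \<in> carrier ?Y0" for y by (rule qp[OF that])
  have dX: "?d x \<in> carrier ?X0" if "x \<in> carrier ?X1" for x using mod_hom_closed[OF d that] by simp
  show "p0 (?m (j1 (p1 y))) = p0 (?m y)" if "y \<in> carrier ?Y1" for y
    by (rule splits_vanishing[OF F1 s0(6) mod_hom_comp[OF mY s0(9)] _ that]) (simp add: mF s0(12) dX)
  show "?m (?F1 x) = ?F0 (?d x)" if "x \<in> carrier ?X1" for x by (rule mF[OF that])
  show "?k (?F0 x) = f (?e x)" if "x \<in> carrier ?X0" for x by (rule kf[OF that])
qed

end

section \<open>Cokernels and transposes\<close>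

context cring begin

section \<open>Cosets, quotient modules and cokernels\<close>

lemma submodule_abelian_subgroup:
  assumes M: "module R M" and H: "submodule H R M"
  shows "abelian_subgroup H M"
proof (rule abelian_subgroupI3)
  show "additive_subgroup H M"
    using submodule.axioms(1)[OF H] by (rule additive_subgroup.intro)
  show "abelian_group M" using M by (rule module.axioms(2))
qed

lemma coset_zero:
  assumes M: "module R M" and H: "submodule H R M"
  shows "H +>\<^bsub>M\<^esub> \<zero>\<^bsub>M\<^esub> = H"
  by (rule abelian_group.a_coset_add_zero[OF module.axioms(2)[OF M] submodule_subset[OF M H]])

lemma coset_sum:
  assumes M: "module R M" and H: "submodule H R M" and x: "x \<in> carrier M" and y: "y \<in> carrier M"
  shows "set_add M (H +>\<^bsub>M\<^esub> x) (H +>\<^bsub>M\<^esub> y) = H +>\<^bsub>M\<^esub> (x \<oplus>\<^bsub>M\<^esub> y)"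
  by (rule abelian_subgroup.a_rcos_sum[OF submodule_abelian_subgroup[OF M H] x y])

lemma coset_eq_iff_mem:
  assumes M: "module R M" and H: "submodule H R M" and x: "x \<in> carrier M"
  shows "H +>\<^bsub>M\<^esub> x = H \<longleftrightarrow> x \<in> H"
proof
  assume "H +>\<^bsub>M\<^esub> x = H"
  then show "x \<in> H"
    using abelian_subgroup.a_rcos_self[OF submodule_abelian_subgroup[OF M H] x] by simp
qed (rule abelian_group.a_coset_join2[OF module.axioms(2)[OF M] x submodule.axioms(1)[OF H]])

lemma mem_coset_iff: "z \<in> H +>\<^bsub>M\<^esub> x \<longleftrightarrow> (\<exists>h\<in>H. z = h \<oplus>\<^bsub>M\<^esub> x)"
  by (auto simp: a_r_coset_def')

text \<open>Adding \<open>K\<close> absorbs the image of \<open>H\<close>, so the image of a whole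
  coset becomes a single coset again. Both the scalar multiplication of \<open>quot_mod\<close> and
  \<open>cok_map\<close> have this form.\<close>

lemma coset_map:
  assumes M: "module R M" and H: "submodule H R M" and N: "module R N" and K: "submodule K R N"
    and v: "v \<in> mod_hom R M N" and vH: "v ` H \<subseteq> K" and x: "x \<in> carrier M"
  shows "set_add N K (v ` (H +>\<^bsub>M\<^esub> x)) = K +>\<^bsub>N\<^esub> v x"
proof -
  have HM: "H \<subseteq> carrier M" and KN: "K \<subseteq> carrier N"
    by (rule submodule_subset[OF M H], rule submodule_subset[OF N K])
  have vx: "v x \<in> carrier N" by (rule mod_hom_closed[OF v x])
  show ?thesis
  proof
    show "set_add N K (v ` (H +>\<^bsub>M\<^esub> x)) \<subseteq> K +>\<^bsub>N\<^esub> v x"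
    proof
      fix z assume "z \<in> set_add N K (v ` (H +>\<^bsub>M\<^esub> x))"
      then obtain k h where kh: "k \<in> K" "h \<in> H" "z = k \<oplus>\<^bsub>N\<^esub> v (h \<oplus>\<^bsub>M\<^esub> x)"
        by (auto simp: mem_set_add_iff mem_coset_iff)
      have h: "h \<in> carrier M" and vh: "v h \<in> K" using kh HM vH by auto
      have "z = (k \<oplus>\<^bsub>N\<^esub> v h) \<oplus>\<^bsub>N\<^esub> v x"
        using kh h vh vx x KN N by (simp add: mod_hom_add[OF v] mod_add_assoc subset_iff)
      moreover have "k \<oplus>\<^bsub>N\<^esub> v h \<in> K" by (rule submodule_add[OF N K kh(1) vh])
      ultimately show "z \<in> K +>\<^bsub>N\<^esub> v x" unfolding mem_coset_iff by (rule bexI)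
    qed
    show "K +>\<^bsub>N\<^esub> v x \<subseteq> set_add N K (v ` (H +>\<^bsub>M\<^esub> x))"
    proof
      fix z assume "z \<in> K +>\<^bsub>N\<^esub> v x"
      then obtain k where k: "k \<in> K" "z = k \<oplus>\<^bsub>N\<^esub> v x" by (auto simp: mem_coset_iff)
      have "x = \<zero>\<^bsub>M\<^esub> \<oplus>\<^bsub>M\<^esub> x" using x M by simp
      then have "x \<in> H +>\<^bsub>M\<^esub> x" unfolding mem_coset_iff by (rule bexI) (rule submodule_zero[OF M H])
      then have "v x \<in> v ` (H +>\<^bsub>M\<^esub> x)" by (rule imageI)
      then show "z \<in> set_add N K (v ` (H +>\<^bsub>M\<^esub> x))" unfolding mem_set_add_iff using k by (intro bexI)
    qed
  qed
qed

text \<open>The module axioms are inherited along a surjection that respects the operations, which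
  saves verifying them on cosets.\<close>

lemma module_image:
  assumes M: "module R M" and q: "q ` carrier M = carrier N"
    and add: "\<And>x y. \<lbrakk>x \<in> carrier M; y \<in> carrier M\<rbrakk> \<Longrightarrow> q x \<oplus>\<^bsub>N\<^esub> q y = q (x \<oplus>\<^bsub>M\<^esub> y)"
    and smult: "\<And>a x. \<lbrakk>a \<in> carrier R; x \<in> carrier M\<rbrakk> \<Longrightarrow> a \<odot>\<^bsub>N\<^esub> q x = q (a \<odot>\<^bsub>M\<^esub> x)"
    and zero: "\<zero>\<^bsub>N\<^esub> = q \<zero>\<^bsub>M\<^esub>"
  shows "module R N" "q \<in> mod_hom R M N"
proof -
  interpret M: module R M by fact
  have rep: "\<exists>x\<in>carrier M. y = q x" if "y \<in> carrier N" for y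
    using that unfolding q[symmetric] by blast
  have cl: "q x \<in> carrier N" if "x \<in> carrier M" for x
    using that unfolding q[symmetric] by blast
  show "module R N"
  proof (rule moduleI')
    fix x y assume "x \<in> carrier N" "y \<in> carrier N"
    then obtain u v where uv: "u \<in> carrier M" "x = q u" "v \<in> carrier M" "y = q v" using rep by metis
    show "x \<oplus>\<^bsub>N\<^esub> y \<in> carrier N" by (simp add: uv add cl M)
    show "x \<oplus>\<^bsub>N\<^esub> y = y \<oplus>\<^bsub>N\<^esub> x" by (simp add: uv add M mod_add_commute)
  next
    fix x y z assume "x \<in> carrier N" "y \<in> carrier N" "z \<in> carrier N"
    then obtain u v w where "u \<in> carrier M" "x = q u" "v \<in> carrier M" "y = q v" "w \<in> carrier M" "z = q w"
      using rep by metis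
    then show "x \<oplus>\<^bsub>N\<^esub> y \<oplus>\<^bsub>N\<^esub> z = x \<oplus>\<^bsub>N\<^esub> (y \<oplus>\<^bsub>N\<^esub> z)" by (simp add: add M mod_add_assoc)
  next
    show "\<zero>\<^bsub>N\<^esub> \<in> carrier N" unfolding zero by (rule cl) (simp add: M)
  next
    fix x assume "x \<in> carrier N"
    then obtain u where u: "u \<in> carrier M" "x = q u" using rep by metis
    show "\<zero>\<^bsub>N\<^esub> \<oplus>\<^bsub>N\<^esub> x = x" "\<one> \<odot>\<^bsub>N\<^esub> x = x" "\<zero> \<odot>\<^bsub>N\<^esub> x = \<zero>\<^bsub>N\<^esub>"
      using u M by (simp_all add: zero add smult)
    fix a assume a: "a \<in> carrier R"
    show "a \<odot>\<^bsub>N\<^esub> x \<in> carrier N" using a u M by (simp add: smult cl)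
    fix b assume b: "b \<in> carrier R"
    show "(a \<oplus> b) \<odot>\<^bsub>N\<^esub> x = a \<odot>\<^bsub>N\<^esub> x \<oplus>\<^bsub>N\<^esub> b \<odot>\<^bsub>N\<^esub> x"
      "(a \<otimes> b) \<odot>\<^bsub>N\<^esub> x = a \<odot>\<^bsub>N\<^esub> (b \<odot>\<^bsub>N\<^esub> x)"
      using a b u M by (simp_all add: smult add M.smult_l_distr M.smult_assoc1)
  next
    fix a x y assume a: "a \<in> carrier R" and "x \<in> carrier N" "y \<in> carrier N"
    then obtain u v where uv: "u \<in> carrier M" "x = q u" "v \<in> carrier M" "y = q v" using rep by metis
    then show "a \<odot>\<^bsub>N\<^esub> (x \<oplus>\<^bsub>N\<^esub> y) = a \<odot>\<^bsub>N\<^esub> x \<oplus>\<^bsub>N\<^esub> a \<odot>\<^bsub>N\<^esub> y"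
      using a M by (simp add: smult add mod_smult_add)
  qed
  show "q \<in> mod_hom R M N" by (rule mod_homI) (simp_all add: cl add smult)
qed

lemma smult_mod_hom: "\<lbrakk>module R M; a \<in> carrier R\<rbrakk> \<Longrightarrow> (\<lambda>x. a \<odot>\<^bsub>M\<^esub> x) \<in> mod_hom R M M"
  by (rule mod_hom_smult_fun) simp_all

lemma module_quot_mod:
  assumes M: "module R M" and H: "submodule H R M"
  shows "module R (quot_mod M H)" "(\<lambda>x. H +>\<^bsub>M\<^esub> x) \<in> mod_hom R M (quot_mod M H)"
    "(\<lambda>x. H +>\<^bsub>M\<^esub> x) ` carrier M = carrier (quot_mod M H)"
proof -
  have onto: "(\<lambda>x. H +>\<^bsub>M\<^esub> x) ` carrier M = carrier (quot_mod M H)"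
    by (auto simp: quot_mod_def A_RCOSETS_def')
  show "(\<lambda>x. H +>\<^bsub>M\<^esub> x) ` carrier M = carrier (quot_mod M H)" by (rule onto)
  have "(H +>\<^bsub>M\<^esub> x) \<oplus>\<^bsub>quot_mod M H\<^esub> (H +>\<^bsub>M\<^esub> y) = H +>\<^bsub>M\<^esub> (x \<oplus>\<^bsub>M\<^esub> y)"
    if "x \<in> carrier M" "y \<in> carrier M" for x y
    using coset_sum[OF M H that] by (simp add: quot_mod_def)
  moreover have "a \<odot>\<^bsub>quot_mod M H\<^esub> (H +>\<^bsub>M\<^esub> x) = H +>\<^bsub>M\<^esub> (a \<odot>\<^bsub>M\<^esub> x)"
    if a: "a \<in> carrier R" and x: "x \<in> carrier M" for a x
  proof -
    have "(\<lambda>x. a \<odot>\<^bsub>M\<^esub> x) ` H \<subseteq> H" using submodule_smult[OF M H a] by blast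
    then show ?thesis
      using coset_map[OF M H M H smult_mod_hom[OF M a] _ x] by (simp add: quot_mod_def)
  qed
  moreover have "\<zero>\<^bsub>quot_mod M H\<^esub> = H +>\<^bsub>M\<^esub> \<zero>\<^bsub>M\<^esub>"
    using coset_zero[OF M H] by (simp add: quot_mod_def)
  ultimately show "module R (quot_mod M H)" "(\<lambda>x. H +>\<^bsub>M\<^esub> x) \<in> mod_hom R M (quot_mod M H)"
    using module_image[OF M onto] by simp_all
qed

lemma module_Cok:
  assumes M: "module R M" and N: "module R N" and k: "k \<in> mod_hom R M N"
  shows "module R (Cok M N k)" "cok_proj M N k \<in> mod_hom R N (Cok M N k)"
    "cok_proj M N k ` carrier N = carrier (Cok M N k)"
    "\<And>y. y \<in> carrier N \<Longrightarrow> cok_proj M N k y = \<zero>\<^bsub>Cok M N k\<^esub> \<longleftrightarrow> y \<in> k ` carrier M"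
  using module_quot_mod[OF N submodule_image[OF M N k]] coset_eq_iff_mem[OF N submodule_image[OF M N k]]
  by (simp_all add: Cok_def cok_proj_def) (simp add: quot_mod_def)

lemma cok_map_proj:
  assumes M: "module R M" and N: "module R N" and k: "k \<in> mod_hom R M N"
    and M': "module R M'" and N': "module R N'" and k': "k' \<in> mod_hom R M' N'"
    and v: "v \<in> mod_hom R N N'" and vk: "\<And>x. x \<in> carrier M \<Longrightarrow> v (k x) \<in> k' ` carrier M'"
    and y: "y \<in> carrier N"
  shows "cok_map M' N' k' v (cok_proj M N k y) = cok_proj M' N' k' (v y)"
  unfolding cok_map_def cok_proj_def
  by (rule coset_map[OF N submodule_image[OF M N k] N' submodule_image[OF M' N' k'] v _ y])
     (use vk in blast)

section \<open>Transposes described by functionals\<close>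

abbreviation fnl :: "('a, 'p) module \<Rightarrow> ('p \<Rightarrow> 'a) set" where
  "fnl P \<equiv> mod_hom R P (reg_mod R)"

text \<open>
  \<open>q\<close> presents \<open>T\<close> as the cokernel of \<open>Hom(P0, R) \<rightarrow> Hom(P1, R)\<close>. It is applied to functionals that
  need not be extensional, so the conditions only compare values on the carrier.
\<close>

definition transp :: "('a, 'p) module \<Rightarrow> ('p \<Rightarrow> 'q) \<Rightarrow> ('a, 'q) module \<Rightarrow> ('a, 't) module \<Rightarrow>
    (('p \<Rightarrow> 'a) \<Rightarrow> 't) \<Rightarrow> bool" where
  "transp P1 d P0 T q \<longleftrightarrow> module R T \<and> (\<forall>\<phi>\<in>fnl P1. q \<phi> \<in> carrier T) \<and>
    (\<forall>\<phi>\<in>fnl P1. \<forall>\<psi>\<in>fnl P1. \<forall>\<chi>\<in>fnl P1.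
      (\<forall>x\<in>carrier P1. \<chi> x = \<phi> x \<oplus> \<psi> x) \<longrightarrow> q \<chi> = q \<phi> \<oplus>\<^bsub>T\<^esub> q \<psi>) \<and>
    (\<forall>a\<in>carrier R. \<forall>\<phi>\<in>fnl P1. \<forall>\<chi>\<in>fnl P1.
      (\<forall>x\<in>carrier P1. \<chi> x = a \<otimes> \<phi> x) \<longrightarrow> q \<chi> = a \<odot>\<^bsub>T\<^esub> q \<phi>) \<and>
    (\<forall>t\<in>carrier T. \<exists>\<phi>\<in>fnl P1. t = q \<phi>) \<and>
    (\<forall>\<phi>\<in>fnl P1. q \<phi> = \<zero>\<^bsub>T\<^esub> \<longleftrightarrow> (\<exists>\<psi>\<in>fnl P0. \<forall>x\<in>carrier P1. \<phi> x = \<psi> (d x)))"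

lemma fnl_closed: "\<lbrakk>\<phi> \<in> fnl P; x \<in> carrier P\<rbrakk> \<Longrightarrow> \<phi> x \<in> carrier R"
  using mod_hom_closed[of \<phi> P "reg_mod R"] by simp

lemma fnl_add: "\<lbrakk>\<phi> \<in> fnl P; \<psi> \<in> fnl P\<rbrakk> \<Longrightarrow> (\<lambda>x. \<phi> x \<oplus> \<psi> x) \<in> fnl P"
  using mod_hom_add_fun[of \<phi> P "reg_mod R" \<psi>] by simp

lemma reg_mod_minus [simp]: "\<lbrakk>x \<in> carrier R; y \<in> carrier R\<rbrakk> \<Longrightarrow> x \<ominus>\<^bsub>reg_mod R\<^esub> y = x \<ominus> y"
proof -
  assume xy: "x \<in> carrier R" "y \<in> carrier R"
  then have "x = (x \<ominus> y) \<oplus>\<^bsub>reg_mod R\<^esub> y" by (simp add: minus_eq a_assoc l_neg)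
  then show ?thesis
    using xy mod_eq_diff_iff[OF module_reg_mod, of "x \<ominus> y" x y] by simp
qed

lemma fnl_diff:
  assumes "\<phi> \<in> fnl P" "\<psi> \<in> fnl P" "module R P"
  shows "(\<lambda>x. \<phi> x \<ominus> \<psi> x) \<in> fnl P"
proof (rule mod_hom_cong[OF mod_hom_diff_fun[OF assms module_reg_mod] assms(3)])
  fix x assume "x \<in> carrier P"
  then show "\<phi> x \<ominus> \<psi> x = \<phi> x \<ominus>\<^bsub>reg_mod R\<^esub> \<psi> x"
    using fnl_closed[OF assms(1)] fnl_closed[OF assms(2)] by simp
qed

lemma fnl_zero: "(\<lambda>x. \<zero>) \<in> fnl P"
  using mod_hom_zero_fun[OF module_reg_mod, of P] by simp

lemma fnl_comp: "\<lbrakk>h \<in> mod_hom R P Q; \<phi> \<in> fnl Q\<rbrakk> \<Longrightarrow> (\<lambda>x. \<phi> (h x)) \<in> fnl P"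
  by (rule mod_hom_comp)

lemma fnl_at_zero: "\<lbrakk>\<phi> \<in> fnl P; module R P\<rbrakk> \<Longrightarrow> \<phi> \<zero>\<^bsub>P\<^esub> = \<zero>"
  using mod_hom_zero[of \<phi> P "reg_mod R"] by simp

lemma transpD:
  assumes "transp P1 d P0 T q"
  shows "module R T" "\<And>\<phi>. \<phi> \<in> fnl P1 \<Longrightarrow> q \<phi> \<in> carrier T"
    "\<And>\<phi> \<psi> \<chi>. \<lbrakk>\<phi> \<in> fnl P1; \<psi> \<in> fnl P1; \<chi> \<in> fnl P1; \<And>x. x \<in> carrier P1 \<Longrightarrow> \<chi> x = \<phi> x \<oplus> \<psi> x\<rbrakk>
      \<Longrightarrow> q \<chi> = q \<phi> \<oplus>\<^bsub>T\<^esub> q \<psi>"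
    "\<And>a \<phi> \<chi>. \<lbrakk>a \<in> carrier R; \<phi> \<in> fnl P1; \<chi> \<in> fnl P1; \<And>x. x \<in> carrier P1 \<Longrightarrow> \<chi> x = a \<otimes> \<phi> x\<rbrakk>
      \<Longrightarrow> q \<chi> = a \<odot>\<^bsub>T\<^esub> q \<phi>"
    "\<And>t. t \<in> carrier T \<Longrightarrow> \<exists>\<phi>\<in>fnl P1. t = q \<phi>"
    "\<And>\<phi>. \<phi> \<in> fnl P1 \<Longrightarrow> q \<phi> = \<zero>\<^bsub>T\<^esub> \<longleftrightarrow> (\<exists>\<psi>\<in>fnl P0. \<forall>x\<in>carrier P1. \<phi> x = \<psi> (d x))"
  using assms unfolding transp_def by simp_all

text \<open>This follows from the additivity clause: \<phi> agrees on the carrier with the sum of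
  \<psi> and the zero functional, and the class of the latter is zero because it is a pullback along
  \<open>d\<close>.\<close>

lemma transp_cong:
  assumes T: "transp P1 d P0 T q" and \<phi>: "\<phi> \<in> fnl P1" "\<psi> \<in> fnl P1"
    and eq: "\<And>x. x \<in> carrier P1 \<Longrightarrow> \<phi> x = \<psi> x"
  shows "q \<phi> = q \<psi>"
proof -
  have 0: "q (\<lambda>x. \<zero>) = \<zero>\<^bsub>T\<^esub>"
    unfolding transpD(6)[OF T fnl_zero] by (rule bexI[OF _ fnl_zero]) simp
  have "q \<phi> = q \<psi> \<oplus>\<^bsub>T\<^esub> q (\<lambda>x. \<zero>)"
    by (rule transpD(3)[OF T \<phi>(2) fnl_zero \<phi>(1)]) (simp add: eq fnl_closed[OF \<phi>(2)])
  then show ?thesis by (simp add: 0 transpD(1)[OF T] transpD(2)[OF T \<phi>(2)])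
qed

lemma transp_diff:
  assumes T: "transp P1 d P0 T q" and \<phi>: "\<phi> \<in> fnl P1" "\<psi> \<in> fnl P1" "\<chi> \<in> fnl P1"
    and eq: "\<And>x. x \<in> carrier P1 \<Longrightarrow> \<chi> x = \<phi> x \<ominus> \<psi> x"
  shows "q \<chi> = q \<phi> \<ominus>\<^bsub>T\<^esub> q \<psi>"
proof -
  have "q \<phi> = q \<chi> \<oplus>\<^bsub>T\<^esub> q \<psi>"
    by (rule transpD(3)[OF T \<phi>(3,2,1)])
      (simp add: eq fnl_closed[OF \<phi>(2)] fnl_closed[OF \<phi>(1)] minus_eq a_assoc l_neg)
  then show ?thesis by (simp add: mod_eq_diff_iff transpD(1)[OF T] transpD(2)[OF T] \<phi>)
qed

lemma transp_mod_hom: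
  assumes T: "transp P1 d P0 T q" and P1: "module R P1"
  shows "q \<in> mod_hom R (dual R P1) T" "q ` carrier (dual R P1) = carrier T"
proof -
  have D: "module R (dual R P1)" using P1 by simp
  note TD = transpD[OF T]
  show "q \<in> mod_hom R (dual R P1) T"
  proof (rule mod_homI)
    fix \<phi> \<psi> assume h: "\<phi> \<in> carrier (dual R P1)" "\<psi> \<in> carrier (dual R P1)"
    have "\<phi> \<oplus>\<^bsub>dual R P1\<^esub> \<psi> \<in> carrier (dual R P1)" using D h by (rule mod_add_closed)
    then show "q (\<phi> \<oplus>\<^bsub>dual R P1\<^esub> \<psi>) = q \<phi> \<oplus>\<^bsub>T\<^esub> q \<psi>" using h by (intro TD(3)) simp_all
  next
    fix a \<phi> assume h: "a \<in> carrier R" "\<phi> \<in> carrier (dual R P1)"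
    have "a \<odot>\<^bsub>dual R P1\<^esub> \<phi> \<in> carrier (dual R P1)" using D h by (rule mod_smult_closed)
    then show "q (a \<odot>\<^bsub>dual R P1\<^esub> \<phi>) = a \<odot>\<^bsub>T\<^esub> q \<phi>" using h by (intro TD(4)) simp_all
  qed (use TD(2) in simp)
  show "q ` carrier (dual R P1) = carrier T"
  proof
    show "carrier T \<subseteq> q ` carrier (dual R P1)"
    proof
      fix t assume "t \<in> carrier T"
      then obtain \<phi> where \<phi>: "\<phi> \<in> fnl P1" "t = q \<phi>" using TD(5) by blast
      have r: "restrict \<phi> (carrier P1) \<in> fnl P1" by (rule mod_hom_restrict[OF P1 \<phi>(1)])
      have "t = q (restrict \<phi> (carrier P1))"
        unfolding \<phi>(2) by (rule transp_cong[OF T \<phi>(1) r]) simp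
      then show "t \<in> q ` carrier (dual R P1)" by (rule image_eqI[where f = q]) (use r in simp)
    qed
  qed (use TD(2) in auto)
qed

text \<open>Universal property of the transpose: a map out of \<open>T\<close> is a linear operation
  on functionals that kills those pulled back along \<open>d\<close>.\<close>

lemma transp_lift:
  assumes T: "transp P1 d P0 T q" and P1: "module R P1" and L: "module R L"
    and k: "\<And>\<phi>. \<phi> \<in> fnl P1 \<Longrightarrow> k \<phi> \<in> carrier L"
    and kadd: "\<And>\<phi> \<psi> \<chi>. \<lbrakk>\<phi> \<in> fnl P1; \<psi> \<in> fnl P1; \<chi> \<in> fnl P1; \<And>x. x \<in> carrier P1 \<Longrightarrow> \<chi> x = \<phi> x \<oplus> \<psi> x\<rbrakk>
      \<Longrightarrow> k \<chi> = k \<phi> \<oplus>\<^bsub>L\<^esub> k \<psi>"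
    and ksm: "\<And>a \<phi> \<chi>. \<lbrakk>a \<in> carrier R; \<phi> \<in> fnl P1; \<chi> \<in> fnl P1; \<And>x. x \<in> carrier P1 \<Longrightarrow> \<chi> x = a \<otimes> \<phi> x\<rbrakk>
      \<Longrightarrow> k \<chi> = a \<odot>\<^bsub>L\<^esub> k \<phi>"
    and k0: "\<And>\<phi> \<psi>. \<lbrakk>\<phi> \<in> fnl P1; \<psi> \<in> fnl P0; \<And>x. x \<in> carrier P1 \<Longrightarrow> \<phi> x = \<psi> (d x)\<rbrakk> \<Longrightarrow> k \<phi> = \<zero>\<^bsub>L\<^esub>"
  shows "\<exists>t\<in>mod_hom R T L. \<forall>\<phi>\<in>fnl P1. t (q \<phi>) = k \<phi>"
proof -
  have D: "module R (dual R P1)" using P1 by simp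
  note TD = transpD[OF T]
  note q = transp_mod_hom[OF T P1]
  have k': "k \<in> mod_hom R (dual R P1) L"
  proof (rule mod_homI)
    fix \<phi> \<psi> assume h: "\<phi> \<in> carrier (dual R P1)" "\<psi> \<in> carrier (dual R P1)"
    have "\<phi> \<oplus>\<^bsub>dual R P1\<^esub> \<psi> \<in> carrier (dual R P1)" using D h by (rule mod_add_closed)
    then show "k (\<phi> \<oplus>\<^bsub>dual R P1\<^esub> \<psi>) = k \<phi> \<oplus>\<^bsub>L\<^esub> k \<psi>" using h by (intro kadd) simp_all
  next
    fix a \<phi> assume h: "a \<in> carrier R" "\<phi> \<in> carrier (dual R P1)"
    have "a \<odot>\<^bsub>dual R P1\<^esub> \<phi> \<in> carrier (dual R P1)" using D h by (rule mod_smult_closed)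
    then show "k (a \<odot>\<^bsub>dual R P1\<^esub> \<phi>) = a \<odot>\<^bsub>L\<^esub> k \<phi>" using h by (intro ksm) simp_all
  qed (use k in simp)
  have "\<exists>t\<in>mod_hom R T L. \<forall>\<phi>\<in>carrier (dual R P1). t (q \<phi>) = k \<phi>"
  proof (rule mod_hom_factor[OF D TD(1) L q(1) k' q(2)])
    fix \<phi> assume "\<phi> \<in> carrier (dual R P1)" "q \<phi> = \<zero>\<^bsub>T\<^esub>"
    then obtain \<psi> where "\<phi> \<in> fnl P1" "\<psi> \<in> fnl P0" "\<And>x. x \<in> carrier P1 \<Longrightarrow> \<phi> x = \<psi> (d x)"
      using TD(6)[of \<phi>] by auto
    then show "k \<phi> = \<zero>\<^bsub>L\<^esub>" by (rule k0)
  qed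
  then obtain t where t: "t \<in> mod_hom R T L" "\<And>\<phi>. \<phi> \<in> carrier (dual R P1) \<Longrightarrow> t (q \<phi>) = k \<phi>" by blast
  \<comment> \<open>The factored map is known on extensional functionals only; adding the zero
    functional compares \<phi> with its restriction.\<close>
  have kz: "k (\<lambda>x. \<zero>) = \<zero>\<^bsub>L\<^esub>" by (rule k0[OF fnl_zero fnl_zero]) simp
  have "t (q \<phi>) = k \<phi>" if \<phi>: "\<phi> \<in> fnl P1" for \<phi>
  proof -
    have r: "restrict \<phi> (carrier P1) \<in> fnl P1" by (rule mod_hom_restrict[OF P1 \<phi>])
    have "q \<phi> = q (restrict \<phi> (carrier P1))" by (rule transp_cong[OF T \<phi> r]) simp
    moreover have "k \<phi> = k (restrict \<phi> (carrier P1)) \<oplus>\<^bsub>L\<^esub> k (\<lambda>x. \<zero>)"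
      by (rule kadd[OF r fnl_zero \<phi>]) (simp add: fnl_closed[OF \<phi>])
    ultimately show ?thesis using r by (simp add: t(2) kz L k)
  qed
  then show ?thesis using t(1) by blast
qed

text \<open>Transposition is contravariant: precomposition with \<open>c1\<close> takes pullbacks
  along \<open>d'\<close> to pullbacks along \<open>d\<close>, because
  \<open>\<psi> (d' (c1 x)) = \<psi> (c0 (d x))\<close>.\<close>

lemma transp_map:
  assumes T: "transp P1 d P0 T q" and T': "transp Q1 d' Q0 T' q'" and Q1: "module R Q1"
    and c1: "c1 \<in> mod_hom R P1 Q1" and c0: "c0 \<in> mod_hom R P0 Q0"
    and comm: "\<And>x. x \<in> carrier P1 \<Longrightarrow> d' (c1 x) = c0 (d x)"
  shows "\<exists>t\<in>mod_hom R T' T. \<forall>\<phi>\<in>fnl Q1. t (q' \<phi>) = q (\<lambda>x. \<phi> (c1 x))"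
proof (rule transp_lift[OF T' Q1 transpD(1)[OF T]])
  fix \<phi> assume "\<phi> \<in> fnl Q1"
  then show "q (\<lambda>x. \<phi> (c1 x)) \<in> carrier T" by (intro transpD(2)[OF T] fnl_comp[OF c1])
next
  fix \<phi> \<psi> \<chi> assume "\<phi> \<in> fnl Q1" "\<psi> \<in> fnl Q1" "\<chi> \<in> fnl Q1"
    "\<And>x. x \<in> carrier Q1 \<Longrightarrow> \<chi> x = \<phi> x \<oplus> \<psi> x"
  then show "q (\<lambda>x. \<chi> (c1 x)) = q (\<lambda>x. \<phi> (c1 x)) \<oplus>\<^bsub>T\<^esub> q (\<lambda>x. \<psi> (c1 x))"
    using mod_hom_closed[OF c1] by (intro transpD(3)[OF T] fnl_comp[OF c1]) simp_all
next
  fix a \<phi> \<chi> assume "a \<in> carrier R" "\<phi> \<in> fnl Q1" "\<chi> \<in> fnl Q1"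
    "\<And>x. x \<in> carrier Q1 \<Longrightarrow> \<chi> x = a \<otimes> \<phi> x"
  then show "q (\<lambda>x. \<chi> (c1 x)) = a \<odot>\<^bsub>T\<^esub> q (\<lambda>x. \<phi> (c1 x))"
    using mod_hom_closed[OF c1] by (intro transpD(4)[OF T] fnl_comp[OF c1]) simp_all
next
  fix \<phi> \<psi> assume h: "\<phi> \<in> fnl Q1" "\<psi> \<in> fnl Q0" "\<And>x. x \<in> carrier Q1 \<Longrightarrow> \<phi> x = \<psi> (d' x)"
  have "\<forall>x\<in>carrier P1. \<phi> (c1 x) = \<psi> (c0 (d x))"
    using h(3) mod_hom_closed[OF c1] comm by simp
  then show "q (\<lambda>x. \<phi> (c1 x)) = \<zero>\<^bsub>T\<^esub>"
    using transpD(6)[OF T fnl_comp[OF c1 h(1)]] fnl_comp[OF c0 h(2)]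
    by (auto intro!: bexI[of _ "\<lambda>x. \<psi> (c0 x)"])
qed

text \<open>The transpose of a module and the two components of the transpose of a monomorphism are
  all instances; only the identification \<open>\<iota>\<close> of functionals on \<open>P1\<close>
  with elements of \<open>N\<close> differs.\<close>

lemma transp_Cok:
  assumes M: "module R M" and N: "module R N" and k: "k \<in> mod_hom R M N"
    and \<iota>: "\<And>\<phi>. \<phi> \<in> fnl P1 \<Longrightarrow> \<iota> \<phi> \<in> carrier N"
    and \<iota>add: "\<And>\<phi> \<psi> \<chi>. \<lbrakk>\<phi> \<in> fnl P1; \<psi> \<in> fnl P1; \<chi> \<in> fnl P1; \<And>x. x \<in> carrier P1 \<Longrightarrow> \<chi> x = \<phi> x \<oplus> \<psi> x\<rbrakk>
      \<Longrightarrow> \<iota> \<chi> = \<iota> \<phi> \<oplus>\<^bsub>N\<^esub> \<iota> \<psi>"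
    and \<iota>sm: "\<And>a \<phi> \<chi>. \<lbrakk>a \<in> carrier R; \<phi> \<in> fnl P1; \<chi> \<in> fnl P1; \<And>x. x \<in> carrier P1 \<Longrightarrow> \<chi> x = a \<otimes> \<phi> x\<rbrakk>
      \<Longrightarrow> \<iota> \<chi> = a \<odot>\<^bsub>N\<^esub> \<iota> \<phi>"
    and onto: "\<And>y. y \<in> carrier N \<Longrightarrow> \<exists>\<phi>\<in>fnl P1. y = \<iota> \<phi>"
    and ker: "\<And>\<phi>. \<phi> \<in> fnl P1 \<Longrightarrow>
      \<iota> \<phi> \<in> k ` carrier M \<longleftrightarrow> (\<exists>\<psi>\<in>fnl P0. \<forall>x\<in>carrier P1. \<phi> x = \<psi> (d x))"
  shows "transp P1 d P0 (Cok M N k) (\<lambda>\<phi>. cok_proj M N k (\<iota> \<phi>))"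
  unfolding transp_def
proof (intro conjI ballI impI)
  note C = module_Cok[OF M N k]
  show "module R (Cok M N k)" by (rule C)
  fix \<phi> assume \<phi>: "\<phi> \<in> fnl P1"
  show "cok_proj M N k (\<iota> \<phi>) \<in> carrier (Cok M N k)"
    by (rule mod_hom_closed[OF C(2) \<iota>[OF \<phi>]])
  show "cok_proj M N k (\<iota> \<phi>) = \<zero>\<^bsub>Cok M N k\<^esub> \<longleftrightarrow> (\<exists>\<psi>\<in>fnl P0. \<forall>x\<in>carrier P1. \<phi> x = \<psi> (d x))"
    by (simp only: C(4)[OF \<iota>[OF \<phi>]] ker[OF \<phi>])
  fix \<psi> \<chi> assume h: "\<psi> \<in> fnl P1" "\<chi> \<in> fnl P1" "\<forall>x\<in>carrier P1. \<chi> x = \<phi> x \<oplus> \<psi> x"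
  then have "\<iota> \<chi> = \<iota> \<phi> \<oplus>\<^bsub>N\<^esub> \<iota> \<psi>" using \<phi> by (intro \<iota>add) simp_all
  then show "cok_proj M N k (\<iota> \<chi>) = cok_proj M N k (\<iota> \<phi>) \<oplus>\<^bsub>Cok M N k\<^esub> cok_proj M N k (\<iota> \<psi>)"
    using \<iota> \<phi> h by (simp add: mod_hom_add[OF C(2)])
next
  note C = module_Cok[OF M N k]
  fix a \<phi> \<chi> assume h: "a \<in> carrier R" "\<phi> \<in> fnl P1" "\<chi> \<in> fnl P1" "\<forall>x\<in>carrier P1. \<chi> x = a \<otimes> \<phi> x"
  then have "\<iota> \<chi> = a \<odot>\<^bsub>N\<^esub> \<iota> \<phi>" by (intro \<iota>sm) simp_all
  then show "cok_proj M N k (\<iota> \<chi>) = a \<odot>\<^bsub>Cok M N k\<^esub> cok_proj M N k (\<iota> \<phi>)"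
    using \<iota> h by (simp add: mod_hom_smult[OF C(2)])
next
  fix t assume "t \<in> carrier (Cok M N k)"
  then have "t \<in> cok_proj M N k ` carrier N" using module_Cok(3)[OF M N k] by simp
  then obtain y where y: "y \<in> carrier N" "t = cok_proj M N k y" by blast
  from onto[OF y(1)] y(2) show "\<exists>\<phi>\<in>fnl P1. t = cok_proj M N k (\<iota> \<phi>)" by blast
qed

end

section \<open>The transpose in the category of homomorphisms\<close>

context cring begin

lemma precomp_mod_hom:
  assumes M: "module R M" and N: "module R N" and d: "d \<in> mod_hom R M N" and L: "module R L"
  shows "precomp M d \<in> mod_hom R (Hom_mod R N L) (Hom_mod R M L)"
proof (rule mod_homI)
  fix h assume "h \<in> carrier (Hom_mod R N L)"
  then have "(\<lambda>x. h (d x)) \<in> mod_hom R M L" by (intro mod_hom_comp[OF d]) simp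
  then show "precomp M d h \<in> carrier (Hom_mod R M L)"
    using M by (simp add: precomp_def compose_def)
next
  fix h k
  show "precomp M d (h \<oplus>\<^bsub>Hom_mod R N L\<^esub> k) = precomp M d h \<oplus>\<^bsub>Hom_mod R M L\<^esub> precomp M d k"
    using mod_hom_closed[OF d] by (auto intro!: restrict_ext simp: precomp_def compose_def)
next
  fix a h
  show "precomp M d (a \<odot>\<^bsub>Hom_mod R N L\<^esub> h) = a \<odot>\<^bsub>Hom_mod R M L\<^esub> precomp M d h"
    using mod_hom_closed[OF d] by (auto intro!: restrict_ext simp: precomp_def compose_def)
qed

text \<open>The class of \<phi> in the transpose. Restriction turns \<phi> into an element of the
  Hom module, which consists of extensional functions only.\<close>

definition Tr_class :: "('a, 'p) module \<Rightarrow> ('p \<Rightarrow> 'q) \<Rightarrow> ('a, 'q) module \<Rightarrow> ('p \<Rightarrow> 'a) \<Rightarrow> ('p \<Rightarrow> 'a) set"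
  where "Tr_class P1 d P0 \<phi> =
    cok_proj (dual R P0) (dual R P1) (precomp P1 d) (restrict \<phi> (carrier P1))"

lemma restrict_eq_precomp_iff:
  assumes P1: "module R P1" and P0: "module R P0" and d: "d \<in> mod_hom R P1 P0" and \<phi>: "\<phi> \<in> fnl P1"
  shows "restrict \<phi> (carrier P1) \<in> precomp P1 d ` carrier (dual R P0) \<longleftrightarrow>
    (\<exists>\<psi>\<in>fnl P0. \<forall>x\<in>carrier P1. \<phi> x = \<psi> (d x))"
proof
  assume "restrict \<phi> (carrier P1) \<in> precomp P1 d ` carrier (dual R P0)"
  then obtain \<psi> where \<psi>: "\<psi> \<in> fnl P0" and eq: "restrict \<phi> (carrier P1) = precomp P1 d \<psi>" by auto
  have "\<phi> x = \<psi> (d x)" if "x \<in> carrier P1" for x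
    using fun_cong[OF eq, of x] that by (simp add: precomp_def compose_def)
  then show "\<exists>\<psi>\<in>fnl P0. \<forall>x\<in>carrier P1. \<phi> x = \<psi> (d x)" using \<psi> by (intro bexI ballI)
next
  assume "\<exists>\<psi>\<in>fnl P0. \<forall>x\<in>carrier P1. \<phi> x = \<psi> (d x)"
  then obtain \<psi> where \<psi>: "\<psi> \<in> fnl P0" "\<And>x. x \<in> carrier P1 \<Longrightarrow> \<phi> x = \<psi> (d x)" by auto
  have "restrict \<phi> (carrier P1) = precomp P1 d (restrict \<psi> (carrier P0))"
    using \<psi>(2) mod_hom_closed[OF d] by (auto intro!: restrict_ext simp: precomp_def compose_def)
  moreover have "restrict \<psi> (carrier P0) \<in> carrier (dual R P0)"
    using mod_hom_restrict[OF P0 \<psi>(1)] by simp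
  ultimately show "restrict \<phi> (carrier P1) \<in> precomp P1 d ` carrier (dual R P0)"
    by (rule image_eqI[where f = "precomp P1 d"])
qed

lemma transp_Tr:
  assumes P1: "module R P1" and P0: "module R P0" and d: "d \<in> mod_hom R P1 P0"
  shows "transp P1 d P0 (Tr R P1 d P0) (Tr_class P1 d P0)"
proof -
  have "transp P1 d P0 (Cok (dual R P0) (dual R P1) (precomp P1 d))
    (\<lambda>\<phi>. cok_proj (dual R P0) (dual R P1) (precomp P1 d) (restrict \<phi> (carrier P1)))"
  proof (rule transp_Cok)
    show "precomp P1 d \<in> mod_hom R (dual R P0) (dual R P1)"
      by (rule precomp_mod_hom[OF P1 P0 d module_reg_mod])
    fix \<phi> assume \<phi>: "\<phi> \<in> fnl P1"
    show "restrict \<phi> (carrier P1) \<in> carrier (dual R P1)" using mod_hom_restrict[OF P1 \<phi>] by simp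
    show "restrict \<phi> (carrier P1) \<in> precomp P1 d ` carrier (dual R P0) \<longleftrightarrow>
      (\<exists>\<psi>\<in>fnl P0. \<forall>x\<in>carrier P1. \<phi> x = \<psi> (d x))"
      by (rule restrict_eq_precomp_iff[OF P1 P0 d \<phi>])
  next
    fix y assume "y \<in> carrier (dual R P1)"
    then have "y \<in> fnl P1" "y = restrict y (carrier P1)" by (auto simp: extensional_restrict)
    then show "\<exists>\<phi>\<in>fnl P1. y = restrict \<phi> (carrier P1)" by (intro bexI)
  qed (use P1 P0 in \<open>auto intro!: restrict_ext\<close>)
  then show ?thesis by (simp only: Tr_def Tr_class_def[abs_def])
qed

text \<open>On classes, the map of cosets used to define the transpose of a homomorphism is
  precomposition with \<open>c1\<close>. This connects \<open>is_Tr_map\<close> with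
  \<open>transp_map\<close>.\<close>

lemma cok_map_Tr_class:
  assumes P1: "module R P1" and P0: "module R P0" and d: "d \<in> mod_hom R P1 P0"
    and Q1: "module R Q1" and Q0: "module R Q0" and d': "d' \<in> mod_hom R Q1 Q0"
    and c1: "c1 \<in> mod_hom R P1 Q1" and c0: "c0 \<in> mod_hom R P0 Q0"
    and comm: "\<And>x. x \<in> carrier P1 \<Longrightarrow> d' (c1 x) = c0 (d x)" and \<phi>: "\<phi> \<in> fnl Q1"
  shows "cok_map (dual R P0) (dual R P1) (precomp P1 d) (precomp P1 c1) (Tr_class Q1 d' Q0 \<phi>)
    = Tr_class P1 d P0 (\<lambda>x. \<phi> (c1 x))"
proof -
  have "cok_map (dual R P0) (dual R P1) (precomp P1 d) (precomp P1 c1) (Tr_class Q1 d' Q0 \<phi>)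
    = cok_proj (dual R P0) (dual R P1) (precomp P1 d) (precomp P1 c1 (restrict \<phi> (carrier Q1)))"
    unfolding Tr_class_def
  proof (rule cok_map_proj)
    show "precomp Q1 d' \<in> mod_hom R (dual R Q0) (dual R Q1)"
      by (rule precomp_mod_hom[OF Q1 Q0 d' module_reg_mod])
    show "precomp P1 d \<in> mod_hom R (dual R P0) (dual R P1)"
      by (rule precomp_mod_hom[OF P1 P0 d module_reg_mod])
    show "precomp P1 c1 \<in> mod_hom R (dual R Q1) (dual R P1)"
      by (rule precomp_mod_hom[OF P1 Q1 c1 module_reg_mod])
    show "restrict \<phi> (carrier Q1) \<in> carrier (dual R Q1)" using mod_hom_restrict[OF Q1 \<phi>] by simp
    fix \<psi> assume \<psi>: "\<psi> \<in> carrier (dual R Q0)"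
    have "precomp P1 c1 (precomp Q1 d' \<psi>) = precomp P1 d (precomp P0 c0 \<psi>)"
      using comm mod_hom_closed[OF c1] mod_hom_closed[OF d]
      by (auto intro!: restrict_ext simp: precomp_def compose_def)
    moreover have "precomp P0 c0 \<psi> \<in> carrier (dual R P0)"
      by (rule mod_hom_closed[OF precomp_mod_hom[OF P0 Q0 c0 module_reg_mod] \<psi>])
    ultimately show "precomp P1 c1 (precomp Q1 d' \<psi>) \<in> precomp P1 d ` carrier (dual R P0)"
      by (rule image_eqI[where f = "precomp P1 d"])
  qed (use assms in simp_all)
  moreover have "precomp P1 c1 (restrict \<phi> (carrier Q1)) = restrict (\<lambda>x. \<phi> (c1 x)) (carrier P1)"
    using mod_hom_closed[OF c1] by (auto intro!: restrict_ext simp: precomp_def compose_def)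
  ultimately show ?thesis by (simp add: Tr_class_def)
qed

section \<open>Hom modules in the category and the dual of an object\<close>

lemma M_Hom_mod_simps [simp]:
  "carrier (M_Hom_mod R F G) =
    M_hom R F G \<inter> (extensional (carrier (src F)) \<times> extensional (carrier (tgt F)))"
  "(u, v) \<oplus>\<^bsub>M_Hom_mod R F G\<^esub> (u', v') = (\<lambda>x\<in>carrier (src F). u x \<oplus>\<^bsub>src G\<^esub> u' x, \<lambda>y\<in>carrier (tgt F). v y \<oplus>\<^bsub>tgt G\<^esub> v' y)"
  "a \<odot>\<^bsub>M_Hom_mod R F G\<^esub> (u, v) = (\<lambda>x\<in>carrier (src F). a \<odot>\<^bsub>src G\<^esub> u x, \<lambda>y\<in>carrier (tgt F). a \<odot>\<^bsub>tgt G\<^esub> v y)"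
  by (simp_all add: M_Hom_mod_def)

lemma M_homI:
  assumes "u \<in> mod_hom R (src F) (src G)" "v \<in> mod_hom R (tgt F) (tgt G)"
    "\<And>x. x \<in> carrier (src F) \<Longrightarrow> v (arr F x) = arr G (u x)"
  shows "(u, v) \<in> M_hom R F G"
  using assms by (simp add: M_hom_def)

lemma M_homD:
  assumes "(u, v) \<in> M_hom R F G"
  shows "u \<in> mod_hom R (src F) (src G)" "v \<in> mod_hom R (tgt F) (tgt G)"
    "\<And>x. x \<in> carrier (src F) \<Longrightarrow> v (arr F x) = arr G (u x)"
  using assms by (simp_all add: M_hom_def)

text \<open>The structure is that of the product of the two Hom modules, in which the commutative
  squares form a submodule.\<close>

lemma module_M_Hom_mod:
  assumes X: "module R (src F)" and Y: "module R (tgt F)" and F: "arr F \<in> mod_hom R (src F) (tgt F)"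
    and A: "module R (src G)" and B: "module R (tgt G)" and G: "arr G \<in> mod_hom R (src G) (tgt G)"
  shows "module R (M_Hom_mod R F G)"
proof -
  let ?H = "M_hom R F G \<inter> (extensional (carrier (src F)) \<times> extensional (carrier (tgt F)))"
  let ?D = "dsum (Hom_mod R (src F) (src G)) (Hom_mod R (tgt F) (tgt G))"
  have D: "module R ?D" using X Y A B by simp
  note cl = mod_hom_closed[OF F] mod_hom_closed[OF G]
  have "submodule ?H R ?D"
  proof (rule submoduleI'[OF D])
    show "?H \<subseteq> carrier ?D" by (auto dest: M_homD)
    show "\<zero>\<^bsub>?D\<^esub> \<in> ?H"
      using X Y A B cl mod_hom_zero[OF G A B]
      by (auto intro!: M_homI)
  next
    fix x y assume xy: "x \<in> ?H" "y \<in> ?H"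
    obtain u v where uv: "x = (u, v)" by (cases x)
    obtain u' v' where uv': "y = (u', v')" by (cases y)
    have "(u, v) \<in> M_hom R F G" "(u', v') \<in> M_hom R F G" using xy uv uv' by simp_all
    note h = M_homD[OF this(1)] M_homD[OF this(2)]
    have "(\<lambda>x\<in>carrier (src F). u x \<oplus>\<^bsub>src G\<^esub> u' x, \<lambda>y\<in>carrier (tgt F). v y \<oplus>\<^bsub>tgt G\<^esub> v' y) \<in> M_hom R F G"
      using X Y A B h(3,6) cl mod_hom_closed[OF h(1)] mod_hom_closed[OF h(4)]
      by (intro M_homI mod_hom_restrict mod_hom_add_fun h) (simp_all add: mod_hom_add[OF G])
    then show "x \<oplus>\<^bsub>?D\<^esub> y \<in> ?H" by (simp add: uv uv')
  next
    fix a x assume a: "a \<in> carrier R" and x: "x \<in> ?H"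
    obtain u v where uv: "x = (u, v)" by (cases x)
    have "(u, v) \<in> M_hom R F G" using x uv by simp
    note h = M_homD[OF this]
    have "(\<lambda>x\<in>carrier (src F). a \<odot>\<^bsub>src G\<^esub> u x, \<lambda>y\<in>carrier (tgt F). a \<odot>\<^bsub>tgt G\<^esub> v y) \<in> M_hom R F G"
      using X Y A B h(3) cl mod_hom_closed[OF h(1)] a
      by (intro M_homI mod_hom_restrict mod_hom_smult_fun h) (simp_all add: mod_hom_smult[OF G])
    then show "a \<odot>\<^bsub>?D\<^esub> x \<in> ?H" by (simp add: uv)
  qed
  then show ?thesis unfolding M_Hom_mod_def by (rule restrict_module[OF D])
qed

abbreviation dual_map :: "('a, 'x, 'y) mobj \<Rightarrow> ('x \<Rightarrow> 'u) \<times> ('y \<Rightarrow> 'v) \<Rightarrow>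
    ('u \<Rightarrow> 'z) \<times> ('v \<Rightarrow> 'w) \<Rightarrow> ('x \<Rightarrow> 'z) \<times> ('y \<Rightarrow> 'w)" where
  "dual_map F \<delta> \<equiv> map_prod (precomp (src F) (fst \<delta>)) (precomp (tgt F) (snd \<delta>))"

text \<open>For a split \<open>F\<close> this is the dual of \<open>Q\<close>: the first component
  of a morphism to \<open>0 \<rightarrow> R\<close> is zero, and the second is a functional on the
  target that kills the image of \<open>arr F\<close>. Likewise \<open>star1 F\<close> below is the
  dual of \<open>tgt F\<close>, since a morphism to \<open>R = R\<close> is determined by its second
  component.\<close>

abbreviation star0 :: "('a, 'x, 'y) mobj \<Rightarrow> ('a, ('x \<Rightarrow> 'a) \<times> ('y \<Rightarrow> 'a)) module" where
  "star0 F \<equiv> M_Hom_mod R F (zero_obj R (reg_mod R))"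

abbreviation star1 :: "('a, 'x, 'y) mobj \<Rightarrow> ('a, ('x \<Rightarrow> 'a) \<times> ('y \<Rightarrow> 'a)) module" where
  "star1 F \<equiv> M_Hom_mod R F (id_obj (reg_mod R))"

lemma star_map_mod_hom:
  assumes F: "module R (src F)" "module R (tgt F)" "arr F \<in> mod_hom R (src F) (tgt F)"
    and F': "arr F' \<in> mod_hom R (src F') (tgt F')" and \<delta>: "\<delta> \<in> M_hom R F F'"
  shows "dual_map F \<delta>
    \<in> mod_hom R (M_Hom_mod R F' G) (M_Hom_mod R F G)"
proof -
  have "(fst \<delta>, snd \<delta>) \<in> M_hom R F F'" using \<delta> by simp
  note d = M_homD[OF this]
  note cl = mod_hom_closed[OF d(1)] mod_hom_closed[OF d(2)] mod_hom_closed[OF F(3)] mod_hom_closed[OF F']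
  show ?thesis
  proof (rule mod_homI)
    fix x assume x: "x \<in> carrier (M_Hom_mod R F' G)"
    obtain u v where uv: "x = (u, v)" by (cases x)
    have "(u, v) \<in> M_hom R F' G" using x uv by simp
    note h = M_homD[OF this]
    have "(\<lambda>x\<in>carrier (src F). u (fst \<delta> x), \<lambda>y\<in>carrier (tgt F). v (snd \<delta> y)) \<in> M_hom R F G"
      using cl h(3) d(3) by (intro M_homI mod_hom_restrict F mod_hom_comp[OF d(1) h(1)] mod_hom_comp[OF d(2) h(2)]) simp_all
    then show "dual_map F \<delta> x \<in> carrier (M_Hom_mod R F G)"
      by (simp add: uv precomp_def compose_def)
  next
    fix x y
    show "dual_map F \<delta> (x \<oplus>\<^bsub>M_Hom_mod R F' G\<^esub> y)
      = dual_map F \<delta> x \<oplus>\<^bsub>M_Hom_mod R F G\<^esub>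
        dual_map F \<delta> y"
      using cl by (cases x; cases y) (auto intro!: restrict_ext simp: precomp_def compose_def)
  next
    fix a x
    show "dual_map F \<delta> (a \<odot>\<^bsub>M_Hom_mod R F' G\<^esub> x)
      = a \<odot>\<^bsub>M_Hom_mod R F G\<^esub> dual_map F \<delta> x"
      using cl by (cases x) (auto intro!: restrict_ext simp: precomp_def compose_def)
  qed
qed

lemma Tr_M_simps:
  "src (Tr_M R F1 \<delta> F0) = Cok (star0 F0) (star0 F1)
    (dual_map F1 \<delta>)"
  "tgt (Tr_M R F1 \<delta> F0) = Cok (star1 F0) (star1 F1)
    (dual_map F1 \<delta>)"
  "arr (Tr_M R F1 \<delta> F0) = cok_map (star1 F0) (star1 F1)
    (dual_map F1 \<delta>)
    (\<lambda>(a, b). (restrict a (carrier (src F1)), restrict b (carrier (tgt F1))))"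
  by (simp_all add: Tr_M_def M_cok_def star_def star_map_def Let_def compose_def restrict_def case_prod_beta)

lemma obj_simps [simp]:
  "src (zero_obj R P) = zero_mod R" "tgt (zero_obj R P) = P" "arr (zero_obj R P) = (\<lambda>_. \<zero>\<^bsub>P\<^esub>)"
  "src (id_obj P) = P" "tgt (id_obj P) = P" "arr (id_obj P) = (\<lambda>x. x)"
  by (simp_all add: zero_obj_def id_obj_def)

text \<open>The first component is forced: for the pair to be a morphism to \<open>R = R\<close> it
  has to be \<phi> after \<open>arr F1\<close>.\<close>

definition Tr_M_class :: "('a, 'x1, 'y1) mobj \<Rightarrow>
    ('x1 \<Rightarrow> 'x0) \<times> ('y1 \<Rightarrow> 'y0) \<Rightarrow> ('a, 'x0, 'y0) mobj \<Rightarrow> ('y1 \<Rightarrow> 'a) \<Rightarrow> (('x1 \<Rightarrow> 'a) \<times> ('y1 \<Rightarrow> 'a)) set"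
  where "Tr_M_class F1 \<delta> F0 \<phi> =
    cok_proj (star1 F0) (star1 F1)
      (dual_map F1 \<delta>)
      (\<lambda>x\<in>carrier (src F1). \<phi> (arr F1 x), restrict \<phi> (carrier (tgt F1)))"

text \<open>Here \<open>p\<close> is meant to be the projection of a splitting of \<open>F1\<close>,
  so that \<phi> after \<open>p\<close> vanishes on the source, as a morphism to
  \<open>0 \<rightarrow> R\<close> requires.\<close>

definition Tr_M_class0 :: "('a, 'x1, 'y1) mobj \<Rightarrow>
    ('x1 \<Rightarrow> 'x0) \<times> ('y1 \<Rightarrow> 'y0) \<Rightarrow> ('a, 'x0, 'y0) mobj \<Rightarrow> ('y1 \<Rightarrow> 'z) \<Rightarrow> ('z \<Rightarrow> 'a) \<Rightarrow>
    (('x1 \<Rightarrow> 'a) \<times> ('y1 \<Rightarrow> 'a)) set"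
  where "Tr_M_class0 F1 \<delta> F0 p \<phi> =
    cok_proj (star0 F0) (star0 F1)
      (dual_map F1 \<delta>)
      (\<lambda>x\<in>carrier (src F1). \<zero>, \<lambda>y\<in>carrier (tgt F1). \<phi> (p y))"

lemma transp_Tr_M_tgt:
  assumes F1: "module R (src F1)" "module R (tgt F1)" "arr F1 \<in> mod_hom R (src F1) (tgt F1)"
    and F0: "module R (src F0)" "module R (tgt F0)" "arr F0 \<in> mod_hom R (src F0) (tgt F0)"
    and \<delta>: "\<delta> \<in> M_hom R F1 F0"
  shows "transp (tgt F1) (snd \<delta>) (tgt F0) (tgt (Tr_M R F1 \<delta> F0)) (Tr_M_class F1 \<delta> F0)"
proof -
  have "(fst \<delta>, snd \<delta>) \<in> M_hom R F1 F0" using \<delta> by simp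
  note d = M_homD[OF this]
  note cl = mod_hom_closed[OF d(1)] mod_hom_closed[OF d(2)] mod_hom_closed[OF F1(3)] mod_hom_closed[OF F0(3)]
  let ?k = "dual_map F1 \<delta>"
  let ?M = "star1 F0" and ?N = "star1 F1"
  let ?\<iota> = "\<lambda>\<phi>. (\<lambda>x\<in>carrier (src F1). \<phi> (arr F1 x), restrict \<phi> (carrier (tgt F1)))"
  have "transp (tgt F1) (snd \<delta>) (tgt F0) (Cok ?M ?N ?k) (\<lambda>\<phi>. cok_proj ?M ?N ?k (?\<iota> \<phi>))"
  proof (rule transp_Cok)
    show "module R ?M" "module R ?N" using F1 F0 by (simp_all add: module_M_Hom_mod)
    show "?k \<in> mod_hom R ?M ?N" by (rule star_map_mod_hom[OF F1 F0(3) \<delta>])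
    fix \<phi> assume \<phi>: "\<phi> \<in> fnl (tgt F1)"
    have "?\<iota> \<phi> \<in> M_hom R F1 (id_obj (reg_mod R))"
      using F1 cl fnl_comp[OF F1(3) \<phi>] \<phi> by (intro M_homI) simp_all
    then show "?\<iota> \<phi> \<in> carrier ?N" by simp
    show "?\<iota> \<phi> \<in> ?k ` carrier ?M \<longleftrightarrow> (\<exists>\<psi>\<in>fnl (tgt F0). \<forall>x\<in>carrier (tgt F1). \<phi> x = \<psi> (snd \<delta> x))"
    proof
      assume "?\<iota> \<phi> \<in> ?k ` carrier ?M"
      then obtain x where x: "x \<in> carrier ?M" "?\<iota> \<phi> = ?k x" by (rule imageE)
      obtain a b where ab: "x = (a, b)" by (cases x)
      have ba: "b \<in> fnl (tgt F0)" using x(1) ab M_homD(2)[of a b F0 "id_obj (reg_mod R)"] by simp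
      have eq: "restrict \<phi> (carrier (tgt F1)) = precomp (tgt F1) (snd \<delta>) b" using x(2) ab by simp
      have "\<phi> x = b (snd \<delta> x)" if "x \<in> carrier (tgt F1)" for x
        using fun_cong[OF eq, of x] that by (simp add: precomp_def compose_def)
      then show "\<exists>\<psi>\<in>fnl (tgt F0). \<forall>x\<in>carrier (tgt F1). \<phi> x = \<psi> (snd \<delta> x)" using ba by (intro bexI ballI)
    next
      assume "\<exists>\<psi>\<in>fnl (tgt F0). \<forall>x\<in>carrier (tgt F1). \<phi> x = \<psi> (snd \<delta> x)"
      then obtain \<psi> where \<psi>: "\<psi> \<in> fnl (tgt F0)" "\<And>x. x \<in> carrier (tgt F1) \<Longrightarrow> \<phi> x = \<psi> (snd \<delta> x)" by auto
      let ?x = "(\<lambda>x\<in>carrier (src F0). \<psi> (arr F0 x), restrict \<psi> (carrier (tgt F0)))"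
      have "?x \<in> M_hom R F0 (id_obj (reg_mod R))"
        using F0 cl fnl_comp[OF F0(3) \<psi>(1)] \<psi>(1) by (intro M_homI) simp_all
      then have "?x \<in> carrier ?M" by simp
      moreover have "?\<iota> \<phi> = ?k ?x"
        using cl d(3) \<psi>(2) by (auto intro!: restrict_ext simp: precomp_def compose_def)
      ultimately show "?\<iota> \<phi> \<in> ?k ` carrier ?M" by (rule rev_image_eqI)
    qed
  next
    fix y assume y: "y \<in> carrier ?N"
    obtain a b where ab: "y = (a, b)" by (cases y)
    have "(a, b) \<in> M_hom R F1 (id_obj (reg_mod R))" using y ab by simp
    note h = M_homD[OF this]
    have "a = (\<lambda>x\<in>carrier (src F1). b (arr F1 x))" "b = restrict b (carrier (tgt F1))"
      using y ab h(3) by (auto intro!: extensionalityI[of _ "carrier (src F1)"] simp: extensional_restrict)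
    then have "y = ?\<iota> b" using ab by simp
    moreover have "b \<in> fnl (tgt F1)" using h(2) by simp
    ultimately show "\<exists>\<phi>\<in>fnl (tgt F1). y = ?\<iota> \<phi>" by (rule bexI)
  qed (use cl in \<open>auto intro!: restrict_ext\<close>)
  then show ?thesis by (simp only: Tr_M_simps Tr_M_class_def[abs_def])
qed

lemma fnl_splits:
  assumes F: "splits F Q r p j" and b: "b \<in> fnl (tgt F)"
    and bF: "\<And>x. x \<in> carrier (src F) \<Longrightarrow> b (arr F x) = \<zero>" and y: "y \<in> carrier (tgt F)"
  shows "b (j (p y)) = b y"
  by (rule splits_vanishing[OF F module_reg_mod b _ y]) (simp add: bF)

lemma module_star0:
  assumes F: "splits F Q r p j"
  shows "module R (star0 F)"
  using splitsD[OF F] fnl_zero[of "zero_mod R"] by (simp add: module_M_Hom_mod)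

lemma star0_memI:
  assumes F: "splits F Q r p j" and \<phi>: "\<phi> \<in> fnl Q"
  shows "(\<lambda>x\<in>carrier (src F). \<zero>, \<lambda>y\<in>carrier (tgt F). \<phi> (p y)) \<in> carrier (star0 F)"
proof -
  note s = splitsD[OF F]
  let ?Z = "zero_obj R (reg_mod R) :: ('a, 'a, 'a) mobj"
  have "(\<lambda>x\<in>carrier (src F). \<zero>, \<lambda>y\<in>carrier (tgt F). \<phi> (p y)) \<in> M_hom R F ?Z"
  proof (rule M_homI)
    show "(\<lambda>x\<in>carrier (src F). \<zero>) \<in> mod_hom R (src F) (src ?Z)"
      using mod_hom_restrict[OF s(4) mod_hom_zero_fun[OF module_zero_mod]] by simp
    show "(\<lambda>y\<in>carrier (tgt F). \<phi> (p y)) \<in> mod_hom R (tgt F) (tgt ?Z)"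
      using mod_hom_restrict[OF s(5) fnl_comp[OF s(9) \<phi>]] by simp
  qed (use mod_hom_closed[OF s(7)] s(12) fnl_at_zero[OF \<phi> s(6)] in simp)
  then show ?thesis by simp
qed

text \<open>Morphisms to \<open>0 \<rightarrow> R\<close> are functionals on the quotients
  \<open>Q1\<close> and \<open>Q0\<close>, so the differential that matters is the one induced by
  \<delta> between these. It is written with the section \<open>j1\<close>, and \<open>pd\<close>
  says that it is indeed induced.\<close>

lemma transp_Tr_M_src:
  assumes F1: "splits F1 Q1 r1 p1 j1" and F0: "splits F0 Q0 r0 p0 j0"
    and \<delta>: "\<delta> \<in> M_hom R F1 F0"
    and pd: "\<And>y. y \<in> carrier (tgt F1) \<Longrightarrow> p0 (snd \<delta> (j1 (p1 y))) = p0 (snd \<delta> y)"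
  shows "transp Q1 (\<lambda>z. p0 (snd \<delta> (j1 z))) Q0 (src (Tr_M R F1 \<delta> F0)) (Tr_M_class0 F1 \<delta> F0 p1)"
proof -
  note s1 = splitsD[OF F1] and s0 = splitsD[OF F0]
  have "(fst \<delta>, snd \<delta>) \<in> M_hom R F1 F0" using \<delta> by simp
  note d = M_homD[OF this]
  note cl = mod_hom_closed[OF d(1)] mod_hom_closed[OF d(2)] mod_hom_closed[OF s1(7)] mod_hom_closed[OF s0(7)]
    mod_hom_closed[OF s1(9)] mod_hom_closed[OF s0(9)] mod_hom_closed[OF s1(10)] mod_hom_closed[OF s0(10)]
  let ?k = "dual_map F1 \<delta>"
  let ?Z = "zero_obj R (reg_mod R) :: ('a, 'a, 'a) mobj"
  let ?M = "M_Hom_mod R F0 ?Z" and ?N = "M_Hom_mod R F1 ?Z"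
  let ?\<iota> = "\<lambda>\<phi>. (\<lambda>x\<in>carrier (src F1). \<zero>, \<lambda>y\<in>carrier (tgt F1). \<phi> (p1 y))"
  have "transp Q1 (\<lambda>z. p0 (snd \<delta> (j1 z))) Q0 (Cok ?M ?N ?k) (\<lambda>\<phi>. cok_proj ?M ?N ?k (?\<iota> \<phi>))"
  proof (rule transp_Cok)
    show "module R ?M" "module R ?N" by (rule module_star0[OF F0], rule module_star0[OF F1])
    show "?k \<in> mod_hom R ?M ?N" by (rule star_map_mod_hom[OF s1(4,5,7) s0(7) \<delta>])
    fix \<phi> assume \<phi>: "\<phi> \<in> fnl Q1"
    show "?\<iota> \<phi> \<in> carrier ?N" by (rule star0_memI[OF F1 \<phi>])
    show "?\<iota> \<phi> \<in> ?k ` carrier ?M \<longleftrightarrow> (\<exists>\<psi>\<in>fnl Q0. \<forall>z\<in>carrier Q1. \<phi> z = \<psi> (p0 (snd \<delta> (j1 z))))"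
    proof
      assume "?\<iota> \<phi> \<in> ?k ` carrier ?M"
      then obtain x where x: "x \<in> carrier ?M" "?\<iota> \<phi> = ?k x" by (rule imageE)
      obtain a b where ab: "x = (a, b)" by (cases x)
      have "(a, b) \<in> M_hom R F0 ?Z" using x(1) ab by simp
      note h = M_homD[OF this]
      have b: "b \<in> fnl (tgt F0)" using h(2) by simp
      have eq: "(\<lambda>y\<in>carrier (tgt F1). \<phi> (p1 y)) = precomp (tgt F1) (snd \<delta>) b" using x(2) ab by simp
      have "\<phi> z = b (j0 (p0 (snd \<delta> (j1 z))))" if z: "z \<in> carrier Q1" for z
      proof -
        have jz: "j1 z \<in> carrier (tgt F1)" using cl z by simp
        have "\<phi> (p1 (j1 z)) = b (snd \<delta> (j1 z))"
          using fun_cong[OF eq, of "j1 z"] jz by (simp add: precomp_def compose_def)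
        \<comment> \<open>\<open>b\<close> kills the image of \<open>arr F0\<close>, so it may be
          evaluated after projecting to \<open>Q0\<close> and coming back.\<close>
        also have "\<dots> = b (j0 (p0 (snd \<delta> (j1 z))))"
          using h(3) cl jz by (intro fnl_splits[OF F0 b, symmetric]) simp_all
        finally show ?thesis by (simp add: s1(14)[OF z])
      qed
      then show "\<exists>\<psi>\<in>fnl Q0. \<forall>z\<in>carrier Q1. \<phi> z = \<psi> (p0 (snd \<delta> (j1 z)))"
        using fnl_comp[OF s0(10) b] by (intro bexI[of _ "\<lambda>z. b (j0 z)"]) simp_all
    next
      assume "\<exists>\<psi>\<in>fnl Q0. \<forall>z\<in>carrier Q1. \<phi> z = \<psi> (p0 (snd \<delta> (j1 z)))"
      then obtain \<psi> where \<psi>: "\<psi> \<in> fnl Q0" "\<And>z. z \<in> carrier Q1 \<Longrightarrow> \<phi> z = \<psi> (p0 (snd \<delta> (j1 z)))" by auto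
      let ?x = "(\<lambda>x\<in>carrier (src F0). \<zero>, \<lambda>y\<in>carrier (tgt F0). \<psi> (p0 y))"
      have "?x \<in> carrier ?M" by (rule star0_memI[OF F0 \<psi>(1)])
      moreover have "?\<iota> \<phi> = ?k ?x"
        using cl \<psi>(2) pd by (auto intro!: restrict_ext simp: precomp_def compose_def)
      ultimately show "?\<iota> \<phi> \<in> ?k ` carrier ?M" by (rule rev_image_eqI)
    qed
  next
    fix y assume y: "y \<in> carrier ?N"
    obtain a b where ab: "y = (a, b)" by (cases y)
    have "(a, b) \<in> M_hom R F1 ?Z" using y ab by simp
    note h = M_homD[OF this]
    have b: "b \<in> fnl (tgt F1)" using h(2) by simp
    have "a = (\<lambda>x\<in>carrier (src F1). \<zero>)"
      using y ab mod_hom_closed[OF h(1)] by (auto intro!: extensionalityI[of _ "carrier (src F1)"])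
    moreover have "b = (\<lambda>y\<in>carrier (tgt F1). b (j1 (p1 y)))"
      using y ab h(3) fnl_splits[OF F1 b] by (auto intro!: extensionalityI[of _ "carrier (tgt F1)"])
    ultimately have "y = ?\<iota> (\<lambda>z. b (j1 z))" unfolding ab by (simp only: )
    then show "\<exists>\<phi>\<in>fnl Q1. y = ?\<iota> \<phi>"
      by (rule bexI[where x = "\<lambda>z. b (j1 z)"]) (rule fnl_comp[OF s1(10) b])
  next
    fix \<phi> \<psi> \<chi> assume "\<And>x. x \<in> carrier Q1 \<Longrightarrow> \<chi> x = \<phi> x \<oplus> \<psi> x"
    then show "?\<iota> \<chi> = ?\<iota> \<phi> \<oplus>\<^bsub>?N\<^esub> ?\<iota> \<psi>" using cl by (auto intro!: restrict_ext)
  next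
    fix a \<phi> \<chi> assume "a \<in> carrier R" "\<And>x. x \<in> carrier Q1 \<Longrightarrow> \<chi> x = a \<otimes> \<phi> x"
    then show "?\<iota> \<chi> = a \<odot>\<^bsub>?N\<^esub> ?\<iota> \<phi>" using cl by (auto intro!: restrict_ext)
  qed
  then show ?thesis by (simp only: Tr_M_simps Tr_M_class0_def[abs_def])
qed

text \<open>The zero module is realised inside \<open>R\<close>, so a morphism to
  \<open>0 \<rightarrow> R\<close> is literally a morphism to \<open>R = R\<close>, and the map is
  the inclusion on pairs. The representative already has the shape used for the target, since
  \<open>p1\<close> kills the image of \<open>arr F1\<close>.\<close>

lemma arr_Tr_M:
  assumes F1: "splits F1 Q1 r1 p1 j1" and F0: "splits F0 Q0 r0 p0 j0"
    and \<delta>: "\<delta> \<in> M_hom R F1 F0" and \<phi>: "\<phi> \<in> fnl Q1"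
  shows "arr (Tr_M R F1 \<delta> F0) (Tr_M_class0 F1 \<delta> F0 p1 \<phi>) = Tr_M_class F1 \<delta> F0 (\<lambda>y. \<phi> (p1 y))"
proof -
  note s1 = splitsD[OF F1] and s0 = splitsD[OF F0]
  let ?k = "dual_map F1 \<delta>"
  let ?Z = "zero_obj R (reg_mod R) :: ('a, 'a, 'a) mobj" and ?I = "id_obj (reg_mod R)"
  let ?M = "M_Hom_mod R F0 ?Z" and ?N = "M_Hom_mod R F1 ?Z"
  let ?M' = "M_Hom_mod R F0 ?I" and ?N' = "M_Hom_mod R F1 ?I"
  let ?\<iota> = "(\<lambda>x\<in>carrier (src F1). \<zero>, \<lambda>y\<in>carrier (tgt F1). \<phi> (p1 y))"
  let ?v = "\<lambda>(a, b). (restrict a (carrier (src F1)), restrict b (carrier (tgt F1)))"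
  have inc: "(a, b) \<in> M_hom R F ?I" if "(a, b) \<in> M_hom R F ?Z" for a b and F :: "('a, 'n, 'o) mobj"
  proof -
    note h = M_homD[OF that]
    have a: "a x = \<zero>" if "x \<in> carrier (src F)" for x using mod_hom_closed[OF h(1) that] by simp
    have "a \<in> fnl (src F)"
      by (rule mod_homI) (use a mod_hom_rules[OF h(1)] in simp_all)
    then show ?thesis using h(2,3) a by (intro M_homI) simp_all
  qed
  have v: "?v x = x" if "x \<in> carrier ?N" for x
    using that by (auto simp: extensional_restrict)
  have sub: "carrier ?N \<subseteq> carrier ?N'" "carrier ?M \<subseteq> carrier ?M'"
    using inc by auto
  have M: "module R ?M" and N: "module R ?N" by (rule module_star0[OF F0], rule module_star0[OF F1])
  have vh: "?v \<in> mod_hom R ?N ?N'"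
  proof (rule mod_homI)
    fix x assume x: "x \<in> carrier ?N"
    show "?v x \<in> carrier ?N'" unfolding v[OF x] by (rule subsetD[OF sub(1) x])
  next
    fix x y assume x: "x \<in> carrier ?N" and y: "y \<in> carrier ?N"
    have "x \<oplus>\<^bsub>?N\<^esub> y = x \<oplus>\<^bsub>?N'\<^esub> y" by (cases x; cases y) simp
    then show "?v (x \<oplus>\<^bsub>?N\<^esub> y) = ?v x \<oplus>\<^bsub>?N'\<^esub> ?v y"
      using v[OF x] v[OF y] v[OF mod_add_closed[OF N x y]] by (simp only: )
  next
    fix a x assume a: "a \<in> carrier R" and x: "x \<in> carrier ?N"
    have "a \<odot>\<^bsub>?N\<^esub> x = a \<odot>\<^bsub>?N'\<^esub> x" by (cases x) simp
    then show "?v (a \<odot>\<^bsub>?N\<^esub> x) = a \<odot>\<^bsub>?N'\<^esub> ?v x"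
      using v[OF x] v[OF mod_smult_closed[OF N a x]] by (simp only: )
  qed
  have k: "?k \<in> mod_hom R ?M ?N" by (rule star_map_mod_hom[OF s1(4,5,7) s0(7) \<delta>])
  have \<iota>: "?\<iota> \<in> carrier ?N" by (rule star0_memI[OF F1 \<phi>])
  have "arr (Tr_M R F1 \<delta> F0) (Tr_M_class0 F1 \<delta> F0 p1 \<phi>) = cok_map ?M' ?N' ?k ?v (cok_proj ?M ?N ?k ?\<iota>)"
    by (simp only: Tr_M_simps Tr_M_class0_def)
  also have "\<dots> = cok_proj ?M' ?N' ?k (?v ?\<iota>)"
  proof (rule cok_map_proj[OF M N k _ _ _ vh _ \<iota>])
    show "module R ?M'" "module R ?N'" using s1 s0 by (simp_all add: module_M_Hom_mod)
    show "?k \<in> mod_hom R ?M' ?N'" by (rule star_map_mod_hom[OF s1(4,5,7) s0(7) \<delta>])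
    fix x assume x: "x \<in> carrier ?M"
    have "?v (?k x) = ?k x" by (rule v[OF mod_hom_closed[OF k x]])
    then show "?v (?k x) \<in> ?k ` carrier ?M'" by (rule image_eqI[where f = ?k, OF _ subsetD[OF sub(2) x]])
  qed
  also have "?v ?\<iota> = ?\<iota>" by (rule v[OF \<iota>])
  also have "?\<iota> = (\<lambda>x\<in>carrier (src F1). \<phi> (p1 (arr F1 x)), \<lambda>y\<in>carrier (tgt F1). \<phi> (p1 y))"
    using s1(12) fnl_at_zero[OF \<phi> s1(6)] by (auto intro!: restrict_ext)
  finally show ?thesis by (simp only: Tr_M_class_def)
qed

end

section \<open>The projective summand, exactness, and extension of functionals\<close>

context cring begin

lemma fg_projective_free_mod: "fg_projective R (free_mod R n)"
  unfolding fg_projective_def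
  by (intro conjI exI[of _ n] bexI[of _ "\<lambda>x. x"] ballI) simp_all

text \<open>The image of the idempotent \<open>w u\<close> is a retract of \<open>T\<close> that
  factors through \<open>P\<close>. It is rebuilt inside a free module so that its elements have the
  type \<open>nat \<Rightarrow> 'a\<close> that the theorem asks of its projective module.\<close>

lemma idempotent_splits:
  fixes T :: "('a, 't) module" and P :: "('a, 'p) module"
  assumes T: "module R T" and P: "fg_projective R P" and u: "u \<in> mod_hom R T P" and w: "w \<in> mod_hom R P T"
    and idem: "\<And>t. t \<in> carrier T \<Longrightarrow> w (u (w (u t))) = w (u t)"
  obtains N :: "('a, nat \<Rightarrow> 'a) module" and \<iota> \<kappa> where "fg_projective R N" "\<iota> \<in> mod_hom R T N"
    "\<kappa> \<in> mod_hom R N T" "\<And>n. n \<in> carrier N \<Longrightarrow> \<iota> (\<kappa> n) = n" "\<And>t. t \<in> carrier T \<Longrightarrow> \<kappa> (\<iota> t) = w (u t)"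
proof -
  obtain m i p where i: "i \<in> mod_hom R P (free_mod R m)" and p: "p \<in> mod_hom R (free_mod R m) P"
    and pi: "\<And>x. x \<in> carrier P \<Longrightarrow> p (i x) = x"
    using P by (auto simp: fg_projective_def)
  \<comment> \<open>\<open>i (u t)\<close> alone would not do. Only \<open>w u\<close> is known to
    be idempotent, and the additional \<open>w u\<close> makes
    \<open>\<iota> \<kappa> \<iota> = \<iota>\<close> hold.\<close>
  define \<iota> where "\<iota> t = i (u (w (u t)))" for t
  define \<kappa> where "\<kappa> v = w (p v)" for v
  have \<iota>: "\<iota> \<in> mod_hom R T (free_mod R m)"
    unfolding \<iota>_def by (rule mod_hom_comp[OF mod_hom_comp[OF mod_hom_comp[OF u w] u] i])
  have \<kappa>: "\<kappa> \<in> mod_hom R (free_mod R m) T" unfolding \<kappa>_def by (rule mod_hom_comp[OF p w])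
  have \<kappa>\<iota>: "\<kappa> (\<iota> t) = w (u t)" if t: "t \<in> carrier T" for t
    using mod_hom_closed[OF u mod_hom_closed[OF w mod_hom_closed[OF u t]]]
    by (simp add: \<iota>_def \<kappa>_def pi idem[OF t])
  have \<iota>\<kappa>\<iota>: "\<iota> (\<kappa> (\<iota> t)) = \<iota> t" if t: "t \<in> carrier T" for t
    unfolding \<kappa>\<iota>[OF t] by (simp add: \<iota>_def idem[OF t])
  let ?N = "(free_mod R m)\<lparr>carrier := \<iota> ` carrier T\<rparr>"
  have sub: "submodule (\<iota> ` carrier T) R (free_mod R m)"
    by (rule submodule_image[OF T module_free_mod \<iota>])
  have NF: "\<iota> ` carrier T \<subseteq> carrier (free_mod R m)" by (rule submodule_subset[OF module_free_mod sub])
  have N: "module R ?N" by (rule restrict_module[OF module_free_mod sub])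
  have \<iota>N: "\<iota> \<in> mod_hom R T ?N" by (rule mod_hom_into_submodule[OF \<iota>]) simp
  have \<kappa>N: "\<kappa> \<in> mod_hom R ?N T" by (rule mod_hom_on_submodule[OF \<kappa> NF])
  have \<iota>\<kappa>: "\<iota> (\<kappa> n) = n" if n: "n \<in> carrier ?N" for n
  proof -
    from n obtain t where "t \<in> carrier T" "n = \<iota> t" by auto
    then show ?thesis using \<iota>\<kappa>\<iota> by simp
  qed
  have "fg_projective R ?N"
    by (rule fg_projective_retract[where i = "\<lambda>x. x" and p = "\<lambda>x. \<iota> (\<kappa> x)", OF fg_projective_free_mod N mod_hom_on_submodule[OF mod_hom_id NF]
          mod_hom_comp[OF \<kappa> \<iota>N] \<iota>\<kappa>])
  then show thesis using \<iota>N \<kappa>N \<iota>\<kappa> \<kappa>\<iota> by (rule that)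
qed

text \<open>\<open>S\<close> after \<open>D\<close> is precomposition with \<open>b1 s1\<close>,
  which is the identity. This serves for retractions and, with the roles exchanged, for the second
  half of an isomorphism.\<close>

lemma transp_map_inverse:
  assumes T: "transp P1 d P0 T q" and s1: "s1 \<in> mod_hom R P1 Q1" and b1: "b1 \<in> mod_hom R Q1 P1"
    and bs: "\<And>x. x \<in> carrier P1 \<Longrightarrow> b1 (s1 x) = x"
    and S: "\<And>\<phi>. \<phi> \<in> fnl Q1 \<Longrightarrow> S (qQ \<phi>) = q (\<lambda>x. \<phi> (s1 x))"
    and D: "\<And>\<phi>. \<phi> \<in> fnl P1 \<Longrightarrow> D (q \<phi>) = qQ (\<lambda>x. \<phi> (b1 x))" and t: "t \<in> carrier T"
  shows "S (D t) = t"
proof -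
  obtain \<phi> where \<phi>: "\<phi> \<in> fnl P1" "t = q \<phi>" using transpD(5)[OF T t] by blast
  have \<phi>b: "(\<lambda>x. \<phi> (b1 x)) \<in> fnl Q1" by (rule fnl_comp[OF b1 \<phi>(1)])
  have "S (D t) = q (\<lambda>x. \<phi> (b1 (s1 x)))" unfolding \<phi>(2) D[OF \<phi>(1)] by (rule S[OF \<phi>b])
  also have "\<dots> = q \<phi>" by (rule transp_cong[OF T fnl_comp[OF s1 \<phi>b] \<phi>(1)]) (simp add: bs)
  finally show ?thesis by (simp add: \<phi>(2))
qed

text \<open>The maps \<open>s\<close> and \<open>b\<close> compose on the larger presentation to a map homotopic to the identity,
  so the complement of \<open>T\<^sub>B\<close> in \<open>T\<close> is a retract of the projective module \<open>dual R Y1\<close>.\<close>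

lemma transp_complement:
  assumes Y: "presentation R Y1 dY Y0 eY B"
    and s1: "s1 \<in> mod_hom R P1 Y1" and s0: "s0 \<in> mod_hom R P0 Y0"
    and b1: "b1 \<in> mod_hom R Y1 P1" and b0: "b0 \<in> mod_hom R Y0 P0"
    and es: "\<And>x. x \<in> carrier P0 \<Longrightarrow> eY (s0 x) = e x" and eb: "\<And>x. x \<in> carrier Y0 \<Longrightarrow> e (b0 x) = eY x"
    and ds: "\<And>x. x \<in> carrier P1 \<Longrightarrow> dY (s1 x) = s0 (d x)" and db: "\<And>x. x \<in> carrier Y1 \<Longrightarrow> d (b1 x) = b0 (dY x)"
    and bs: "\<And>x. x \<in> carrier P1 \<Longrightarrow> b1 (s1 x) = x"
    and TY: "transp Y1 dY Y0 T q" and TB: "transp P1 d P0 TB qB"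
    and S: "S \<in> mod_hom R T TB" and Sq: "\<And>\<phi>. \<phi> \<in> fnl Y1 \<Longrightarrow> S (q \<phi>) = qB (\<lambda>x. \<phi> (s1 x))"
    and D: "D \<in> mod_hom R TB T" and Dq: "\<And>\<phi>. \<phi> \<in> fnl P1 \<Longrightarrow> D (qB \<phi>) = q (\<lambda>x. \<phi> (b1 x))"
  obtains N :: "('a, nat \<Rightarrow> 'a) module" and \<iota> \<kappa> where "fg_projective R N" "\<iota> \<in> mod_hom R T N"
    "\<kappa> \<in> mod_hom R N T" "\<And>n. n \<in> carrier N \<Longrightarrow> \<iota> (\<kappa> n) = n"
    "\<And>t. t \<in> carrier T \<Longrightarrow> \<kappa> (\<iota> t) \<oplus>\<^bsub>T\<^esub> D (S t) = t" "\<And>t. t \<in> carrier TB \<Longrightarrow> S (D t) = t"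
proof -
  have B: "module R B" and fg1: "fg_projective R Y1" and fg0: "fg_projective R Y0"
    and dY: "dY \<in> mod_hom R Y1 Y0" and eY: "eY \<in> mod_hom R Y0 B" and ker: "dY ` carrier Y1 = a_kernel Y0 B eY"
    using Y by (simp_all add: presentation_def)
  have Y1: "module R Y1" and Y0: "module R Y0" using fg1 fg0 by (simp_all add: fg_projective_module)
  note T = transpD(1)[OF TY] and mTB = transpD(1)[OF TB]
  let ?K = "Y0\<lparr>carrier := a_kernel Y0 B eY\<rparr>"
  have K: "module R ?K" by (rule restrict_module[OF Y0 submodule_kernel[OF Y0 B eY]])
  have dK: "dY \<in> mod_hom R Y1 ?K" by (rule mod_hom_into_submodule[OF dY]) (simp add: ker)
  note cl = mod_hom_closed[OF s1] mod_hom_closed[OF s0] mod_hom_closed[OF b1] mod_hom_closed[OF b0]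
    mod_hom_closed[OF dY] mod_hom_closed[OF eY]
  \<comment> \<open>\<open>s0 b0\<close> lies over the identity of \<open>B\<close>, so its
    difference from the identity has values in the kernel of \<open>eY\<close>, which is the image
    of \<open>dY\<close>. Projectivity of \<open>Y0\<close> then provides the homotopy
    \<open>h\<close>.\<close>
  have sb0: "(\<lambda>y. y \<ominus>\<^bsub>Y0\<^esub> s0 (b0 y)) \<in> mod_hom R Y0 ?K"
  proof (rule mod_hom_into_submodule[OF mod_hom_diff_fun[OF mod_hom_id mod_hom_comp[OF b0 s0] Y0 Y0]])
    show "(\<lambda>y. y \<ominus>\<^bsub>Y0\<^esub> s0 (b0 y)) ` carrier Y0 \<subseteq> a_kernel Y0 B eY"
      using cl Y0 B es eb by (auto simp: mod_hom_diff[OF eY Y0 B])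
  qed
  obtain h where h: "h \<in> mod_hom R Y0 Y1" and dh: "\<And>y. y \<in> carrier Y0 \<Longrightarrow> dY (h y) = y \<ominus>\<^bsub>Y0\<^esub> s0 (b0 y)"
    using fg_projective_lift[OF fg0 Y1 K dK _ sb0] ker by auto
  \<comment> \<open>What remains of the identity after removing \<open>s1 b1\<close> and the
    homotopy term. It has values in the kernel of \<open>dY\<close>; as the presentation stops at
    \<open>Y1\<close>, nothing forces it to vanish, and it is what gives rise to
    \<open>Q\<close>.\<close>
  define w where "w y = (y \<ominus>\<^bsub>Y1\<^esub> s1 (b1 y)) \<ominus>\<^bsub>Y1\<^esub> h (dY y)" for y
  have sb1: "(\<lambda>y. s1 (b1 y)) \<in> mod_hom R Y1 Y1" and hd: "(\<lambda>y. h (dY y)) \<in> mod_hom R Y1 Y1"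
    by (rule mod_hom_comp[OF b1 s1], rule mod_hom_comp[OF dY h])
  have w: "w \<in> mod_hom R Y1 Y1"
    unfolding w_def by (rule mod_hom_diff_fun[OF mod_hom_diff_fun[OF mod_hom_id sb1 Y1 Y1] hd Y1 Y1])
  have dw: "dY (w y) = \<zero>\<^bsub>Y0\<^esub>" if y: "y \<in> carrier Y1" for y
    using cl mod_hom_closed[OF h] y Y0 Y1
    by (simp add: w_def mod_hom_diff[OF dY Y1 Y0] dh ds db)
  let ?D = "dual R Y1"
  have fgD: "fg_projective R ?D" by (rule fg_projective_dual[OF fg1])
  have mD: "module R ?D" by (rule fg_projective_module[OF fgD])
  \<comment> \<open>Since \<open>dY w\<close> is zero, functionals pulled back along
    \<open>dY\<close> become zero after \<open>w\<close>, and not only their classes do. So the map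
    takes values in the projective module \<open>?D\<close>.\<close>
  have "\<exists>u\<in>mod_hom R T ?D. \<forall>\<phi>\<in>fnl Y1. u (q \<phi>) = (\<lambda>y\<in>carrier Y1. \<phi> (w y))"
  proof (rule transp_lift[OF TY Y1 mD])
    fix \<phi> assume "\<phi> \<in> fnl Y1"
    from mod_hom_restrict[OF Y1 fnl_comp[OF w this]]
    show "(\<lambda>y\<in>carrier Y1. \<phi> (w y)) \<in> carrier ?D" by simp
  next
    fix \<phi> \<psi> assume h: "\<phi> \<in> fnl Y1" "\<psi> \<in> fnl Y0" "\<And>x. x \<in> carrier Y1 \<Longrightarrow> \<phi> x = \<psi> (dY x)"
    show "(\<lambda>y\<in>carrier Y1. \<phi> (w y)) = \<zero>\<^bsub>?D\<^esub>"
      using h(3) mod_hom_closed[OF w] fnl_at_zero[OF h(2) Y0] by (auto intro!: restrict_ext simp: dw)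
  qed (use mod_hom_closed[OF w] in \<open>auto intro!: restrict_ext\<close>)
  then obtain u where u: "u \<in> mod_hom R T ?D"
    and uq: "\<And>\<phi>. \<phi> \<in> fnl Y1 \<Longrightarrow> u (q \<phi>) = (\<lambda>y\<in>carrier Y1. \<phi> (w y))" by blast
  note q = transp_mod_hom(1)[OF TY Y1]
  have SD: "S (D t) = t" if "t \<in> carrier TB" for t
    by (rule transp_map_inverse[where S = S and D = D and qQ = q and q = qB, OF TB s1 b1 bs Sq Dq that])
  \<comment> \<open>The functional \<open>\<phi> h dY\<close> is pulled back along
    \<open>dY\<close>, so its class is zero; hence the class of \<phi> after \<open>w\<close> is
    that of \<phi> minus \<phi> after \<open>s1 b1\<close>.\<close>
  have qu: "q (u t) = t \<ominus>\<^bsub>T\<^esub> D (S t)" if t: "t \<in> carrier T" for t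
  proof -
    obtain \<phi> where \<phi>: "\<phi> \<in> fnl Y1" "t = q \<phi>" using transpD(5)[OF TY t] by blast
    have \<phi>s: "(\<lambda>x. \<phi> (s1 x)) \<in> fnl P1" by (rule fnl_comp[OF s1 \<phi>(1)])
    have \<phi>sb: "(\<lambda>x. \<phi> (s1 (b1 x))) \<in> fnl Y1" by (rule fnl_comp[OF b1 \<phi>s])
    have \<phi>h: "(\<lambda>y. \<phi> (h y)) \<in> fnl Y0" by (rule fnl_comp[OF h \<phi>(1)])
    have \<phi>hd: "(\<lambda>y. \<phi> (h (dY y))) \<in> fnl Y1" by (rule fnl_comp[OF dY \<phi>h])
    have \<phi>w: "(\<lambda>y\<in>carrier Y1. \<phi> (w y)) \<in> fnl Y1" by (rule mod_hom_restrict[OF Y1 fnl_comp[OF w \<phi>(1)]])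
    have DS: "D (S t) = q (\<lambda>x. \<phi> (s1 (b1 x)))" unfolding \<phi>(2) Sq[OF \<phi>(1)] by (rule Dq[OF \<phi>s])
    have d1: "(\<lambda>x. \<phi> x \<ominus> \<phi> (s1 (b1 x))) \<in> fnl Y1" by (rule fnl_diff[OF \<phi>(1) \<phi>sb Y1])
    have e1: "q (\<lambda>x. \<phi> x \<ominus> \<phi> (s1 (b1 x))) = t \<ominus>\<^bsub>T\<^esub> D (S t)"
      unfolding DS unfolding \<phi>(2) by (rule transp_diff[OF TY \<phi>(1) \<phi>sb d1]) simp
    have e0: "q (\<lambda>y. \<phi> (h (dY y))) = \<zero>\<^bsub>T\<^esub>"
      unfolding transpD(6)[OF TY \<phi>hd] by (rule bexI[OF _ \<phi>h]) simp
    have "q (\<lambda>y\<in>carrier Y1. \<phi> (w y)) = q (\<lambda>x. \<phi> x \<ominus> \<phi> (s1 (b1 x))) \<ominus>\<^bsub>T\<^esub> q (\<lambda>y. \<phi> (h (dY y)))"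
    proof (rule transp_diff[OF TY d1 \<phi>hd \<phi>w])
      fix x assume x: "x \<in> carrier Y1"
      have *: "s1 (b1 x) \<in> carrier Y1" "h (dY x) \<in> carrier Y1"
        by (rule mod_hom_closed[OF sb1 x], rule mod_hom_closed[OF hd x])
      show "(\<lambda>y\<in>carrier Y1. \<phi> (w y)) x = \<phi> x \<ominus> \<phi> (s1 (b1 x)) \<ominus> \<phi> (h (dY x))"
        using x * Y1 mod_hom_diff[OF \<phi>(1) Y1 module_reg_mod] fnl_closed[OF \<phi>(1)]
        by (simp add: w_def)
    qed
    then have "q (u t) = (t \<ominus>\<^bsub>T\<^esub> D (S t)) \<ominus>\<^bsub>T\<^esub> \<zero>\<^bsub>T\<^esub>"
      unfolding e0 e1 by (simp add: \<phi>(2) uq[OF \<phi>(1)])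
    then show ?thesis using t T mod_hom_closed[OF D mod_hom_closed[OF S t]] by simp
  qed
  have DS: "D (S t) \<in> carrier T" if "t \<in> carrier T" for t by (rule mod_hom_closed[OF D mod_hom_closed[OF S that]])
  \<comment> \<open>\<open>S\<close> kills \<open>q (u t)\<close> because \<open>S D\<close> is the
    identity, so applying \<open>q u\<close> once more subtracts zero.\<close>
  have idem: "q (u (q (u t))) = q (u t)" if t: "t \<in> carrier T" for t
  proof -
    have "S (q (u t)) = S t \<ominus>\<^bsub>TB\<^esub> S (D (S t))"
      unfolding qu[OF t] by (rule mod_hom_diff[OF S T mTB t DS[OF t]])
    then have "S (q (u t)) = \<zero>\<^bsub>TB\<^esub>" using SD mod_hom_closed[OF S t] mTB by simp
    then show ?thesis
      using qu[OF mod_hom_closed[OF q mod_hom_closed[OF u t]]] mod_hom_zero[OF D mTB T] T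
        mod_hom_closed[OF q mod_hom_closed[OF u t]] by simp
  qed
  obtain N :: "('a, nat \<Rightarrow> 'a) module" and \<iota> \<kappa> where N: "fg_projective R N" "\<iota> \<in> mod_hom R T N"
    "\<kappa> \<in> mod_hom R N T" "\<And>n. n \<in> carrier N \<Longrightarrow> \<iota> (\<kappa> n) = n" and \<kappa>\<iota>: "\<And>t. t \<in> carrier T \<Longrightarrow> \<kappa> (\<iota> t) = q (u t)"
  proof (rule idempotent_splits[where u = u and w = q, OF T fgD u q idem])
    fix N :: "('a, nat \<Rightarrow> 'a) module" and \<iota> \<kappa>
    assume h: "fg_projective R N" "\<iota> \<in> mod_hom R T N" "\<kappa> \<in> mod_hom R N T"
      "\<And>n. n \<in> carrier N \<Longrightarrow> \<iota> (\<kappa> n) = n" "\<And>t. t \<in> carrier T \<Longrightarrow> \<kappa> (\<iota> t) = q (u t)"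
    show thesis by (rule that[OF h])
  qed
  have "\<kappa> (\<iota> t) \<oplus>\<^bsub>T\<^esub> D (S t) = t" if "t \<in> carrier T" for t
    using that DS[OF that] T by (simp add: \<kappa>\<iota> qu)
  from that[OF N this SD] show thesis .
qed

text \<open>Surjectivity of \<open>J\<close>: a functional on the source extends to the target along
  \<open>r1\<close>. Kernel of \<open>J\<close>: if \<phi> restricts on \<open>src F1\<close> to
  \<psi> after \<open>fst \<delta>\<close>, subtracting the pullback of \<open>\<psi> r0\<close>
  along \<open>snd \<delta>\<close> does not change the class of \<phi>, and the difference kills
  the source, so it comes from \<open>Q1\<close>. Injectivity of \<open>I\<close> is not claimed; it
  is the matter of the second part of the theorem.\<close>

lemma transp_exact:
  assumes F1: "splits F1 Q1 r1 p1 j1" and F0: "splits F0 Q0 r0 p0 j0"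
    and \<delta>: "\<delta> \<in> M_hom R F1 F0"
    and TY: "transp (tgt F1) (snd \<delta>) (tgt F0) T q"
    and TX: "transp (src F1) (fst \<delta>) (src F0) TX qX"
    and TQ: "transp Q1 dQ Q0 TQ qQ"
    and I: "\<And>\<phi>. \<phi> \<in> fnl Q1 \<Longrightarrow> I (qQ \<phi>) = q (\<lambda>y. \<phi> (p1 y))"
    and J: "J \<in> mod_hom R T TX" and Jq: "\<And>\<phi>. \<phi> \<in> fnl (tgt F1) \<Longrightarrow> J (q \<phi>) = qX (\<lambda>x. \<phi> (arr F1 x))"
  shows "I ` carrier TQ = a_kernel T TX J" "J ` carrier T = carrier TX"
proof -
  note s1 = splitsD[OF F1] and s0 = splitsD[OF F0]
  have "(fst \<delta>, snd \<delta>) \<in> M_hom R F1 F0" using \<delta> by simp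
  note d = M_homD[OF this]
  note T = transpD[OF TY] and X = transpD[OF TX] and Q = transpD[OF TQ]
  show "J ` carrier T = carrier TX"
  proof
    show "carrier TX \<subseteq> J ` carrier T"
    proof
      fix t assume "t \<in> carrier TX"
      then obtain \<phi> where \<phi>: "\<phi> \<in> fnl (src F1)" "t = qX \<phi>" using X(5) by blast
      have \<phi>r: "(\<lambda>y. \<phi> (r1 y)) \<in> fnl (tgt F1)" by (rule fnl_comp[OF s1(8) \<phi>(1)])
      have "t = qX (\<lambda>x. \<phi> (r1 (arr F1 x)))"
        unfolding \<phi>(2) by (rule transp_cong[OF TX \<phi>(1) fnl_comp[OF s1(7) \<phi>r]]) (simp add: s1(11))
      then have "t = J (q (\<lambda>y. \<phi> (r1 y)))" by (simp only: Jq[OF \<phi>r])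
      then show "t \<in> J ` carrier T" using T(2)[OF \<phi>r] by (rule image_eqI[where f = J])
    qed
  qed (use mod_hom_closed[OF J] in blast)
  show "I ` carrier TQ = a_kernel T TX J"
  proof
    show "I ` carrier TQ \<subseteq> a_kernel T TX J"
    proof
      fix t assume "t \<in> I ` carrier TQ"
      then obtain t' where t': "t' \<in> carrier TQ" "t = I t'" by blast
      obtain \<phi> where \<phi>: "\<phi> \<in> fnl Q1" "t' = qQ \<phi>" using Q(5)[OF t'(1)] by blast
      have \<phi>p: "(\<lambda>y. \<phi> (p1 y)) \<in> fnl (tgt F1)" by (rule fnl_comp[OF s1(9) \<phi>(1)])
      have t: "t = q (\<lambda>y. \<phi> (p1 y))" by (simp only: t'(2) \<phi>(2) I[OF \<phi>(1)])
      have "J t = qX (\<lambda>x. \<phi> (p1 (arr F1 x)))" unfolding t by (rule Jq[OF \<phi>p])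
      also have "\<dots> = \<zero>\<^bsub>TX\<^esub>"
        unfolding X(6)[OF fnl_comp[OF s1(7) \<phi>p]]
        by (rule bexI[OF _ fnl_zero]) (simp add: s1(12) fnl_at_zero[OF \<phi>(1) s1(6)])
      finally show "t \<in> a_kernel T TX J" using T(2)[OF \<phi>p] by (simp add: t)
    qed
    show "a_kernel T TX J \<subseteq> I ` carrier TQ"
    proof
      fix t assume "t \<in> a_kernel T TX J"
      then have t: "t \<in> carrier T" "J t = \<zero>\<^bsub>TX\<^esub>" by simp_all
      obtain \<phi> where \<phi>: "\<phi> \<in> fnl (tgt F1)" "t = q \<phi>" using T(5)[OF t(1)] by blast
      have "qX (\<lambda>x. \<phi> (arr F1 x)) = \<zero>\<^bsub>TX\<^esub>" using t(2) unfolding \<phi>(2) Jq[OF \<phi>(1)] .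
      then obtain \<psi> where \<psi>: "\<psi> \<in> fnl (src F0)" and \<phi>\<psi>: "\<And>x. x \<in> carrier (src F1) \<Longrightarrow> \<phi> (arr F1 x) = \<psi> (fst \<delta> x)"
        unfolding X(6)[OF fnl_comp[OF s1(7) \<phi>(1)]] by blast
      have \<psi>r: "(\<lambda>y. \<psi> (r0 y)) \<in> fnl (tgt F0)" by (rule fnl_comp[OF s0(8) \<psi>])
      have \<psi>rd: "(\<lambda>y. \<psi> (r0 (snd \<delta> y))) \<in> fnl (tgt F1)" by (rule fnl_comp[OF d(2) \<psi>r])
      define \<phi>' where "\<phi>' y = \<phi> y \<ominus> \<psi> (r0 (snd \<delta> y))" for y
      have \<phi>': "\<phi>' \<in> fnl (tgt F1)" unfolding \<phi>'_def by (rule fnl_diff[OF \<phi>(1) \<psi>rd s1(5)])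
      have \<phi>'F: "\<phi>' (arr F1 x) = \<zero>" if x: "x \<in> carrier (src F1)" for x
        using fnl_closed[OF \<psi> mod_hom_closed[OF d(1) x]]
        by (simp add: \<phi>'_def \<phi>\<psi>[OF x] d(3)[OF x] s0(11)[OF mod_hom_closed[OF d(1) x]] r_right_minus_eq)
      have 0: "q (\<lambda>y. \<psi> (r0 (snd \<delta> y))) = \<zero>\<^bsub>T\<^esub>"
        unfolding T(6)[OF \<psi>rd] by (rule bexI[OF _ \<psi>r]) simp
      have "q \<phi>' = q \<phi> \<ominus>\<^bsub>T\<^esub> q (\<lambda>y. \<psi> (r0 (snd \<delta> y)))"
        by (rule transp_diff[OF TY \<phi>(1) \<psi>rd \<phi>']) (simp add: \<phi>'_def)
      then have "t = q \<phi>'" using t(1) T(1) by (simp add: 0 \<phi>(2))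
      also have \<phi>'j: "(\<lambda>z. \<phi>' (j1 z)) \<in> fnl Q1" by (rule fnl_comp[OF s1(10) \<phi>'])
      have "q \<phi>' = q (\<lambda>y. \<phi>' (j1 (p1 y)))"
        by (rule transp_cong[OF TY \<phi>' fnl_comp[OF s1(9) \<phi>'j]])
          (simp add: fnl_splits[OF F1 \<phi>' \<phi>'F])
      also have "\<dots> = I (qQ (\<lambda>z. \<phi>' (j1 z)))" by (simp only: I[OF \<phi>'j])
      finally show "t \<in> I ` carrier TQ" using Q(2)[OF \<phi>'j] by (rule image_eqI[where f = I])
    qed
  qed
qed

text \<open>The connecting homomorphism from the dual of \<open>A\<close> to
  \<open>Ext\<^sup>1(C, R)\<close>, computed on cochains. The resolution is mapped to the given
  extension by \<open>\<sigma>0\<close> and \<open>\<sigma>1\<close>; then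
  \<open>\<chi> \<sigma>1\<close> is a cocycle and represents the obstruction to extending \<chi>.
  If it is the coboundary of \<theta>, then \<theta> and \<chi> together define \<omega>.\<close>

lemma Ext_zero_extends:
  fixes A :: "('a, 'e) module" and P :: "nat \<Rightarrow> ('a, 'p) module"
  assumes A: "module R A" and B: "module R B" and C: "module R C"
    and f: "f \<in> mod_hom R A B" and inj: "inj_on f (carrier A)"
    and g: "g \<in> mod_hom R B C" and onto: "g ` carrier B = carrier C" and ker: "a_kernel B C g = f ` carrier A"
    and res: "proj_resolution R P d e C"
    and Ext: "carrier (Ext R 1 P d (reg_mod R)) = {\<zero>\<^bsub>Ext R 1 P d (reg_mod R)\<^esub>}"
    and \<chi>: "\<chi> \<in> fnl A"
  obtains \<omega> where "\<omega> \<in> fnl B" "\<And>a. a \<in> carrier A \<Longrightarrow> \<omega> (f a) = \<chi> a"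
proof -
  have P: "fg_projective R (P n)" and mP: "module R (P n)" and d: "d n \<in> mod_hom R (P (Suc n)) (P n)"
    and dd: "d (Suc n) ` carrier (P (Suc (Suc n))) = a_kernel (P (Suc n)) (P n) (d n)" for n
    using res by (simp_all add: proj_resolution_def fg_projective_module)
  have e: "e \<in> mod_hom R (P 0) C" and eonto: "e ` carrier (P 0) = carrier C"
    and d0: "d 0 ` carrier (P 1) = a_kernel (P 0) C e"
    using res by (simp_all add: proj_resolution_def)
  let ?K = "B\<lparr>carrier := a_kernel B C g\<rparr>"
  have mK: "module R ?K" by (rule restrict_module[OF B submodule_kernel[OF B C g]])
  have fK: "f \<in> mod_hom R A ?K" by (rule mod_hom_into_submodule[OF f]) (simp add: ker)
  have gf: "g (f a) = \<zero>\<^bsub>C\<^esub>" if "a \<in> carrier A" for a using mod_hom_closed[OF fK that] by simp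
  obtain \<sigma>0 where \<sigma>0: "\<sigma>0 \<in> mod_hom R (P 0) B" and g\<sigma>: "\<And>x. x \<in> carrier (P 0) \<Longrightarrow> g (\<sigma>0 x) = e x"
    using fg_projective_lift[OF P B C g _ e] onto by auto
  have d01: "d 0 \<in> mod_hom R (P 1) (P 0)" using d[of 0] by simp
  have ed: "e (d 0 z) = \<zero>\<^bsub>C\<^esub>" if "z \<in> carrier (P 1)" for z
  proof -
    have "d 0 z \<in> a_kernel (P 0) C e" unfolding d0[symmetric] using that by (rule imageI)
    then show ?thesis by simp
  qed
  have \<sigma>d: "(\<lambda>z. \<sigma>0 (d 0 z)) \<in> mod_hom R (P 1) ?K"
  proof (rule mod_hom_into_submodule[OF mod_hom_comp[OF d01 \<sigma>0]])
    show "(\<lambda>z. \<sigma>0 (d 0 z)) ` carrier (P 1) \<subseteq> a_kernel B C g"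
      using mod_hom_closed[OF \<sigma>0] mod_hom_closed[OF d01] by (auto simp: g\<sigma> ed)
  qed
  obtain \<sigma>1 where \<sigma>1: "\<sigma>1 \<in> mod_hom R (P 1) A" and f\<sigma>: "\<And>z. z \<in> carrier (P 1) \<Longrightarrow> f (\<sigma>1 z) = \<sigma>0 (d 0 z)"
    using fg_projective_lift[OF P A mK fK _ \<sigma>d] ker by auto
  note cl = mod_hom_closed[OF \<sigma>0] mod_hom_closed[OF \<sigma>1] mod_hom_closed[OF f] mod_hom_closed[OF g]
    mod_hom_closed[OF d01] mod_hom_closed[OF e]
  have f0: "a = \<zero>\<^bsub>A\<^esub>" if "a \<in> carrier A" "f a = \<zero>\<^bsub>B\<^esub>" for a
    using inj_onD[OF inj, of a "\<zero>\<^bsub>A\<^esub>"] that mod_hom_zero[OF f A B] A by simp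
  define \<eta> where "\<eta> = (\<lambda>z\<in>carrier (P 1). \<chi> (\<sigma>1 z))"
  have \<chi>\<sigma>: "(\<lambda>z. \<chi> (\<sigma>1 z)) \<in> fnl (P 1)" by (rule fnl_comp[OF \<sigma>1 \<chi>])
  have d12: "d 1 \<in> mod_hom R (P 2) (P 1)" using d[of 1] by (simp add: numeral_2_eq_2)
  \<comment> \<open>Cocycle condition: \<open>f \<sigma>1 d1\<close> equals
    \<open>\<sigma>0 d0 d1\<close>, which is zero, and \<open>f\<close> is injective.\<close>
  have \<eta>d: "\<eta> (d 1 y) = \<zero>" if y: "y \<in> carrier (P 2)" for y
  proof -
    have dy: "d 1 y \<in> carrier (P 1)" by (rule mod_hom_closed[OF d12 y])
    have "d 1 y \<in> d (Suc 0) ` carrier (P (Suc (Suc 0)))" using y by (simp add: numeral_2_eq_2)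
    then have "d 0 (d 1 y) = \<zero>\<^bsub>P 0\<^esub>" unfolding dd by simp
    then have "f (\<sigma>1 (d 1 y)) = \<zero>\<^bsub>B\<^esub>" using f\<sigma>[OF dy] mod_hom_zero[OF \<sigma>0 mP B] by simp
    then have "\<sigma>1 (d 1 y) = \<zero>\<^bsub>A\<^esub>" using f0 cl dy by simp
    then show ?thesis using dy fnl_at_zero[OF \<chi> A] by (simp add: \<eta>_def)
  qed
  let ?H = "dual R (P 1)" and ?H' = "dual R (P 2)" and ?d = "precomp (P 2) (d 1)"
  let ?I = "precomp (P 1) (d 0) ` carrier (dual R (P 0))"
  let ?Z = "?H\<lparr>carrier := a_kernel ?H ?H' ?d\<rparr>"
  have \<eta>H: "\<eta> \<in> carrier ?H" using mod_hom_restrict[OF mP \<chi>\<sigma>] by (simp add: \<eta>_def)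
  have mH: "module R ?H" "module R ?H'" using mP by simp_all
  have "?d \<eta> = \<zero>\<^bsub>?H'\<^esub>"
    using \<eta>d by (auto intro!: restrict_ext simp: precomp_def compose_def)
  then have \<eta>Z: "\<eta> \<in> a_kernel ?H ?H' ?d" using \<eta>H by simp
  \<comment> \<open>The zero of \<open>Ext\<close> is the coset \<open>?I\<close> itself. The class
    of \<eta> has to be this coset, and \<eta> lies in its own class, so it is a coboundary.\<close>
  have "?I +>\<^bsub>?Z\<^esub> \<eta> \<in> carrier (Ext R 1 P d (reg_mod R))"
    using \<eta>Z by (auto simp: Ext_def quot_mod_def A_RCOSETS_def' numeral_2_eq_2)
  then have "?I +>\<^bsub>?Z\<^esub> \<eta> = ?I"
    unfolding Ext by (simp add: Ext_def quot_mod_def)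
  moreover have "\<eta> \<in> ?I +>\<^bsub>?Z\<^esub> \<eta>"
  proof -
    have "\<eta> = \<zero>\<^bsub>?H\<^esub> \<oplus>\<^bsub>?H\<^esub> \<eta>" using mod_add_zero(2)[OF mH(1) \<eta>H] by (rule sym)
    also have "\<dots> = \<zero>\<^bsub>?H\<^esub> \<oplus>\<^bsub>?Z\<^esub> \<eta>" by simp
    finally have "\<eta> = \<zero>\<^bsub>?H\<^esub> \<oplus>\<^bsub>?Z\<^esub> \<eta>" .
    moreover have "\<zero>\<^bsub>?H\<^esub> \<in> ?I"
    proof -
      have "submodule ?I R ?H"
        by (rule submodule_image[OF _ mH(1) precomp_mod_hom[OF mP mP d01 module_reg_mod]]) (simp add: mP)
      then show ?thesis by (rule submodule_zero[OF mH(1)])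
    qed
    ultimately show ?thesis unfolding mem_coset_iff by (rule bexI)
  qed
  ultimately have "\<eta> \<in> ?I" by simp
  then obtain \<theta> where \<theta>: "\<theta> \<in> fnl (P 0)" and eq: "\<eta> = precomp (P 1) (d 0) \<theta>" by auto
  have \<theta>d: "\<chi> (\<sigma>1 z) = \<theta> (d 0 z)" if "z \<in> carrier (P 1)" for z
    using fun_cong[OF eq, of z] that by (simp add: \<eta>_def precomp_def compose_def)
  \<comment> \<open>\<open>?h\<close> presents \<open>B\<close> as a quotient of
    \<open>P 0 \<oplus> A\<close> whose kernel consists of the pairs of \<open>d 0 z\<close> and the
    negative of \<open>\<sigma>1 z\<close>. On these \<open>?k\<close> is zero, because
    \<open>\<theta> d0 = \<chi> \<sigma>1\<close>.\<close>
  let ?S = "dsum (P 0) A"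
  let ?h = "\<lambda>x. \<sigma>0 (fst x) \<oplus>\<^bsub>B\<^esub> f (snd x)" and ?k = "\<lambda>x. \<theta> (fst x) \<oplus> \<chi> (snd x)"
  have mS: "module R ?S" using mP A by simp
  have h: "?h \<in> mod_hom R ?S B"
    by (rule mod_hom_add_fun[OF mod_hom_comp[OF mod_hom_fst \<sigma>0] mod_hom_comp[OF mod_hom_snd f] B])
  have k: "?k \<in> fnl ?S"
    by (rule fnl_add[OF fnl_comp[OF mod_hom_fst \<theta>] fnl_comp[OF mod_hom_snd \<chi>]])
  have "?h ` carrier ?S = carrier B"
  proof
    show "carrier B \<subseteq> ?h ` carrier ?S"
    proof
      fix y assume y: "y \<in> carrier B"
      have "g y \<in> e ` carrier (P 0)" unfolding eonto by (rule cl(4)[OF y])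
      then obtain x where x: "x \<in> carrier (P 0)" "g y = e x" by blast
      have "y \<ominus>\<^bsub>B\<^esub> \<sigma>0 x \<in> a_kernel B C g"
        using x y cl B C by (simp add: mod_hom_diff[OF g B C] g\<sigma>)
      then obtain a where a: "a \<in> carrier A" "y \<ominus>\<^bsub>B\<^esub> \<sigma>0 x = f a" unfolding ker by blast
      have "y = \<sigma>0 x \<oplus>\<^bsub>B\<^esub> f a" unfolding a(2)[symmetric] using y cl(1)[OF x(1)] B by simp
      then have "y = ?h (x, a)" by simp
      then show "y \<in> ?h ` carrier ?S" by (rule image_eqI[where f = ?h]) (simp add: x a)
    qed
  qed (use mod_hom_closed[OF h] in blast)
  moreover have "?k x = \<zero>\<^bsub>reg_mod R\<^esub>" if x: "x \<in> carrier ?S" "?h x = \<zero>\<^bsub>B\<^esub>" for x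
  proof -
    obtain u a where ua: "x = (u, a)" "u \<in> carrier (P 0)" "a \<in> carrier A" using x(1) by (cases x) auto
    have s: "\<sigma>0 u \<oplus>\<^bsub>B\<^esub> f a = \<zero>\<^bsub>B\<^esub>" using x(2) ua by simp
    have "g (\<sigma>0 u \<oplus>\<^bsub>B\<^esub> f a) = e u"
      using ua cl C by (simp add: mod_hom_add[OF g] g\<sigma> gf)
    then have "u \<in> a_kernel (P 0) C e" using ua mod_hom_zero[OF g B C] by (simp add: s)
    then obtain z where z: "z \<in> carrier (P 1)" "u = d 0 z" unfolding d0[symmetric] by blast
    have "f (\<sigma>1 z \<oplus>\<^bsub>A\<^esub> a) = \<zero>\<^bsub>B\<^esub>"
      using s z ua cl by (simp add: mod_hom_add[OF f] f\<sigma>)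
    then have "\<sigma>1 z \<oplus>\<^bsub>A\<^esub> a = \<zero>\<^bsub>A\<^esub>" using f0 cl z ua A by simp
    then have "\<chi> (\<sigma>1 z) \<oplus> \<chi> a = \<zero>"
      using mod_hom_add[OF \<chi> cl(2)[OF z(1)] ua(3)] fnl_at_zero[OF \<chi> A] by simp
    then show ?thesis by (simp add: ua(1) z \<theta>d[OF z(1), symmetric])
  qed
  ultimately obtain \<omega> where \<omega>: "\<omega> \<in> fnl B" "\<And>x. x \<in> carrier ?S \<Longrightarrow> \<omega> (?h x) = ?k x"
    using mod_hom_factor[OF mS B module_reg_mod h k] by blast
  have "\<omega> (f a) = \<chi> a" if a: "a \<in> carrier A" for a
    using \<omega>(2)[of "(\<zero>\<^bsub>P 0\<^esub>, a)"] a mP[of 0] B cl mod_hom_zero[OF \<sigma>0 mP B] fnl_at_zero[OF \<theta> mP]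
      fnl_closed[OF \<chi> a] by simp
  with \<omega>(1) show thesis by (rule that)
qed

end

section \<open>The transpose of a monomorphism\<close>

context cring begin

lemma transp_fg_module:
  assumes T: "transp P1 d P0 T q" and P1: "fg_projective R P1"
  shows "fg_module R T"
  by (rule fg_module_image[OF fg_projective_fg[OF fg_projective_dual[OF P1]] transpD(1)[OF T]
        transp_mod_hom[OF T fg_projective_module[OF P1]]])

text \<open>Every element of the transpose is the class of a functional, so it suffices to know
  \<open>t\<close> on classes.\<close>

lemma is_Tr_map_Tr_class:
  assumes P1: "module R P1" and P0: "module R P0" and d: "d \<in> mod_hom R P1 P0"
    and Q1: "module R Q1" and Q0: "module R Q0" and d': "d' \<in> mod_hom R Q1 Q0"
    and c1: "c1 \<in> mod_hom R P1 Q1" and c0: "c0 \<in> mod_hom R P0 Q0"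
    and comm: "\<And>x. x \<in> carrier P1 \<Longrightarrow> d' (c1 x) = c0 (d x)"
    and over: "\<And>x. x \<in> carrier P0 \<Longrightarrow> e' (c0 x) = f (e x)"
    and t: "\<And>\<phi>. \<phi> \<in> fnl Q1 \<Longrightarrow> t (Tr_class Q1 d' Q0 \<phi>) = Tr_class P1 d P0 (\<lambda>x. \<phi> (c1 x))"
  shows "is_Tr_map R P1 d P0 e Q1 d' Q0 e' f t"
  unfolding is_Tr_map_def
proof (intro bexI[OF _ c1] bexI[OF _ c0] conjI ballI)
  fix U assume "U \<in> carrier (Tr R Q1 d' Q0)"
  then obtain \<phi> where \<phi>: "\<phi> \<in> fnl Q1" "U = Tr_class Q1 d' Q0 \<phi>"
    using transpD(5)[OF transp_Tr[OF Q1 Q0 d']] by blast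
  show "t U = cok_map (dual R P0) (dual R P1) (precomp P1 d) (precomp P1 c1) U"
    unfolding \<phi>(2) t[OF \<phi>(1)] by (rule cok_map_Tr_class[OF P1 P0 d Q1 Q0 d' c1 c0 comm \<phi>(1), symmetric])
qed (use comm over in simp_all)

end

theorem proposition3p4:
  fixes R :: "('a, 'm) ring_scheme"
    and A :: "('a, 'b) module" and B :: "('a, 'c) module" and f :: "'b \<Rightarrow> 'c"
    and C :: "('a, 'c set) module" and g :: "'c \<Rightarrow> 'c set"
    and PA1 :: "('a, 'pa1) module" and PA0 :: "('a, 'pa0) module"
    and PB1 :: "('a, 'pb1) module" and PB0 :: "('a, 'pb0) module"
    and PC1 :: "('a, 'pc1) module" and PC0 :: "('a, 'pc0) module"
    and F1 :: "('a, 'x1, 'y1) mobj" and F0 :: "('a, 'x0, 'y0) mobj"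
  assumes R: "cring R" "noetherian_ring R" "local_ring R" "finite_krull_dim R"
    and f: "S_obj R \<lparr>src = A, tgt = B, arr = f\<rparr>"
    and C: "C = Cok A B f" and g: "g = cok_proj A B f"
    and presA: "min_pres R PA1 dA PA0 eA A"
    and presB: "min_pres R PB1 dB PB0 eB B"
    and presC: "min_pres R PC1 dC PC0 eC C"
    and presf: "M_min_pres R F1 \<delta> F0 \<epsilon> \<lparr>src = A, tgt = B, arr = f\<rparr>"
  shows "(\<exists>(Q :: ('a, nat \<Rightarrow> 'a) module) Trf Trg h1 h2.
      fg_projective R Q \<and>
      is_Tr_map R PA1 dA PA0 eA PB1 dB PB0 eB f Trf \<and>
      is_Tr_map R PB1 dB PB0 eB PC1 dC PC0 eC g Trg \<and>
      h1 \<in> mod_hom R (Tr R PC1 dC PC0) Q \<and>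
      h2 \<in> mod_hom R Q (Tr R PA1 dA PA0) \<and>
      M_iso R (Tr_M R F1 \<delta> F0)
        \<lparr>src = Tr R PC1 dC PC0, tgt = dsum (Tr R PB1 dB PB0) Q, arr = (\<lambda>x. (Trg x, h1 x))\<rparr> \<and>
      (\<lambda>x. (Trg x, h1 x)) ` carrier (Tr R PC1 dC PC0) =
        a_kernel (dsum (Tr R PB1 dB PB0) Q) (Tr R PA1 dA PA0)
          (\<lambda>(y, q). Trf y \<oplus>\<^bsub>Tr R PA1 dA PA0\<^esub> h2 q) \<and>
      (\<lambda>(y, q). Trf y \<oplus>\<^bsub>Tr R PA1 dA PA0\<^esub> h2 q) ` carrier (dsum (Tr R PB1 dB PB0) Q) =
        carrier (Tr R PA1 dA PA0)) \<and>
    (\<forall>(P :: nat \<Rightarrow> ('a, 'p) module) d e.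
      proj_resolution R P d e C \<and>
      carrier (Ext R 1 P d (reg_mod R)) = {\<zero>\<^bsub>Ext R 1 P d (reg_mod R)\<^esub>} \<longrightarrow>
      S_obj R (Tr_M R F1 \<delta> F0))"
proof -
  interpret cring R by fact
  have A: "module R A" and B: "module R B" and fh: "f \<in> mod_hom R A B" and inj: "inj_on f (carrier A)"
    using f by (simp_all add: S_obj_def M_obj_def fg_module_def)
  note Cok = module_Cok[OF A B fh, folded C g]
  have ker: "a_kernel B C g = f ` carrier A"
    using Cok(4) mod_hom_closed[OF fh] by auto
  note f = fh and C = Cok(1) and g = Cok(2) and onto = Cok(3)
  have proj: "M_projective R F1" "M_projective R F0"
    using presf by (simp_all add: M_min_pres_def M_proj_cover_def)
  \<comment> \<open>\<open>Q1\<close> and \<open>Q0\<close> belong to the summands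
    \<open>0 \<rightarrow> Q\<close> of the two projective objects; the projective module of the
    statement is the \<open>N\<close> constructed below.\<close>
  obtain Q1 :: "('a, nat \<Rightarrow> 'a) module" and r1 p1 j1 where F1: "splits F1 Q1 r1 p1 j1"
    by (rule M_projective_splits[OF proj(1)])
  obtain Q0 :: "('a, nat \<Rightarrow> 'a) module" and r0 p0 j0 where F0: "splits F0 Q0 r0 p0 j0"
    by (rule M_projective_splits[OF proj(2)])
  note s1 = splitsD[OF F1] and s0 = splitsD[OF F0]
  let ?X1 = "src F1" and ?Y1 = "tgt F1" and ?X0 = "src F0" and ?Y0 = "tgt F0"
  let ?d = "fst \<delta>" and ?m = "snd \<delta>" and ?e = "fst \<epsilon>" and ?k = "snd \<epsilon>"
  let ?dQ = "\<lambda>z. p0 (?m (j1 z))" and ?eQ = "\<lambda>z. g (?k (j0 z))"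
  note pres = M_min_pres_splits[OF presf F0 F1 A B f inj C g onto ker]
  note pX = min_pres_presentation[OF pres(1) A] and pQ = min_pres_presentation[OF pres(2) C]
    and pY = pres(3)
  note pA = min_pres_presentation[OF presA A] and pB = min_pres_presentation[OF presB B]
    and pC = min_pres_presentation[OF presC C]
  have d: "?d \<in> mod_hom R ?X1 ?X0" and m: "?m \<in> mod_hom R ?Y1 ?Y0"
    using pX pY by (simp_all add: presentation_def)
  have e: "?e \<in> mod_hom R ?X0 A" and k: "?k \<in> mod_hom R ?Y0 B"
    using pX pY by (simp_all add: presentation_def)
  have "(?d, ?m) \<in> M_hom R F1 F0" using d m pres(4) by (rule M_homI)
  then have \<delta>: "\<delta> \<in> M_hom R F1 F0" by simp
  have dQ: "?dQ \<in> mod_hom R Q1 Q0" using pQ by (simp add: presentation_def)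
  have mA: "module R PA1" "module R PA0" and dA: "dA \<in> mod_hom R PA1 PA0"
    and mB: "module R PB1" "module R PB0" and dB: "dB \<in> mod_hom R PB1 PB0"
    and mC: "module R PC1" "module R PC0" and dC: "dC \<in> mod_hom R PC1 PC0"
    using pA pB pC by (simp_all add: presentation_def fg_projective_module)
  let ?T = "Tr_M R F1 \<delta> F0"
  let ?TA = "Tr R PA1 dA PA0" and ?TB = "Tr R PB1 dB PB0" and ?TC = "Tr R PC1 dC PC0"
  let ?TX = "Tr R ?X1 ?d ?X0" and ?qX = "Tr_class ?X1 ?d ?X0"
  let ?qA = "Tr_class PA1 dA PA0" and ?qB = "Tr_class PB1 dB PB0" and ?qC = "Tr_class PC1 dC PC0"
  let ?qY = "Tr_M_class F1 \<delta> F0" and ?qQ = "Tr_M_class0 F1 \<delta> F0 p1"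
  have TA: "transp PA1 dA PA0 ?TA ?qA" by (rule transp_Tr[OF mA dA])
  have TB: "transp PB1 dB PB0 ?TB ?qB" by (rule transp_Tr[OF mB dB])
  have TC: "transp PC1 dC PC0 ?TC ?qC" by (rule transp_Tr[OF mC dC])
  have TY: "transp ?Y1 ?m ?Y0 (tgt ?T) ?qY"
    by (rule transp_Tr_M_tgt[OF s1(4,5,7) s0(4,5,7) \<delta>])
  have TQ: "transp Q1 ?dQ Q0 (src ?T) ?qQ"
    by (rule transp_Tr_M_src[OF F1 F0 \<delta>]) (rule pres(7))
  have TX: "transp ?X1 ?d ?X0 ?TX ?qX"
    by (rule transp_Tr[OF s1(4) s0(4) d])
  note mTA = transpD(1)[OF TA] and mTB = transpD(1)[OF TB]
    and mTY = transpD(1)[OF TY] and mTQ = transpD(1)[OF TQ] and mTX = transpD(1)[OF TX]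
  have pm: "?dQ (p1 y) = p0 (?m y)" if "y \<in> carrier ?Y1" for y by (rule pres(7)[OF that])
  have I: "arr ?T (?qQ \<phi>) = ?qY (\<lambda>y. \<phi> (p1 y))" if "\<phi> \<in> fnl Q1" for \<phi>
    by (rule arr_Tr_M[OF F1 F0 \<delta> that])
  \<comment> \<open>On classes \<open>arr ?T\<close> agrees with the map of transposes induced by
    \<open>p1\<close> and \<open>p0\<close>, and from this it inherits linearity.\<close>
  have Ihom: "arr ?T \<in> mod_hom R (src ?T) (tgt ?T)"
  proof -
    obtain I' where I': "I' \<in> mod_hom R (src ?T) (tgt ?T)"
      "\<And>\<phi>. \<phi> \<in> fnl Q1 \<Longrightarrow> I' (?qQ \<phi>) = ?qY (\<lambda>y. \<phi> (p1 y))"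
      using transp_map[where ?c1.0 = p1 and ?c0.0 = p0, OF TY TQ s1(6) s1(9) s0(9) pm] by blast
    show ?thesis
    proof (rule mod_hom_cong[OF I'(1) mTQ])
      fix t assume "t \<in> carrier (src ?T)"
      then obtain \<phi> where \<phi>: "\<phi> \<in> fnl Q1" "t = ?qQ \<phi>" using transpD(5)[OF TQ] by blast
      show "arr ?T t = I' t" unfolding \<phi>(2) I[OF \<phi>(1)] I'(2)[OF \<phi>(1)] ..
    qed
  qed

  \<comment> \<open>Comparison with the presentations fixed in the statement. Over \<open>A\<close>
    and \<open>C\<close> both sides are minimal and the degree 1 comparisons are isomorphisms; over
    \<open>B\<close> there is only a retraction.\<close>
  obtain a1 a0 a1' a0' where ra: "retraction R PA1 dA PA0 eA ?X1 ?d ?X0 ?e a1 a0 a1' a0'"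
    by (rule min_pres_retract[OF presA pX])
  obtain s1' s0' b1 b0 where rb: "retraction R PB1 dB PB0 eB ?Y1 ?m ?Y0 ?k s1' s0' b1 b0"
    by (rule min_pres_retract[OF presB pY])
  obtain c1 c0 c1' c0' where rc: "retraction R PC1 dC PC0 eC Q1 ?dQ Q0 ?eQ c1 c0 c1' c0'"
    by (rule min_pres_retract[OF presC pQ])
  note a = retractionD[OF ra] and b = retractionD[OF rb] and c = retractionD[OF rc]
  note aa = min_pres_retraction_iso[OF ra pres(1) A] and cc = min_pres_retraction_iso[OF rc pres(2) C]

  \<comment> \<open>Each map of transposes is fixed by its effect on functionals. \<open>S\<close>
    and \<open>D\<close> are the projection to \<open>Tr B\<close> and its inclusion,
    \<open>U\<close> and \<open>V\<close> identify the source with \<open>Tr C\<close>,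
    \<open>W\<close> and \<open>W'\<close> identify \<open>?TX\<close> with \<open>Tr A\<close>, and
    \<open>J\<close> is dual to \<open>arr F1\<close>.\<close>
  obtain S where S: "S \<in> mod_hom R (tgt ?T) ?TB" "\<And>\<phi>. \<phi> \<in> fnl ?Y1 \<Longrightarrow> S (?qY \<phi>) = ?qB (\<lambda>x. \<phi> (s1' x))"
    using transp_map[where ?c1.0 = s1' and ?c0.0 = s0', OF TB TY s1(5) b(1,2,7)] by blast
  obtain D where D: "D \<in> mod_hom R ?TB (tgt ?T)" "\<And>\<phi>. \<phi> \<in> fnl PB1 \<Longrightarrow> D (?qB \<phi>) = ?qY (\<lambda>x. \<phi> (b1 x))"
    using transp_map[where ?c1.0 = b1 and ?c0.0 = b0, OF TY TB mB(1) b(3,4,8)] by blast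
  obtain U where U: "U \<in> mod_hom R (src ?T) ?TC" "\<And>\<phi>. \<phi> \<in> fnl Q1 \<Longrightarrow> U (?qQ \<phi>) = ?qC (\<lambda>x. \<phi> (c1 x))"
    using transp_map[where ?c1.0 = c1 and ?c0.0 = c0, OF TC TQ s1(6) c(1,2,7)] by blast
  obtain V where V: "V \<in> mod_hom R ?TC (src ?T)" "\<And>\<phi>. \<phi> \<in> fnl PC1 \<Longrightarrow> V (?qC \<phi>) = ?qQ (\<lambda>x. \<phi> (c1' x))"
    using transp_map[where ?c1.0 = c1' and ?c0.0 = c0', OF TQ TC mC(1) c(3,4,8)] by blast
  obtain W where W: "W \<in> mod_hom R ?TX ?TA"
    "\<And>\<phi>. \<phi> \<in> fnl ?X1 \<Longrightarrow> W (?qX \<phi>) = ?qA (\<lambda>x. \<phi> (a1 x))"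
    using transp_map[where ?c1.0 = a1 and ?c0.0 = a0, OF TA TX s1(4) a(1,2,7)] by blast
  obtain W' where W': "W' \<in> mod_hom R ?TA ?TX"
    "\<And>\<phi>. \<phi> \<in> fnl PA1 \<Longrightarrow> W' (?qA \<phi>) = ?qX (\<lambda>x. \<phi> (a1' x))"
    using transp_map[where ?c1.0 = a1' and ?c0.0 = a0', OF TX TA mA(1) a(3,4,8)] by blast
  obtain J where J: "J \<in> mod_hom R (tgt ?T) ?TX"
    "\<And>\<phi>. \<phi> \<in> fnl ?Y1 \<Longrightarrow> J (?qY \<phi>) = ?qX (\<lambda>x. \<phi> (arr F1 x))"
    using transp_map[where ?c1.0 = "arr F1" and ?c0.0 = "arr F0", OF TX TY s1(5) s1(7) s0(7) pres(4)] by blast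
  have UV: "U (V t) = t" if "t \<in> carrier ?TC" for t
    by (rule transp_map_inverse[where S = "U" and D = "V" and qQ = "?qQ" and q = "?qC",
        OF TC c(1,3,10) U(2) V(2) that])
  have VU: "V (U t) = t" if "t \<in> carrier (src ?T)" for t
    by (rule transp_map_inverse[where S = "V" and D = "U" and qQ = "?qC" and q = "?qQ",
        OF TQ c(3,1) cc V(2) U(2) that])
  have WW': "W (W' t) = t" if "t \<in> carrier ?TA" for t
    by (rule transp_map_inverse[where S = "W" and D = "W'" and qQ = "?qX" and q = "?qA",
        OF TA a(1,3,10) W(2) W'(2) that])
  have W'W: "W' (W t) = t" if "t \<in> carrier ?TX" for t
    by (rule transp_map_inverse[where S = "W'" and D = "W" and qQ = "?qA" and q = "?qX",
        OF TX a(3,1) aa W'(2) W(2) that])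
  note ex = transp_exact[OF F1 F0 \<delta> TY TX TQ I J]

  obtain N :: "('a, nat \<Rightarrow> 'a) module" and \<iota> \<kappa> where N: "fg_projective R N"
    and \<iota>: "\<iota> \<in> mod_hom R (tgt ?T) N" and \<kappa>: "\<kappa> \<in> mod_hom R N (tgt ?T)"
    and \<iota>\<kappa>: "\<And>n. n \<in> carrier N \<Longrightarrow> \<iota> (\<kappa> n) = n"
    and sum: "\<And>t. t \<in> carrier (tgt ?T) \<Longrightarrow> \<kappa> (\<iota> t) \<oplus>\<^bsub>tgt ?T\<^esub> D (S t) = t"
    and SD: "\<And>t. t \<in> carrier ?TB \<Longrightarrow> S (D t) = t"
  proof (rule transp_complement[OF pY b(1-8,10) TY TB S D])
    fix N :: "('a, nat \<Rightarrow> 'a) module" and \<iota> \<kappa>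
    assume h: "fg_projective R N" "\<iota> \<in> mod_hom R (tgt ?T) N" "\<kappa> \<in> mod_hom R N (tgt ?T)"
      "\<And>n. n \<in> carrier N \<Longrightarrow> \<iota> (\<kappa> n) = n"
      "\<And>t. t \<in> carrier (tgt ?T) \<Longrightarrow> \<kappa> (\<iota> t) \<oplus>\<^bsub>tgt ?T\<^esub> D (S t) = t"
      "\<And>t. t \<in> carrier ?TB \<Longrightarrow> S (D t) = t"
    show thesis by (rule that[OF h])
  qed
  have mN: "module R N" using N by (rule fg_projective_module)
  note cl = mod_hom_closed[OF S(1)] mod_hom_closed[OF D(1)] mod_hom_closed[OF \<iota>] mod_hom_closed[OF \<kappa>]
    mod_hom_closed[OF U(1)] mod_hom_closed[OF V(1)] mod_hom_closed[OF W(1)] mod_hom_closed[OF W'(1)]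
    mod_hom_closed[OF J(1)] mod_hom_closed[OF Ihom]
  \<comment> \<open>Orthogonality of the two summands follows from the decomposition of the
    identity: at \<open>\<kappa> n\<close> its first term is already \<open>\<kappa> n\<close>, so
    \<open>D (S (\<kappa> n))\<close> is zero, and \<open>D\<close> is injective.
    \<open>\<iota>D\<close> is the symmetric statement.\<close>
  have S\<kappa>: "S (\<kappa> n) = \<zero>\<^bsub>?TB\<^esub>" if n: "n \<in> carrier N" for n
  proof -
    have "\<kappa> n \<oplus>\<^bsub>tgt ?T\<^esub> D (S (\<kappa> n)) = \<kappa> n \<oplus>\<^bsub>tgt ?T\<^esub> \<zero>\<^bsub>tgt ?T\<^esub>"
      using sum[of "\<kappa> n"] n cl mTY by (simp add: \<iota>\<kappa>)
    then have "D (S (\<kappa> n)) = \<zero>\<^bsub>tgt ?T\<^esub>"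
      using n cl mTY by (simp add: mod_add_cancel_left del: mod_add_zero)
    then have "S (D (S (\<kappa> n))) = \<zero>\<^bsub>?TB\<^esub>" using mod_hom_zero[OF S(1) mTY mTB] by simp
    then show ?thesis using SD n cl by simp
  qed
  have \<iota>D: "\<iota> (D t) = \<zero>\<^bsub>N\<^esub>" if t: "t \<in> carrier ?TB" for t
  proof -
    have "\<kappa> (\<iota> (D t)) \<oplus>\<^bsub>tgt ?T\<^esub> D t = \<zero>\<^bsub>tgt ?T\<^esub> \<oplus>\<^bsub>tgt ?T\<^esub> D t"
      using sum[of "D t"] t cl mTY by (simp add: SD)
    then have "D t \<oplus>\<^bsub>tgt ?T\<^esub> \<kappa> (\<iota> (D t)) = D t \<oplus>\<^bsub>tgt ?T\<^esub> \<zero>\<^bsub>tgt ?T\<^esub>"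
      using t cl mTY by (simp add: mod_add_commute[OF mTY])
    then have "\<kappa> (\<iota> (D t)) = \<zero>\<^bsub>tgt ?T\<^esub>"
      using t cl mTY by (simp add: mod_add_cancel_left del: mod_add_zero)
    then have "\<iota> (\<kappa> (\<iota> (D t))) = \<zero>\<^bsub>N\<^esub>" using mod_hom_zero[OF \<iota> mTY mN] by simp
    then show ?thesis using \<iota>\<kappa> t cl by simp
  qed
  \<comment> \<open>The maps \<open>arr ?T\<close> and \<open>J\<close>, read through the
    identifications of the outer terms and through the decomposition of the middle term into
    \<open>Tr B\<close> and \<open>N\<close>.\<close>
  define Trf where "Trf t = W (J (D t))" for t
  define Trg where "Trg t = S (arr ?T (V t))" for t
  define h1 where "h1 t = \<iota> (arr ?T (V t))" for t
  define h2 where "h2 n = W (J (\<kappa> n))" for n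
  have WJ: "(\<lambda>t. W (J t)) \<in> mod_hom R (tgt ?T) ?TA" by (rule mod_hom_comp[OF J(1) W(1)])
  have IV: "(\<lambda>t. arr ?T (V t)) \<in> mod_hom R ?TC (tgt ?T)" by (rule mod_hom_comp[OF V(1) Ihom])
  have Trf: "Trf \<in> mod_hom R ?TB ?TA" unfolding Trf_def by (rule mod_hom_comp[OF D(1) WJ])
  have h1: "h1 \<in> mod_hom R ?TC N" unfolding h1_def by (rule mod_hom_comp[OF IV \<iota>])
  have h2: "h2 \<in> mod_hom R N ?TA" unfolding h2_def by (rule mod_hom_comp[OF \<kappa> WJ])

  \<comment> \<open>The lift of \<open>f\<close> passes through the large presentation: from that of
    \<open>A\<close> to the sources, along \<open>arr F1\<close> and \<open>arr F0\<close> to the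
    targets, and back to that of \<open>B\<close>. The lift of \<open>g\<close> below runs in the
    same manner through \<open>p1\<close> and \<open>p0\<close>.\<close>
  have isTrf: "is_Tr_map R PA1 dA PA0 eA PB1 dB PB0 eB f Trf"
  proof (rule is_Tr_map_Tr_class[OF mA dA mB dB])
    show "(\<lambda>x. b1 (arr F1 (a1 x))) \<in> mod_hom R PA1 PB1"
      by (rule mod_hom_comp[OF mod_hom_comp[OF a(1) s1(7)] b(3)])
    show "(\<lambda>x. b0 (arr F0 (a0 x))) \<in> mod_hom R PA0 PB0"
      by (rule mod_hom_comp[OF mod_hom_comp[OF a(2) s0(7)] b(4)])
  next
    fix x assume x: "x \<in> carrier PA1"
    show "dB (b1 (arr F1 (a1 x))) = b0 (arr F0 (a0 (dA x)))"
      using mod_hom_closed[OF a(1) x] mod_hom_closed[OF s1(7)] by (simp add: b(8) pres(4) a(7)[OF x])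
  next
    fix x assume x: "x \<in> carrier PA0"
    show "eB (b0 (arr F0 (a0 x))) = f (eA x)"
      using mod_hom_closed[OF a(2) x] mod_hom_closed[OF s0(7)] by (simp add: b(6) pres(5) a(5)[OF x])
  next
    fix \<phi> assume \<phi>: "\<phi> \<in> fnl PB1"
    have \<phi>b: "(\<lambda>x. \<phi> (b1 x)) \<in> fnl ?Y1" by (rule fnl_comp[OF b(3) \<phi>])
    show "Trf (?qB \<phi>) = ?qA (\<lambda>x. \<phi> (b1 (arr F1 (a1 x))))"
      by (simp only: Trf_def D(2)[OF \<phi>] J(2)[OF \<phi>b] W(2)[OF fnl_comp[OF s1(7) \<phi>b]])
  qed
  have isTrg: "is_Tr_map R PB1 dB PB0 eB PC1 dC PC0 eC g Trg"
  proof (rule is_Tr_map_Tr_class[OF mB dB mC dC])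
    show "(\<lambda>x. c1' (p1 (s1' x))) \<in> mod_hom R PB1 PC1"
      by (rule mod_hom_comp[OF mod_hom_comp[OF b(1) s1(9)] c(3)])
    show "(\<lambda>x. c0' (p0 (s0' x))) \<in> mod_hom R PB0 PC0"
      by (rule mod_hom_comp[OF mod_hom_comp[OF b(2) s0(9)] c(4)])
  next
    fix x assume x: "x \<in> carrier PB1"
    show "dC (c1' (p1 (s1' x))) = c0' (p0 (s0' (dB x)))"
      using mod_hom_closed[OF b(1) x] mod_hom_closed[OF s1(9)] by (simp add: c(8) pm b(7)[OF x])
  next
    fix x assume x: "x \<in> carrier PB0"
    show "eC (c0' (p0 (s0' x))) = g (eB x)"
      using mod_hom_closed[OF b(2) x] mod_hom_closed[OF s0(9)] by (simp add: c(6) pres(6) b(5)[OF x])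
  next
    fix \<phi> assume \<phi>: "\<phi> \<in> fnl PC1"
    have \<phi>c: "(\<lambda>x. \<phi> (c1' x)) \<in> fnl Q1" by (rule fnl_comp[OF c(3) \<phi>])
    show "Trg (?qC \<phi>) = ?qB (\<lambda>x. \<phi> (c1' (p1 (s1' x))))"
      by (simp only: Trg_def V(2)[OF \<phi>] I[OF \<phi>c] S(2)[OF fnl_comp[OF s1(9) \<phi>c]])
  qed

  let ?v = "\<lambda>t. (S t, \<iota> t)" and ?v' = "\<lambda>x. \<kappa> (snd x) \<oplus>\<^bsub>tgt ?T\<^esub> D (fst x)"
  have v: "?v \<in> mod_hom R (tgt ?T) (dsum ?TB N)" by (rule mod_hom_Pair[OF S(1) \<iota>])
  have v': "?v' \<in> mod_hom R (dsum ?TB N) (tgt ?T)"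
    by (rule mod_hom_add_fun[OF mod_hom_comp[OF mod_hom_snd \<kappa>] mod_hom_comp[OF mod_hom_fst D(1)] mTY])
  have vv': "?v (?v' x) = x" if mem: "x \<in> carrier (dsum ?TB N)" for x
  proof -
    obtain y n where x: "x = (y, n)" "y \<in> carrier ?TB" "n \<in> carrier N" using mem by auto
    then show ?thesis
      using cl mTB mN by (simp add: mod_hom_add[OF S(1)] mod_hom_add[OF \<iota>] S\<kappa> SD \<iota>\<kappa> \<iota>D)
  qed
  have vbij: "bij_betw ?v (carrier (tgt ?T)) (carrier (dsum ?TB N))"
    by (rule bij_betw_mutual_inverse[OF v v' _ vv']) (simp add: sum)
  have ubij: "bij_betw U (carrier (src ?T)) (carrier ?TC)"
    by (rule bij_betw_mutual_inverse[OF U(1) V(1) VU UV])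
  have iso: "M_iso R ?T \<lparr>src = ?TC, tgt = dsum ?TB N, arr = (\<lambda>x. (Trg x, h1 x))\<rparr>"
    unfolding M_iso_def
  proof (rule bexI[where x = "(U, ?v)"])
    show "(U, ?v) \<in> M_hom R ?T \<lparr>src = ?TC, tgt = dsum ?TB N, arr = (\<lambda>x. (Trg x, h1 x))\<rparr>"
      using U(1) v by (intro M_homI) (simp_all add: Trg_def h1_def VU)
  qed (use ubij vbij in simp)

  \<comment> \<open>Through the isomorphism \<open>?v\<close> the second map of the sequence becomes
    \<open>W J\<close>, so exactness and surjectivity reduce to the corresponding facts for
    \<open>arr ?T\<close> and \<open>J\<close>.\<close>
  let ?h = "\<lambda>(y, n). Trf y \<oplus>\<^bsub>?TA\<^esub> h2 n"
  have hv: "?h (?v t) = W (J t)" if t: "t \<in> carrier (tgt ?T)" for t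
  proof -
    have "W (J t) = W (J (\<kappa> (\<iota> t) \<oplus>\<^bsub>tgt ?T\<^esub> D (S t)))" by (simp only: sum[OF t])
    also have "\<dots> = h2 (\<iota> t) \<oplus>\<^bsub>?TA\<^esub> Trf (S t)"
      using mod_hom_add[OF WJ, of "\<kappa> (\<iota> t)" "D (S t)"] t cl by (simp add: h2_def Trf_def)
    also have "\<dots> = Trf (S t) \<oplus>\<^bsub>?TA\<^esub> h2 (\<iota> t)"
      using t cl by (intro mod_add_commute[OF mTA] mod_hom_closed[OF Trf] mod_hom_closed[OF h2])
    finally show ?thesis by simp
  qed
  have vonto: "carrier (dsum ?TB N) = ?v ` carrier (tgt ?T)" using vbij by (simp only: bij_betw_def)
  have Vonto: "carrier (src ?T) = V ` carrier ?TC"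
  proof
    show "carrier (src ?T) \<subseteq> V ` carrier ?TC"
    proof
      fix t assume t: "t \<in> carrier (src ?T)"
      show "t \<in> V ` carrier ?TC" by (rule image_eqI[where f = V, OF VU[OF t, symmetric] cl(5)[OF t]])
    qed
  qed (use cl(6) in blast)
  have WJ0: "W (J t) = \<zero>\<^bsub>?TA\<^esub> \<longleftrightarrow> J t = \<zero>\<^bsub>?TX\<^esub>" if t: "t \<in> carrier (tgt ?T)" for t
    using W'W[OF cl(9)[OF t]] mod_hom_zero[OF W(1) mTX mTA] mod_hom_zero[OF W'(1) mTA mTX] by auto
  have exact: "(\<lambda>x. (Trg x, h1 x)) ` carrier ?TC = a_kernel (dsum ?TB N) ?TA ?h"
  proof -
    have "(\<lambda>x. (Trg x, h1 x)) ` carrier ?TC = ?v ` arr ?T ` V ` carrier ?TC"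
      by (simp add: image_image Trg_def h1_def)
    also have "\<dots> = ?v ` a_kernel (tgt ?T) ?TX J" by (simp only: Vonto[symmetric] ex(1))
    also have "\<dots> = a_kernel (dsum ?TB N) ?TA ?h"
    proof
      show "?v ` a_kernel (tgt ?T) ?TX J \<subseteq> a_kernel (dsum ?TB N) ?TA ?h"
      proof
        fix x assume "x \<in> ?v ` a_kernel (tgt ?T) ?TX J"
        then obtain t where t: "t \<in> carrier (tgt ?T)" "J t = \<zero>\<^bsub>?TX\<^esub>" "x = ?v t" by auto
        have "?h x = \<zero>\<^bsub>?TA\<^esub>" unfolding t(3) hv[OF t(1)] WJ0[OF t(1)] by (rule t(2))
        then show "x \<in> a_kernel (dsum ?TB N) ?TA ?h" using mod_hom_closed[OF v t(1)] unfolding a_kernel_iff t(3) by (intro conjI)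
      qed
      show "a_kernel (dsum ?TB N) ?TA ?h \<subseteq> ?v ` a_kernel (tgt ?T) ?TX J"
      proof
        fix x assume x: "x \<in> a_kernel (dsum ?TB N) ?TA ?h"
        then have "x \<in> ?v ` carrier (tgt ?T)" unfolding vonto[symmetric] by simp
        then obtain t where t: "t \<in> carrier (tgt ?T)" "x = ?v t" by blast
        have "?h (?v t) = \<zero>\<^bsub>?TA\<^esub>" using x unfolding a_kernel_iff t(2) by (rule conjunct2)
        then have "J t = \<zero>\<^bsub>?TX\<^esub>" unfolding hv[OF t(1)] WJ0[OF t(1)] .
        then have "t \<in> a_kernel (tgt ?T) ?TX J" using t(1) by simp
        with t(2) show "x \<in> ?v ` a_kernel (tgt ?T) ?TX J" by (rule image_eqI[where f = ?v])
      qed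
    qed
    finally show ?thesis .
  qed
  have "?h ` carrier (dsum ?TB N) = (\<lambda>t. ?h (?v t)) ` carrier (tgt ?T)"
    unfolding vonto by (rule image_image)
  also have "\<dots> = (\<lambda>t. W (J t)) ` carrier (tgt ?T)" by (rule image_cong[OF refl hv])
  also have "\<dots> = W ` carrier ?TX" by (simp only: ex(2)[symmetric] image_image)
  also have "\<dots> = carrier ?TA"
  proof
    show "carrier ?TA \<subseteq> W ` carrier ?TX"
    proof
      fix t assume t: "t \<in> carrier ?TA"
      show "t \<in> W ` carrier ?TX"
        by (rule image_eqI[where f = W, OF WW'[OF t, symmetric] cl(8)[OF t]])
    qed
  qed (use cl(7) in blast)
  finally have surj: "?h ` carrier (dsum ?TB N) = carrier ?TA" .
  have part2: "S_obj R ?T" if res: "proj_resolution R P dP eP C"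
    and Ext: "carrier (Ext R 1 P dP (reg_mod R)) = {\<zero>\<^bsub>Ext R 1 P dP (reg_mod R)\<^esub>}"
  for P :: "nat \<Rightarrow> ('a, 'p) module" and dP eP
  proof -
    have eX: "?e ` carrier ?X0 = carrier A" and kX: "?d ` carrier ?X1 = a_kernel ?X0 A ?e"
      using pX by (simp_all add: presentation_def)
    have km: "?k (?m y) = \<zero>\<^bsub>B\<^esub>" if "y \<in> carrier ?Y1" for y
    proof -
      have "?m y \<in> a_kernel ?Y0 B ?k" using pY that by (auto simp: presentation_def)
      then show ?thesis by simp
    qed
    \<comment> \<open>If the class of \<phi> is killed, then \<open>\<phi> p1\<close> is the
      pullback of some \<psi> along \<open>?m\<close>. The class of \<phi> itself is zero once
      \<psi> can be replaced by a functional that vanishes on \<open>src F0\<close> and hence comes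
      from \<open>Q0\<close>.\<close>
    have inj0: "t = \<zero>\<^bsub>src ?T\<^esub>" if t: "t \<in> carrier (src ?T)" and t0: "arr ?T t = \<zero>\<^bsub>tgt ?T\<^esub>" for t
    proof -
      obtain \<phi> where \<phi>: "\<phi> \<in> fnl Q1" "t = ?qQ \<phi>" using transpD(5)[OF TQ t] by blast
      have \<phi>p: "(\<lambda>y. \<phi> (p1 y)) \<in> fnl ?Y1" by (rule fnl_comp[OF s1(9) \<phi>(1)])
      have "?qY (\<lambda>y. \<phi> (p1 y)) = \<zero>\<^bsub>tgt ?T\<^esub>" using t0 unfolding \<phi>(2) I[OF \<phi>(1)] .
      then obtain \<psi> where \<psi>: "\<psi> \<in> fnl ?Y0" and \<phi>\<psi>: "\<And>y. y \<in> carrier ?Y1 \<Longrightarrow> \<phi> (p1 y) = \<psi> (?m y)"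
        unfolding transpD(6)[OF TY \<phi>p] by blast
      have \<psi>F: "(\<lambda>x. \<psi> (arr F0 x)) \<in> fnl ?X0" by (rule fnl_comp[OF s0(7) \<psi>])
      have \<psi>Fd: "\<psi> (arr F0 (?d z)) = \<zero>\<^bsub>R\<^esub>" if z: "z \<in> carrier ?X1" for z
      proof -
        have "\<psi> (arr F0 (?d z)) = \<phi> (p1 (arr F1 z))"
          using \<phi>\<psi>[OF mod_hom_closed[OF s1(7) z]] by (simp add: pres(4)[OF z])
        then show ?thesis by (simp add: s1(12)[OF z] fnl_at_zero[OF \<phi>(1) s1(6)])
      qed
      \<comment> \<open>The restriction of \<psi> to \<open>src F0\<close> vanishes on the image of
        \<open>?d\<close>, which is the kernel of \<open>?e\<close>, and so descends to
        \<open>A\<close>. The functional \<chi> obtained there measures the failure of \<psi> to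
        come from \<open>Q0\<close>.\<close>
      have "\<exists>\<chi>\<in>fnl A. \<forall>x\<in>carrier ?X0. \<chi> (?e x) = \<psi> (arr F0 x)"
      proof (rule mod_hom_factor[OF s0(4) A module_reg_mod e \<psi>F eX])
        fix x assume "x \<in> carrier ?X0" "?e x = \<zero>\<^bsub>A\<^esub>"
        then have "x \<in> ?d ` carrier ?X1" unfolding kX by simp
        then obtain z where "z \<in> carrier ?X1" "x = ?d z" by blast
        then show "\<psi> (arr F0 x) = \<zero>\<^bsub>reg_mod R\<^esub>" using \<psi>Fd by simp
      qed
      then obtain \<chi> where \<chi>: "\<chi> \<in> fnl A" "\<And>x. x \<in> carrier ?X0 \<Longrightarrow> \<chi> (?e x) = \<psi> (arr F0 x)" by blast
      obtain \<omega> where \<omega>: "\<omega> \<in> fnl B" "\<And>x. x \<in> carrier A \<Longrightarrow> \<omega> (f x) = \<chi> x"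
        by (rule Ext_zero_extends[OF A B C f inj g onto ker res Ext \<chi>(1)]) (rule that)
      have \<omega>k: "(\<lambda>y. \<omega> (?k y)) \<in> fnl ?Y0" by (rule fnl_comp[OF k \<omega>(1)])
      \<comment> \<open>Subtracting \<omega> after \<open>?k\<close> leaves the pullback along
        \<open>?m\<close> unchanged, because \<open>?k ?m\<close> is zero, and makes the functional
        vanish on \<open>src F0\<close>, because \<omega> extends \<chi>.\<close>
      define \<psi>' where "\<psi>' y = \<psi> y \<ominus>\<^bsub>R\<^esub> \<omega> (?k y)" for y
      have \<psi>': "\<psi>' \<in> fnl ?Y0" unfolding \<psi>'_def by (rule fnl_diff[OF \<psi> \<omega>k s0(5)])
      have \<psi>'F: "\<psi>' (arr F0 x) = \<zero>\<^bsub>R\<^esub>" if x: "x \<in> carrier ?X0" for x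
        using fnl_closed[OF \<psi>F x]
        by (simp add: \<psi>'_def pres(5)[OF x] \<omega>(2)[OF mod_hom_closed[OF e x]] \<chi>(2)[OF x] r_right_minus_eq)
      have "\<phi> z = \<psi>' (j0 (?dQ z))" if z: "z \<in> carrier Q1" for z
      proof -
        have jz: "j1 z \<in> carrier ?Y1" by (rule mod_hom_closed[OF s1(10) z])
        have mj: "?m (j1 z) \<in> carrier ?Y0" by (rule mod_hom_closed[OF m jz])
        have "\<phi> z = \<psi> (?m (j1 z))" using \<phi>\<psi>[OF jz] by (simp add: s1(14)[OF z])
        also have "\<dots> = \<psi>' (?m (j1 z))"
          using fnl_closed[OF \<psi> mj] by (simp add: \<psi>'_def km[OF jz] fnl_at_zero[OF \<omega>(1) B] minus_eq)
        also have "\<dots> = \<psi>' (j0 (?dQ z))" by (rule fnl_splits[OF F0 \<psi>' \<psi>'F mj, symmetric])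
        finally show ?thesis .
      qed
      then show ?thesis
        unfolding \<phi>(2) transpD(6)[OF TQ \<phi>(1)] using fnl_comp[OF s0(10) \<psi>']
        by (intro bexI[of _ "\<lambda>z. \<psi>' (j0 z)"]) simp_all
    qed
    have "inj_on (arr ?T) (carrier (src ?T))"
    proof (rule inj_onI)
      fix s t assume st: "s \<in> carrier (src ?T)" "t \<in> carrier (src ?T)" "arr ?T s = arr ?T t"
      have "arr ?T (s \<ominus>\<^bsub>src ?T\<^esub> t) = \<zero>\<^bsub>tgt ?T\<^esub>"
        using st mod_hom_closed[OF Ihom] mTQ mTY by (simp add: mod_hom_diff[OF Ihom mTQ mTY])
      then have "s \<ominus>\<^bsub>src ?T\<^esub> t = \<zero>\<^bsub>src ?T\<^esub>" using st mTQ by (intro inj0) simp_all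
      then show "s = t" using st mTQ by simp
    qed
    moreover have "fg_module R (src ?T)" by (rule transp_fg_module[OF TQ s1(3)])
    moreover have "fg_module R (tgt ?T)" by (rule transp_fg_module[OF TY s1(2)])
    ultimately show ?thesis using Ihom by (simp add: S_obj_def M_obj_def)
  qed
  show ?thesis
    by (rule conjI, rule exI[of _ N], rule exI[of _ Trf], rule exI[of _ Trg], rule exI[of _ h1],
        rule exI[of _ h2], intro conjI N isTrf isTrg h1 h2 iso exact surj,
        intro allI impI, elim conjE, rule part2)
qed

end
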